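(* Let $(X,d,\mu)$ be a complete metric measure space with $\mu$ doubling, let $1<p<\infty$, assume that $X$ supports a $p$-Poincaré inequality, and let $Q>0$ be an order for which $X$ has relative lower volume decay. Let $1<q<p$, and let $u\in N^{1,p}(X)$ be defined pointwise everywhere by $$u(x)=\limsup_{r\to 0}\frac{1}{\mu(B(x,r))}\int_{B(x,r)}u\,d\mu ,\qquad x\in X.$$ Suppose that one of the following holds: $p<Q$ and $0<h\le\frac{Qp}{Q-p}$; or $p=Q$ and $h>0$; or $p>Q$ and $h>0$. Then $$\int_0^{1}\left(\frac{1}{\mu(B(x,r))}\int_{B(x,r)}|u-u(x)|^h\,d\mu\right)^{\frac{p}{h(p-1)}}\frac{dr}{r}<\infty\quad\text{for } q\text{-q.e. } x\in X,$$ $$\sum_{k=1}^{\infty}\left(\frac{1}{\mu(B(x,2^{-k}))}\int_{B(x,2^{-k})}|u-u(x)|^h\,d\mu\right)^{\frac{p}{h(p-1)}}<\infty\quad\text{for } q\text{-q.e. } x\in X,$$ and $$\lim_{r\to0}\frac{1}{\mu(B(x,r))}\int_{B(x,r)}|u-u(x)|^h\,d\mu=0\quad\text{for } q\text{-q.e. } x\in X.$$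
   Context: $X=(X,d,\mu)$ is a complete metric space with a positive Borel regular measure $\mu$ such that $0<\mu(B)<\infty$ for every open ball $B=B(x,r)$, and $\mu$ is doubling: there is $C_\mu>0$ with $\mu(2B)\le C_\mu\mu(B)$ for all balls $B$. Here $\sigma B$ denotes the ball with the same centre as $B$ and $\sigma$ times its radius. Relative lower volume decay of order $Q>0$: there is $C>0$ such that $\frac{\mu(B(y,r))}{\mu(B(x,R))}\ge C\left(\frac rR\right)^Q$ whenever $x\in X$, $y\in B(x,R)$ and $0<r\le R<\infty$. Curves are non-constant, compact and rectifiable, parameterized by arc length $ds$. For $1<s<\infty$, a property holds for $s$-almost every curve if there is a non-negative Borel function $\rho\in L^s(X)$ with $\int_\gamma\rho\,ds=\infty$ for every curve $\gamma$ for which the property fails. A non-negative Borel function $g$ on $X$ is an upper gradient of $u:X\to\mathbb R$ if $|u(\gamma(0))-u(\gamma(l))|\le\int_\gamma g\,ds$ for all curves $\gamma:[0,l]\to X$; it is an $s$-weak upper gradient if this holds for $s$-almost every curve. $X$ supports a $p$-Poincaré inequality if there are constants $C>0$ and $\sigma\ge1$ such that for all balls $B\subset X$, all integrable functions $u$ on $X$ and all $p$-weak upper gradients $g$ of $u$, $\frac1{\mu(B)}\int_B|u-u_B|\,d\mu\le C\,\mathrm{diam}(B)\left(\frac1{\mu(\sigma B)}\int_{\sigma B}g^p\,d\mu\right)^{1/p}$, where $u_B=\frac1{\mu(B)}\int_Bu\,d\mu$. Newton-Sobolev space: for $1<s<\infty$, $\tilde N^{1,s}(X)$ is the collection of everywhere-defined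 functions $u\in L^s(X)$ having an upper gradient in $L^s(X)$, with seminorm $\|u\|_{\tilde N^{1,s}(X)}=\left(\int_X|u|^s\,d\mu+\inf_g\int_Xg^s\,d\mu\right)^{1/s}$, the infimum being over all upper gradients $g$ of $u$; $N^{1,s}(X)=\tilde N^{1,s}(X)/\sim$, where $u\sim v$ iff $\|u-v\|_{\tilde N^{1,s}(X)}=0$, with the quotient norm. The $s$-capacity of $E\subset X$ is $C_s(E)=\inf\|u\|_{N^{1,s}(X)}^s$ over all $u\in N^{1,s}(X)$ with $u\ge1$ on $E$. A property holds for $s$-quasievery $x$ ($s$-q.e.) if it holds outside a set of $s$-capacity zero. *)

theory Defs
  imports "HOL-Analysis.Analysis"
begin

section \<open>Metric measure spaces\<close>

text \<open>
  A Borel regular (outer) measure is represented by its restriction \<open>M\<close> to the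
  \<open>\<mu>\<close>-measurable sets: a complete measure whose sigma-algebra contains the Borel sets and
  in which every measurable set has a Borel hull of the same measure.
\<close>

locale doubling_metric_measure_space = complete_measure M
  for M :: "'a::metric_space measure" +
  assumes space_eq: "space M = UNIV"
    and borel_sets: "sets borel \<subseteq> sets M"
    and borel_regular:
      "\<And>A. A \<in> sets M \<Longrightarrow> \<exists>B\<in>sets borel. A \<subseteq> B \<and> emeasure M B = emeasure M A"
    and ball_pos: "\<And>x r. 0 < r \<Longrightarrow> 0 < emeasure M (ball x r)"
    and ball_finite: "\<And>x r. 0 < r \<Longrightarrow> emeasure M (ball x r) < \<infinity>"
    and doubling:
      "\<exists>C>0. \<forall>x r. 0 < r \<longrightarrow> measure M (ball x (2 * r)) \<le> C * measure M (ball x r)"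

definition relative_lower_volume_decay :: "'a::metric_space measure \<Rightarrow> real \<Rightarrow> bool" where
  "relative_lower_volume_decay M Q \<longleftrightarrow>
    (\<exists>C>0. \<forall>x y r R. y \<in> ball x R \<longrightarrow> 0 < r \<longrightarrow> r \<le> R \<longrightarrow>
      measure M (ball y r) / measure M (ball x R) \<ge> C * (r / R) powr Q)"

definition ball_average :: "'a::metric_space measure \<Rightarrow> ('a \<Rightarrow> real) \<Rightarrow> 'a \<Rightarrow> real \<Rightarrow> real" where
  "ball_average M u x r = (LINT y:ball x r|M. u y) / measure M (ball x r)"

definition ball_nn_average ::
    "'a::metric_space measure \<Rightarrow> ('a \<Rightarrow> ennreal) \<Rightarrow> 'a \<Rightarrow> real \<Rightarrow> ennreal" where
  "ball_nn_average M f x r = (\<integral>\<^sup>+y\<in>ball x r. f y \<partial>M) / emeasure M (ball x r)"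

text \<open>Powers of extended non-negative numbers; used only with exponents \<open>a > 0\<close>.\<close>

definition epowr :: "ennreal \<Rightarrow> real \<Rightarrow> ennreal" where
  "epowr t a = (if t = \<infinity> then \<infinity> else ennreal (enn2real t powr a))"


section \<open>Curves and upper gradients\<close>

definition curve_length :: "(real \<Rightarrow> 'a::metric_space) \<Rightarrow> real \<Rightarrow> real \<Rightarrow> ennreal" where
  "curve_length \<gamma> a b =
    (SUP (n, t) \<in> {(n::nat, t::nat \<Rightarrow> real). t 0 = a \<and> t n = b \<and> (\<forall>i<n. t i \<le> t (Suc i))}.
      \<Sum>i<n. ennreal (dist (\<gamma> (t i)) (\<gamma> (t (Suc i)))))"

text \<open>
  A non-constant compact rectifiable curve of length \<open>l\<close>, parameterized by arc length on
  \<open>{0..l}\<close>; since \<open>l\<close> is the length, non-constancy is \<open>0 < l\<close>.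
  Values of \<open>\<gamma>\<close> outside \<open>{0..l}\<close> are irrelevant.
\<close>

definition arc_length_curve :: "real \<Rightarrow> (real \<Rightarrow> 'a::metric_space) \<Rightarrow> bool" where
  "arc_length_curve l \<gamma> \<longleftrightarrow> 0 < l \<and> continuous_on {0..l} \<gamma> \<and>
    (\<forall>a b. 0 \<le> a \<longrightarrow> a \<le> b \<longrightarrow> b \<le> l \<longrightarrow> curve_length \<gamma> a b = ennreal (b - a))"

definition curve_integral :: "real \<Rightarrow> (real \<Rightarrow> 'a) \<Rightarrow> ('a \<Rightarrow> ennreal) \<Rightarrow> ennreal" where
  "curve_integral l \<gamma> g = (\<integral>\<^sup>+t\<in>{0..l}. g (\<gamma> t) \<partial>lborel)"

text \<open>Non-negative Borel functions may take the value \<open>\<infinity>\<close>, as is customary in this theory.\<close>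

definition almost_every_curve ::
    "'a::metric_space measure \<Rightarrow> real \<Rightarrow> (real \<Rightarrow> (real \<Rightarrow> 'a) \<Rightarrow> bool) \<Rightarrow> bool" where
  "almost_every_curve M s P \<longleftrightarrow>
    (\<exists>\<rho>::'a \<Rightarrow> ennreal. \<rho> \<in> borel_measurable borel \<and> (\<integral>\<^sup>+x. epowr (\<rho> x) s \<partial>M) < \<infinity> \<and>
      (\<forall>l \<gamma>. arc_length_curve l \<gamma> \<longrightarrow> \<not> P l \<gamma> \<longrightarrow> curve_integral l \<gamma> \<rho> = \<infinity>))"

definition upper_gradient :: "('a::metric_space \<Rightarrow> real) \<Rightarrow> ('a \<Rightarrow> ennreal) \<Rightarrow> bool" where
  "upper_gradient u g \<longleftrightarrow> g \<in> borel_measurable borel \<and>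
    (\<forall>l \<gamma>. arc_length_curve l \<gamma> \<longrightarrow> ennreal \<bar>u (\<gamma> 0) - u (\<gamma> l)\<bar> \<le> curve_integral l \<gamma> g)"

definition weak_upper_gradient ::
    "'a::metric_space measure \<Rightarrow> real \<Rightarrow> ('a \<Rightarrow> real) \<Rightarrow> ('a \<Rightarrow> ennreal) \<Rightarrow> bool" where
  "weak_upper_gradient M s u g \<longleftrightarrow> g \<in> borel_measurable borel \<and>
    almost_every_curve M s
      (\<lambda>l \<gamma>. ennreal \<bar>u (\<gamma> 0) - u (\<gamma> l)\<bar> \<le> curve_integral l \<gamma> g)"

definition supports_poincare :: "'a::metric_space measure \<Rightarrow> real \<Rightarrow> bool" where
  "supports_poincare M p \<longleftrightarrow>
    (\<exists>C>0. \<exists>\<sigma>\<ge>1. \<forall>x r u g. 0 < r \<longrightarrow> integrable M u \<longrightarrow> weak_upper_gradient M p u g \<longrightarrow>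
      ennreal (ball_average M (\<lambda>y. \<bar>u y - ball_average M u x r\<bar>) x r)
        \<le> ennreal (C * diameter (ball x r)) *
           epowr (ball_nn_average M (\<lambda>y. epowr (g y) p) x (\<sigma> * r)) (1 / p))"


section \<open>Newton-Sobolev functions and capacity\<close>

text \<open>
  \<open>newtonian M s\<close> consists of the everywhere defined functions, i.e. of the representatives of
  the elements of the quotient space \<open>N\<^sup>1\<^sup>,\<^sup>s\<close>, whose quotient norm is the seminorm of any
  representative.  A class satisfies \<open>u \<ge> 1\<close> on \<open>E\<close> if it has a representative that does.
\<close>

definition newtonian :: "'a::metric_space measure \<Rightarrow> real \<Rightarrow> ('a \<Rightarrow> real) set" where
  "newtonian M s =
    {u. u \<in> borel_measurable M \<and> (\<integral>\<^sup>+x. ennreal (\<bar>u x\<bar> powr s) \<partial>M) < \<infinity> \<and>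
        (\<exists>g. upper_gradient u g \<and> (\<integral>\<^sup>+x. epowr (g x) s \<partial>M) < \<infinity>)}"

definition newtonian_norm :: "'a::metric_space measure \<Rightarrow> real \<Rightarrow> ('a \<Rightarrow> real) \<Rightarrow> ennreal" where
  "newtonian_norm M s u =
    epowr ((\<integral>\<^sup>+x. ennreal (\<bar>u x\<bar> powr s) \<partial>M) +
           (INF g\<in>{g. upper_gradient u g}. \<integral>\<^sup>+x. epowr (g x) s \<partial>M)) (1 / s)"

definition capacity :: "'a::metric_space measure \<Rightarrow> real \<Rightarrow> 'a set \<Rightarrow> ennreal" where
  "capacity M s E = (INF u\<in>{u \<in> newtonian M s. \<forall>x\<in>E. 1 \<le> u x}. epowr (newtonian_norm M s u) s)"

definition quasi_everywhere :: "'a::metric_space measure \<Rightarrow> real \<Rightarrow> ('a \<Rightarrow> bool) \<Rightarrow> bool" where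
  "quasi_everywhere M s P \<longleftrightarrow> capacity M s {x. \<not> P x} = 0"

text \<open>
  The limsup of the averages can be infinite at some points, so the pointwise representative is
  extended real valued; it depends only on the equivalence class of \<open>u\<close>.
\<close>

definition limsup_representative ::
    "'a::metric_space measure \<Rightarrow> ('a \<Rightarrow> real) \<Rightarrow> 'a \<Rightarrow> ereal" where
  "limsup_representative M u x = Limsup (at_right 0) (\<lambda>r. ereal (ball_average M u x r))"

text \<open>
  The average of \<open>|u - u(x)|\<^sup>h\<close> over the ball of centre \<open>x\<close> and radius \<open>r\<close>.
  In \<open>ereal\<close>, \<open>\<bar>u y - u x\<bar> = \<infinity>\<close> whenever \<open>u x\<close> or \<open>u y\<close> is infinite.
\<close>

definition mean_oscillation ::
    "'a::metric_space measure \<Rightarrow> real \<Rightarrow> ('a \<Rightarrow> ereal) \<Rightarrow> 'a \<Rightarrow> real \<Rightarrow> ennreal" where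
  "mean_oscillation M h u x r =
    ball_nn_average M (\<lambda>y. epowr (e2ennreal \<bar>u y - u x\<bar>) h) x r"

end

(*
Let N = g^p M for an upper gradient g of u in L^p. Because q < p, far more than the Wolff potential
estimate is available: by the 5r-covering argument the set where r^q N(B(x,r)) / M(B(x,r)) is
unbounded for small r has zero q-capacity, and at every other point x the Poincare inequality makes
the averages of u Hoelder continuous in r with exponent 1 - q/p. Together with the Sobolev-Poincare
inequality this gives a power decay of the mean oscillation at x, from which the three conclusions
are immediate. After enlarging Q one may assume p < Q and h <= Qp/(Q-p).

The Sobolev-Poincare inequality with the critical exponent Qp/(Q-p) is obtained from a weak type
estimate (Hedberg's splitting of the telescoping sum of averages) and Maz'ya's truncation argument,
since the truncation of u between two levels a and b has g 1_{a < u < b} as a weak upper gradient.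
*)
theory Submission
  imports Defs "HOL-Probability.Distribution_Functions"
begin

section \<open>Coverings by balls\<close>

text \<open>One growth condition serves both halves. If N(B(x,\<sigma>r)) <= m r^(-q) M(B(x,r)), the
  right side of the Poincare inequality is at most a constant times r^(1 - q/p), so the telescoping
  sum over dyadic radii is geometric. Where the condition fails for every m, cut-offs at the
  offending balls have q-energy comparable to r^(-q) M(B) < N(B)/m, and disjointness bounds the
  total by a constant times N(X)/m. The obstacle lies in the hypothesis: the Poincare inequality is
  given for functions integrable over all of X and for Borel gradients, whereas a truncation of u
  need not be integrable and its level sets are only M-measurable. Hence truncations are localised
  by cut-offs and level sets are replaced by Borel hulls. After that the gradient is forgotten: the
  estimates concern pairs of a function and a finite measure, so that u and its truncations obey the
  same lemmas. The given function is an arbitrary representative, while the conclusion concerns its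
  limsup representative; that both agree almost everywhere is again deduced from the Poincare
  inequality.\<close>

lemma vitali_covering_centers:
  fixes r :: "'a::metric_space \<Rightarrow> real"
  assumes r: "\<And>y. y \<in> F \<Longrightarrow> 0 < r y \<and> r y \<le> L"
  obtains D where "D \<subseteq> F" "disjoint_family_on (\<lambda>y. ball y (r y)) D"
    "F \<subseteq> (\<Union>y\<in>D. ball y (3 * r y))"
proof -
  define meets where "meets y z \<longleftrightarrow> ball y (r y) \<inter> ball z (r z) \<noteq> {}" for y z
  \<comment> \<open>The last conjunct is the greedy property: a ball that meets a selected ball
    meets one of at least half its own radius. It passes to unions of chains, so Zorn's lemma
    applies.\<close>
  define \<Omega> where "\<Omega> = {D. D \<subseteq> F \<and> disjoint_family_on (\<lambda>y. ball y (r y)) D \<and>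
    (\<forall>y\<in>F. (\<exists>z\<in>D. meets y z) \<longrightarrow> (\<exists>z\<in>D. meets y z \<and> r y \<le> 2 * r z))}"
  have "\<exists>D\<in>\<Omega>. \<forall>X\<in>\<Omega>. D \<subseteq> X \<longrightarrow> X = D"
  proof (rule subset_Zorn')
    fix C assume C: "subset.chain \<Omega> C"
    have 1: "\<Union>C \<subseteq> F"
      using C unfolding subset_chain_def \<Omega>_def by blast
    have 2: "disjoint_family_on (\<lambda>y. ball y (r y)) (\<Union>C)"
      unfolding disjoint_family_on_def
    proof safe
      fix y z w A B
      assume "A \<in> C" "y \<in> A" "B \<in> C" "z \<in> B" "y \<noteq> z" "w \<in> ball y (r y)" "w \<in> ball z (r z)"
      moreover from this C obtain E where "E \<in> C" "y \<in> E" "z \<in> E"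
        unfolding subset_chain_def by blast
      moreover have "disjoint_family_on (\<lambda>y. ball y (r y)) E"
        using C \<open>E \<in> C\<close> unfolding subset_chain_def \<Omega>_def by blast
      ultimately show "w \<in> {}"
        unfolding disjoint_family_on_def by blast
    qed
    have 3: "\<forall>y\<in>F. (\<exists>z\<in>\<Union>C. meets y z) \<longrightarrow> (\<exists>z\<in>\<Union>C. meets y z \<and> r y \<le> 2 * r z)"
    proof safe
      fix y z A
      assume a: "y \<in> F" "z \<in> A" "A \<in> C" "meets y z"
      have "A \<in> \<Omega>" using a C unfolding subset_chain_def by blast
      then have "\<exists>z\<in>A. meets y z \<and> r y \<le> 2 * r z"
        using a unfolding \<Omega>_def by blast
      then show "\<exists>z\<in>\<Union>C. meets y z \<and> r y \<le> 2 * r z" using a by blast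
    qed
    show "\<Union>C \<in> \<Omega>" using 1 2 3 unfolding \<Omega>_def by blast
  qed
  then obtain D where D: "D \<in> \<Omega>" and max: "\<And>X. X \<in> \<Omega> \<Longrightarrow> D \<subseteq> X \<Longrightarrow> X = D" by blast
  have all: "\<exists>z\<in>D. meets y z" if "y \<in> F" for y
  proof (rule ccontr)
    assume "\<not> (\<exists>z\<in>D. meets y z)"
    define T where "T = {x\<in>F. \<not> (\<exists>z\<in>D. meets x z)}"
    have T: "y \<in> T" using that \<open>\<not> (\<exists>z\<in>D. meets y z)\<close> unfolding T_def by blast
    have bdd: "bdd_above (r ` T)" using r unfolding T_def by (intro bdd_aboveI[of _ L]) auto
    have "r y \<le> Sup (r ` T)" using T bdd by (intro cSup_upper) auto
    then have "Sup (r ` T) / 2 < Sup (r ` T)" using r[OF that] by auto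
    \<comment> \<open>Among the balls that meet no selected one, that of \<open>x\<close> has more
      than half the supremal radius, which is finite because of \<open>L\<close>. So
      \<open>insert x D\<close> keeps the greedy property, against maximality.\<close>
    then obtain x where x: "x \<in> T" "Sup (r ` T) / 2 < r x"
      using less_cSup_iff[of "r ` T" "Sup (r ` T) / 2"] T bdd by blast
    have big: "r z < 2 * r x" if "z \<in> T" for z
      using cSup_upper[of "r z" "r ` T"] that bdd x by auto
    have xF: "x \<in> F" "\<And>z. z \<in> D \<Longrightarrow> \<not> meets x z" using x unfolding T_def by auto
    have sym: "meets a b \<longleftrightarrow> meets b a" for a b unfolding meets_def by blast
    have "insert x D \<in> \<Omega>"
      unfolding \<Omega>_def
    proof (intro CollectI conjI)
      show "insert x D \<subseteq> F" using D xF unfolding \<Omega>_def by auto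
      show "disjoint_family_on (\<lambda>y. ball y (r y)) (insert x D)"
        using D xF sym unfolding \<Omega>_def disjoint_family_on_def meets_def by blast
      show "\<forall>y\<in>F. (\<exists>z\<in>insert x D. meets y z) \<longrightarrow> (\<exists>z\<in>insert x D. meets y z \<and> r y \<le> 2 * r z)"
      proof (intro ballI impI)
        fix w assume w: "w \<in> F" "\<exists>z\<in>insert x D. meets w z"
        show "\<exists>z\<in>insert x D. meets w z \<and> r w \<le> 2 * r z"
        proof (cases "\<exists>z\<in>D. meets w z")
          case True
          then show ?thesis using D w unfolding \<Omega>_def by blast
        next
          case False
          then have "w \<in> T" using w unfolding T_def by blast
          then have "r w \<le> 2 * r x" using big by force
          moreover have "meets w x" using False w by blast
          ultimately show ?thesis by blast
        qed
      qed
    qed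
    then have "x \<in> D" using max[of "insert x D"] by blast
    moreover have "meets x x" using r[OF xF(1)] unfolding meets_def by auto
    ultimately show False using xF(2) by blast
  qed
  \<comment> \<open>Only centres are covered: the two radii add up to at most
    \<open>3 * r z\<close>, hence the factor 3 in place of the 5 for whole balls.\<close>
  have "F \<subseteq> (\<Union>y\<in>D. ball y (3 * r y))"
  proof
    fix y assume "y \<in> F"
    then obtain z where z: "z \<in> D" "meets y z" "r y \<le> 2 * r z"
      using all D unfolding \<Omega>_def by blast
    then obtain w where "dist y w < r y" "dist z w < r z" unfolding meets_def by auto
    then have "dist z y < 3 * r z"
      using z(3) dist_triangle[of z y w] by (auto simp: dist_commute)
    then show "y \<in> (\<Union>y\<in>D. ball y (3 * r y))" using z by auto
  qed
  with D that show ?thesis unfolding \<Omega>_def by blast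
qed

text \<open>Finite sums of the measures are bounded by the total mass, and a summable family has
  countable support. This is the source of countability for all coverings below.\<close>

lemma (in finite_measure) countable_disjoint_positive:
  assumes disj: "disjoint_family_on B D" and meas: "\<And>y. y \<in> D \<Longrightarrow> B y \<in> sets M"
    and pos: "\<And>y. y \<in> D \<Longrightarrow> 0 < measure M (B y)"
  shows "countable D"
proof -
  have "(\<lambda>y. measure M (B y)) summable_on D"
  proof (rule nonneg_bdd_above_summable_on)
    show "bdd_above (sum (\<lambda>y. measure M (B y)) ` {F. F \<subseteq> D \<and> finite F})"
    proof (rule bdd_aboveI2)
      fix F assume F: "F \<in> {F. F \<subseteq> D \<and> finite F}"
      have "(\<Sum>y\<in>F. measure M (B y)) = measure M (\<Union>y\<in>F. B y)"
        using F meas disj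
        by (intro finite_measure_finite_Union[symmetric]) (auto simp: disjoint_family_on_def)
      then show "(\<Sum>y\<in>F. measure M (B y)) \<le> measure M (space M)"
        using bounded_measure by simp
    qed
  qed auto
  then have "countable {y\<in>D. measure M (B y) \<noteq> 0}"
    by (intro abs_summable_countable summable_on_iff_abs_summable_on_real[THEN iffD1])
  moreover have "{y\<in>D. measure M (B y) \<noteq> 0} = D" using pos by fastforce
  ultimately show ?thesis by simp
qed

lemma ennreal_le_nn_integral_count_space:
  assumes "i \<in> D"
  shows "f i \<le> (\<integral>\<^sup>+j. f j \<partial>count_space D)"
proof -
  have "f i = (\<integral>\<^sup>+j. f j * indicator {i} j \<partial>count_space D)"
    using assms by (subst nn_integral_indicator_singleton) auto
  also have "\<dots> \<le> (\<integral>\<^sup>+j. f j \<partial>count_space D)"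
    by (intro nn_integral_mono) (auto simp: indicator_def)
  finally show ?thesis .
qed

text \<open>Sums over a countable index set are integrals over \<open>count_space\<close>, so
  subadditivity is a pointwise bound followed by Tonelli's theorem.\<close>

lemma emeasure_UN_le_count_space:
  assumes "countable D" and meas: "\<And>y. y \<in> D \<Longrightarrow> B y \<in> sets M"
  shows "emeasure M (\<Union>y\<in>D. B y) \<le> (\<integral>\<^sup>+y. emeasure M (B y) \<partial>count_space D)"
proof -
  have "(\<Union>y\<in>D. B y) \<in> sets M" using assms by (intro sets.countable_UN') auto
  then have "emeasure M (\<Union>y\<in>D. B y) = (\<integral>\<^sup>+x. indicator (\<Union>y\<in>D. B y) x \<partial>M)" by simp
  also have "\<dots> \<le> (\<integral>\<^sup>+x. (\<integral>\<^sup>+y. indicator (B y) x \<partial>count_space D) \<partial>M)"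
  proof (intro nn_integral_mono)
    fix x
    show "indicator (\<Union>y\<in>D. B y) x \<le> (\<integral>\<^sup>+y. indicator (B y) x \<partial>count_space D :: ennreal)"
    proof (cases "x \<in> (\<Union>y\<in>D. B y)")
      case True
      then obtain y where "y \<in> D" "x \<in> B y" by blast
      then show ?thesis
        using True ennreal_le_nn_integral_count_space[of y D "\<lambda>y. indicator (B y) x"]
        by (simp add: indicator_def)
    qed auto
  qed
  also have "\<dots> = (\<integral>\<^sup>+y. emeasure M (B y) \<partial>count_space D)"
    using assms by (subst nn_integral_count_space_nn_integral) (auto intro!: nn_integral_cong)
  finally show ?thesis .
qed

section \<open>Powers and series\<close>

text \<open>A geometric sum is comparable to its largest term. With an arbitrary finite set
  \<open>S\<close> and a bound \<open>W\<close> on the terms, the index at which a series is split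
  never has to be computed.\<close>

lemma sum_powers_le:
  fixes a :: real
  assumes a: "1 < a" and S: "finite S" and bd: "\<And>k. k \<in> S \<Longrightarrow> a ^ k \<le> W" and W: "0 \<le> W"
  shows "(\<Sum>k\<in>S. a ^ k) \<le> W * (a / (a - 1))"
proof (cases "S = {}")
  case False
  define m where "m = Max S"
  have "(\<Sum>k\<in>S. a ^ k) \<le> (\<Sum>k<Suc m. a ^ k)"
    using S a unfolding m_def by (intro sum_mono2) (auto simp: less_Suc_eq_le)
  also have "\<dots> = (a ^ Suc m - 1) / (a - 1)"
    using a by (subst geometric_sum) auto
  also have "\<dots> \<le> (a * W) / (a - 1)"
  proof (intro divide_right_mono)
    have "a * a ^ m \<le> a * W"
      using a bd[of m] S False unfolding m_def by (intro mult_left_mono) auto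
    then show "a ^ Suc m - 1 \<le> a * W" by simp
  qed (use a in auto)
  finally show ?thesis by (simp add: mult.commute)
qed (use a W in auto)

lemma sum_inverse_powers_le:
  fixes a :: real
  assumes a: "1 < a" and S: "finite S" and bd: "\<And>k. k \<in> S \<Longrightarrow> (1 / a) ^ k \<le> W" and W: "0 \<le> W"
  shows "(\<Sum>k\<in>S. (1 / a) ^ k) \<le> W * (a / (a - 1))"
proof (cases "S = {}")
  case False
  define m where "m = Min S"
  define n where "n = Max S"
  have mn: "m \<le> n" using S False unfolding m_def n_def by simp
  have "(\<Sum>k\<in>S. (1 / a) ^ k) \<le> (\<Sum>k\<in>{m..n}. (1 / a) ^ k)"
    using S a unfolding m_def n_def by (intro sum_mono2) auto
  also have "\<dots> = ((1 / a) ^ m - (1 / a) ^ Suc n) / (1 - 1 / a)"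
    using a mn by (subst sum_gp) auto
  also have "\<dots> \<le> W / (1 - 1 / a)"
  proof (intro divide_right_mono)
    have "(1 / a) ^ m \<le> W" using bd[of m] S False unfolding m_def by auto
    moreover have "0 \<le> (1 / a) ^ Suc n" using a by auto
    ultimately show "(1 / a) ^ m - (1 / a) ^ Suc n \<le> W" by linarith
  qed (use a in auto)
  also have "\<dots> = W * (a / (a - 1))" using a by (simp add: field_simps)
  finally show ?thesis .
qed (use a W in auto)

text \<open>Terms with \<open>2 ^ k\<close> below and above \<open>(\<tau> / A) powr (1 / Q)\<close> are summed as two geometric
  series; at the splitting point both bounds agree.\<close>

lemma hedberg_sum_bound:
  fixes p Q :: real
  assumes "1 < p" "p < Q"
  obtains H where "0 < H"
    "\<And>A \<tau> n. 0 < A \<Longrightarrow> 0 < \<tau> \<Longrightarrow>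
      (\<Sum>k<n. (1/2) ^ k * (min \<tau> (A * (2 ^ k) powr Q)) powr (1 / p))
        \<le> H * (\<tau> powr (1 / p - 1 / Q) * A powr (1 / Q))"
proof -
  \<comment> \<open>\<open>(1/2) ^ k\<close> times the \<open>1 / p\<close>-th power of
    \<open>A * (2 ^ k) powr Q\<close> is \<open>A powr (1 / p) * (2 ^ k) powr th\<close>; since
    \<open>p < Q\<close>, these terms increase geometrically in \<open>k\<close>.\<close>
  define th where "th = Q / p - 1"
  have th: "0 < th" using assms unfolding th_def by (simp add: field_simps)
  define a where "a = 2 powr th"
  have a: "1 < a" using th unfolding a_def by (simp add: gr_one_powr)
  have pow: "(2 ^ k) powr th = a ^ k" for k
    unfolding a_def by (simp add: powr_realpow[symmetric] powr_powr mult.commute)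
  \<comment> \<open>\<open>a / (a - 1)\<close> comes from the ascending series of ratio
    \<open>a\<close>, and 2 from the descending series of ratio 1/2.\<close>
  define H where "H = 2 + a / (a - 1)"
  have "0 < H" using a unfolding H_def by (simp add: add_pos_pos)
  moreover have "(\<Sum>k<n. (1/2) ^ k * (min \<tau> (A * (2 ^ k) powr Q)) powr (1 / p))
        \<le> H * (\<tau> powr (1 / p - 1 / Q) * A powr (1 / Q))" if A: "0 < A" and t: "0 < \<tau>" for A \<tau> n
  proof -
    define w where "w = (\<tau> / A) powr (1 / Q)"
    have w: "0 < w" unfolding w_def using A t by simp
    have tw: "\<tau> powr (1 / p) / w = \<tau> powr (1 / p - 1 / Q) * A powr (1 / Q)"
      unfolding w_def using A t by (simp add: powr_divide powr_diff)
    have tA: "\<tau> = A * w powr Q"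
      unfolding w_def using A t assms by (simp add: powr_powr)
    have Aw: "A powr (1 / p) * w powr th = \<tau> powr (1 / p) / w"
    proof -
      have "\<tau> powr (1 / p) = A powr (1 / p) * w powr (Q / p)"
        using A w by (subst tA) (simp add: powr_mult powr_powr)
      then show ?thesis using w unfolding th_def by (simp add: powr_diff)
    qed
    define S1 where "S1 = {k\<in>{..<n}. 2 ^ k < w}"
    define S2 where "S2 = {k\<in>{..<n}. \<not> 2 ^ k < w}"
    let ?f = "\<lambda>k. (1/2) ^ k * (min \<tau> (A * (2 ^ k) powr Q)) powr (1 / p)"
    have "sum ?f {..<n} = sum ?f S1 + sum ?f S2"
      by (subst sum.union_disjoint[symmetric]) (auto simp: S1_def S2_def intro!: sum.cong)
    also have "sum ?f S1 \<le> (\<Sum>k\<in>S1. A powr (1 / p) * a ^ k)"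
    proof (intro sum_mono)
      fix k assume "k \<in> S1"
      have "?f k \<le> (1/2) ^ k * (A * (2 ^ k) powr Q) powr (1 / p)"
        using A t assms by (intro mult_left_mono powr_mono2) auto
      also have "\<dots> = A powr (1 / p) * (2 ^ k) powr th"
        using A unfolding th_def by (simp add: powr_mult powr_powr powr_diff power_one_over field_simps)
      finally show "?f k \<le> A powr (1 / p) * a ^ k" by (simp add: pow)
    qed
    also have "\<dots> = A powr (1 / p) * (\<Sum>k\<in>S1. a ^ k)" by (simp add: sum_distrib_left)
    also have "\<dots> \<le> A powr (1 / p) * (w powr th * (a / (a - 1)))"
    proof (intro mult_left_mono sum_powers_le)
      fix k assume "k \<in> S1"
      then have "(2 ^ k) powr th \<le> w powr th"
        using th unfolding S1_def by (intro powr_mono2) auto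
      then show "a ^ k \<le> w powr th" by (simp add: pow)
    qed (use a in \<open>auto simp: S1_def\<close>)
    also have "\<dots> = (\<tau> powr (1 / p) / w) * (a / (a - 1))" using Aw by (simp only: mult.assoc[symmetric])
    also have "sum ?f S2 \<le> (\<Sum>k\<in>S2. \<tau> powr (1 / p) * (1/2) ^ k)"
    proof (intro sum_mono)
      fix k assume "k \<in> S2"
      have "?f k \<le> (1/2) ^ k * \<tau> powr (1 / p)"
        using A t assms by (intro mult_left_mono powr_mono2) auto
      then show "?f k \<le> \<tau> powr (1 / p) * (1/2) ^ k" by (simp add: mult.commute)
    qed
    also have "\<dots> = \<tau> powr (1 / p) * (\<Sum>k\<in>S2. (1/2) ^ k)" by (simp add: sum_distrib_left)
    also have "\<dots> \<le> \<tau> powr (1 / p) * ((1 / w) * (2 / (2 - 1)))"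
    proof (intro mult_left_mono sum_inverse_powers_le)
      fix k assume "k \<in> S2"
      then have "w \<le> 2 ^ k" unfolding S2_def by auto
      then show "(1 / 2) ^ k \<le> 1 / w" using w by (simp add: field_simps)
    qed (use w in \<open>auto simp: S2_def\<close>)
    finally have "sum ?f {..<n} \<le> (\<tau> powr (1 / p) / w) * (a / (a - 1)) + \<tau> powr (1 / p) * ((1 / w) * (2 / (2 - 1)))"
      by simp
    also have "\<dots> = H * (\<tau> powr (1 / p) / w)"
      unfolding H_def by (simp add: distrib_left distrib_right mult.commute)
    finally show ?thesis by (simp only: tw)
  qed
  ultimately show thesis by (rule that)
qed

text \<open>The form in which coverings are used: whatever is dominated by \<open>N\<close> on each
  selected ball sums to at most a multiple of \<open>N W\<close>. Positivity of the measures of the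
  balls is what makes the selection countable.\<close>

lemma vitali_finite_measure:
  fixes N :: "'a::metric_space measure"
  assumes N: "finite_measure N" "sets borel \<subseteq> sets N"
    and W: "W \<in> sets N"
    and r: "\<And>y. y \<in> F \<Longrightarrow> 0 < r y \<and> r y \<le> L \<and> ball y (r y) \<subseteq> W \<and> 0 < measure N (ball y (r y))"
  obtains D where "countable D" "D \<subseteq> F" "F \<subseteq> (\<Union>y\<in>D. ball y (3 * r y))"
    "(\<integral>\<^sup>+y. emeasure N (ball y (r y)) \<partial>count_space D) \<le> emeasure N W"
proof -
  interpret finite_measure N by fact
  obtain D where D: "D \<subseteq> F" "disjoint_family_on (\<lambda>y. ball y (r y)) D"
    "F \<subseteq> (\<Union>y\<in>D. ball y (3 * r y))"
    using vitali_covering_centers[of F r L] r by metis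
  have meas: "ball y (r y) \<in> sets N" for y using N(2) by auto
  have "countable D"
    using countable_disjoint_positive[OF D(2) meas] D(1) r by blast
  have "(\<integral>\<^sup>+y. emeasure N (ball y (r y)) \<partial>count_space D) = emeasure N (\<Union>y\<in>D. ball y (r y))"
    using D(2) \<open>countable D\<close> meas by (intro emeasure_UN_countable[symmetric])
  also have "\<dots> \<le> emeasure N W"
    using D(1) r W by (intro emeasure_mono) auto
  finally show ?thesis using that D \<open>countable D\<close> by blast
qed

text \<open>\<open>E\<close> need not be known to be measurable: it lies in a countable intersection
  of measure zero, and completeness does the rest.\<close>

lemma (in complete_measure) null_sets_if_small:
  assumes "\<And>e. 0 < e \<Longrightarrow> \<exists>A\<in>sets M. E \<subseteq> A \<and> emeasure M A \<le> ennreal e"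
  shows "E \<in> null_sets M"
proof -
  have "\<forall>n. \<exists>A\<in>sets M. E \<subseteq> A \<and> emeasure M A \<le> ennreal (1 / real (Suc n))"
    using assms by (intro allI) auto
  then obtain A where A: "\<And>n. A n \<in> sets M" "\<And>n. E \<subseteq> A n"
    "\<And>n. emeasure M (A n) \<le> ennreal (1 / real (Suc n))" by metis
  have "emeasure M (\<Inter>n. A n) \<le> ennreal (1 / real (Suc n))" for n
    by (rule order.trans[OF emeasure_mono A(3)[of n]]) (use A(1) in auto)
  moreover have "(\<lambda>n. ennreal (1 / real (Suc n))) \<longlonglongrightarrow> ennreal 0"
    using LIMSEQ_inverse_real_of_nat by (intro tendsto_ennrealI) (simp add: inverse_eq_divide)
  ultimately have "emeasure M (\<Inter>n. A n) \<le> ennreal 0"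
    by (intro LIMSEQ_le_const) auto
  then have "(\<Inter>n. A n) \<in> null_sets M" using A(1) by (intro null_setsI) auto
  then show ?thesis by (rule complete2[rotated]) (use A(2) in auto)
qed

lemma powr_tendsto_0_at_right:
  assumes "0 < \<eta>"
  shows "((\<lambda>r::real. r powr \<eta>) \<longlongrightarrow> 0) (at_right 0)"
proof (rule tendsto_zero_powrI)
  show "\<forall>\<^sub>F r in at_right 0. 0 \<le> (r::real)"
    using eventually_at_right_less[of "0::real"] by (rule eventually_mono) simp
qed (use assms in auto)

section \<open>Measures of balls and averages over balls\<close>

context doubling_metric_measure_space
begin

lemma borel_in_sets: "A \<in> sets borel \<Longrightarrow> A \<in> sets M"
  using borel_sets by auto

lemma ball_in_sets [simp, measurable]: "ball x r \<in> sets M"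
  by (rule borel_in_sets) auto

lemma borel_measurable_lift: "f \<in> borel_measurable borel \<Longrightarrow> f \<in> borel_measurable M"
  using borel_sets space_eq by (auto simp: measurable_def)

lemma emeasure_ball_finite: "emeasure M (ball x r) < \<infinity>"
  using ball_finite[of r x] by (cases "0 < r") (auto simp: ball_empty)

lemma ball_fmeasurable [simp]: "ball x r \<in> fmeasurable M"
  using emeasure_ball_finite by (intro fmeasurableI) auto

lemma emeasure_ball: "emeasure M (ball x r) = ennreal (measure M (ball x r))"
  using emeasure_ball_finite[of x r] by (intro emeasure_eq_ennreal_measure) auto

lemma measure_ball_pos: "0 < r \<Longrightarrow> 0 < measure M (ball x r)"
  using ball_pos[of r x] emeasure_ball[of x r] by (metis ennreal_0 ennreal_neg not_le order_less_irrefl)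

lemma measure_ball_mono: "ball x r \<subseteq> ball y s \<Longrightarrow> measure M (ball x r) \<le> measure M (ball y s)"
  by (intro measure_mono_fmeasurable) auto

definition locally_integrable :: "('a \<Rightarrow> real) \<Rightarrow> bool" where
  "locally_integrable v \<longleftrightarrow> v \<in> borel_measurable M \<and> (\<forall>x r. set_integrable M (ball x r) v)"

lemma locally_integrable_dev:
  assumes "locally_integrable v"
  shows "set_integrable M (ball x r) (\<lambda>y. v y - c)" "set_integrable M (ball x r) (\<lambda>y. \<bar>v y - c\<bar>)"
proof -
  have "set_integrable M (ball x r) (\<lambda>y. c)"
    unfolding set_integrable_def using emeasure_ball_finite[of x r] by simp
  then show "set_integrable M (ball x r) (\<lambda>y. v y - c)"
    using assms unfolding locally_integrable_def by auto
  then show "set_integrable M (ball x r) (\<lambda>y. \<bar>v y - c\<bar>)" by (rule set_integrable_abs)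
qed

lemma set_integral_ball_average:
  assumes "0 < r"
  shows "(LINT y:ball x r|M. f y) = measure M (ball x r) * ball_average M f x r"
  using measure_ball_pos[OF assms, of x] unfolding ball_average_def by simp

lemma ball_average_dev_nonneg: "0 \<le> ball_average M (\<lambda>y. \<bar>f y\<bar>) x r"
  unfolding ball_average_def set_lebesgue_integral_def by (intro divide_nonneg_nonneg integral_nonneg_AE) auto

text \<open>Averaging \<open>\<bar>v - c\<bar>\<close> over the smaller ball costs at most the ratio
  \<open>k\<close> of the measures. With \<open>c\<close> an average over the larger ball this
  compares two averages; with \<open>c\<close> a truncation level it locates the average of a
  truncation.\<close>

lemma ball_average_compare:
  assumes v: "locally_integrable v" and s: "0 < s" and sub: "ball y s \<subseteq> ball x r"
    and ratio: "measure M (ball x r) \<le> k * measure M (ball y s)"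
  shows "\<bar>ball_average M v y s - c\<bar> \<le> k * ball_average M (\<lambda>z. \<bar>v z - c\<bar>) x r"
proof -
  have r: "0 < r" using s sub by (metis ball_empty centre_in_ball empty_iff not_le subset_empty)
  note pos = measure_ball_pos[OF s, of y] measure_ball_pos[OF r, of x]
  have "ball_average M v y s - c = (LINT z:ball y s|M. v z - c) / measure M (ball y s)"
  proof -
    have "(LINT z:ball y s|M. v z - c) = (LINT z:ball y s|M. v z) - (LINT z:ball y s|M. c)"
      using v emeasure_ball_finite[of y s] unfolding locally_integrable_def
      by (intro set_integral_diff(2)) (auto simp: set_integrable_def)
    also have "(LINT z:ball y s|M. c) = c * measure M (ball y s)"
      unfolding set_lebesgue_integral_def by simp
    finally show ?thesis using pos unfolding ball_average_def by (simp add: field_simps)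
  qed
  also have "\<bar>\<dots>\<bar> \<le> (LINT z:ball y s|M. \<bar>v z - c\<bar>) / measure M (ball y s)"
  proof -
    have "\<bar>LINT z:ball y s|M. v z - c\<bar> \<le> (LINT z:ball y s|M. \<bar>v z - c\<bar>)"
      using integral_norm_bound[of M "\<lambda>z. indicator (ball y s) z *\<^sub>R (v z - c)"]
      unfolding set_lebesgue_integral_def by (simp add: abs_mult)
    then show ?thesis using pos by (simp add: divide_right_mono)
  qed
  also have "\<dots> \<le> (LINT z:ball x r|M. \<bar>v z - c\<bar>) / measure M (ball y s)"
  proof (intro divide_right_mono)
    show "(LINT z:ball y s|M. \<bar>v z - c\<bar>) \<le> (LINT z:ball x r|M. \<bar>v z - c\<bar>)"
      using locally_integrable_dev(2)[OF v] sub unfolding set_lebesgue_integral_def set_integrable_def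
      by (intro integral_mono) (auto simp: indicator_def)
  qed (use pos in auto)
  also have "\<dots> = measure M (ball x r) / measure M (ball y s) * ball_average M (\<lambda>z. \<bar>v z - c\<bar>) x r"
    by (simp add: set_integral_ball_average[OF r])
  also have "\<dots> \<le> k * ball_average M (\<lambda>z. \<bar>v z - c\<bar>) x r"
    using ratio pos ball_average_dev_nonneg[of "\<lambda>z. v z - c" x r]
    by (intro mult_right_mono) (auto simp: field_simps)
  finally show ?thesis .
qed

lemma emeasure_dev_le:
  assumes v: "locally_integrable v" and e: "0 < e" and r: "0 < r"
  shows "emeasure M {y\<in>ball x r. e \<le> \<bar>v y - c\<bar>}
    \<le> ennreal (1 / e * (measure M (ball x r) * ball_average M (\<lambda>z. \<bar>v z - c\<bar>) x r))"
  using integral_Markov_inequality'[OF locally_integrable_dev(2)[OF v, of x r c] _ _ e]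
  by (simp add: set_integral_ball_average[OF r])

end

section \<open>Telescoping sums of averages\<close>

text \<open>Fixes the structural constants, so that all later constants depend on them only and not
  on a function or a ball. \<open>Q\<close> is the enlarged decay order, with finite Sobolev
  exponent. \<open>K\<close> is the constant of the Poincare inequality with the radius in place of
  the diameter; the inequality itself is imposed on individual functions by
  \<open>poincare_pair\<close>.\<close>

locale poincare_setting = doubling_metric_measure_space M
  for M :: "'a::metric_space measure" +
  fixes p Q D K \<sigma> c :: real
  assumes p: "1 < p" "p < Q" and D: "1 \<le> D" and K: "0 < K" and \<sigma>: "1 \<le> \<sigma>" and c: "0 < c"
    and doubling_D: "\<And>x r. 0 < r \<Longrightarrow> measure M (ball x (2 * r)) \<le> D * measure M (ball x r)"
    and decay: "\<And>x y r R. y \<in> ball x R \<Longrightarrow> 0 < r \<Longrightarrow> r \<le> R \<Longrightarrow>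
      c * (r / R) powr Q * measure M (ball x R) \<le> measure M (ball y r)"
begin

definition dil :: "real \<Rightarrow> real" where
  "dil a = D ^ nat \<lceil>log 2 a\<rceil>"

lemma dil_ge_1: "1 \<le> dil a"
  unfolding dil_def using D by simp

lemma measure_ball_dil:
  assumes "0 < r" "1 \<le> a"
  shows "measure M (ball x (a * r)) \<le> dil a * measure M (ball x r)"
proof -
  have pow: "measure M (ball x (2 ^ n * r)) \<le> D ^ n * measure M (ball x r)" for n
  proof (induction n)
    case (Suc n)
    have "measure M (ball x (2 * (2 ^ n * r))) \<le> D * measure M (ball x (2 ^ n * r))"
      using assms by (intro doubling_D) auto
    also have "\<dots> \<le> D * (D ^ n * measure M (ball x r))"
      using Suc D by (intro mult_left_mono) auto
    finally show ?case by (simp add: mult.assoc)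
  qed simp
  define n where "n = nat \<lceil>log 2 a\<rceil>"
  have "log 2 a \<le> real n" unfolding n_def by linarith
  then have "a \<le> 2 ^ n" using assms by (simp add: log_le_iff powr_realpow)
  then have "measure M (ball x (a * r)) \<le> measure M (ball x (2 ^ n * r))"
    using assms by (intro measure_ball_mono subset_ball mult_right_mono) auto
  with pow[of n] show ?thesis unfolding dil_def n_def by linarith
qed

text \<open>\<open>N\<close> stands for the measure with density \<open>g powr p\<close>. Replacing
  the gradient by a measure lets a truncation be treated by restricting \<open>N\<close> to a level
  set. The denominator is the measure of the undilated ball, which only weakens the
  inequality.\<close>

definition poincare_pair :: "('a \<Rightarrow> real) \<Rightarrow> 'a measure \<Rightarrow> bool" where
  "poincare_pair v N \<longleftrightarrow> locally_integrable v \<and> finite_measure N \<and> sets N = sets M \<and>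
    (\<forall>x r. 0 < r \<longrightarrow> ball_average M (\<lambda>y. \<bar>v y - ball_average M v x r\<bar>) x r
      \<le> K * (r * (measure N (ball x (\<sigma> * r)) / measure M (ball x r)) powr (1 / p)))"

lemma poincare_pairD:
  assumes "poincare_pair v N"
  shows "locally_integrable v" "v \<in> borel_measurable M" "finite_measure N" "sets N = sets M"
    "0 < r \<Longrightarrow> ball_average M (\<lambda>y. \<bar>v y - ball_average M v x r\<bar>) x r
      \<le> K * (r * (measure N (ball x (\<sigma> * r)) / measure M (ball x r)) powr (1 / p))"
  using assms unfolding poincare_pair_def locally_integrable_def by auto

lemma poincare_pair_compare:
  assumes v: "poincare_pair v N" and s: "0 < s" and sub: "ball y s \<subseteq> ball x r"
    and ratio: "measure M (ball x r) \<le> k * measure M (ball y s)"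
  shows "\<bar>ball_average M v y s - ball_average M v x r\<bar>
    \<le> k * (K * (r * (measure N (ball x (\<sigma> * r)) / measure M (ball x r)) powr (1 / p)))"
proof -
  have r: "0 < r" using s sub by (metis ball_empty centre_in_ball empty_iff not_le subset_empty)
  have "0 < k * measure M (ball y s)"
    using ratio measure_ball_pos[OF r, of x] by linarith
  then have "0 \<le> k" using measure_ball_pos[OF s, of y] by (simp add: zero_less_mult_iff)
  then show ?thesis
    using ball_average_compare[OF poincare_pairD(1)[OF v] s sub ratio, of "ball_average M v x r"]
      mult_left_mono[OF poincare_pairD(5)[OF v r, of x], of k] by linarith
qed

lemma dyadic_telescope:
  assumes v: "poincare_pair v N" and R: "0 < R"
  shows "\<bar>ball_average M v y (R / 2 ^ n) - ball_average M v y R\<bar>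
    \<le> D * K * (\<Sum>k<n. R / 2 ^ k *
        (measure N (ball y (\<sigma> * (R / 2 ^ k))) / measure M (ball y (R / 2 ^ k))) powr (1 / p))"
proof (induction n)
  case (Suc n)
  have "\<bar>ball_average M v y (R / 2 ^ Suc n) - ball_average M v y (R / 2 ^ n)\<bar>
    \<le> D * (K * (R / 2 ^ n *
        (measure N (ball y (\<sigma> * (R / 2 ^ n))) / measure M (ball y (R / 2 ^ n))) powr (1 / p)))"
  proof (rule poincare_pair_compare[OF v])
    show "measure M (ball y (R / 2 ^ n)) \<le> D * measure M (ball y (R / 2 ^ Suc n))"
      using doubling_D[of "R / 2 ^ Suc n" y] R by simp
  qed (use R in \<open>auto intro!: subset_ball simp: field_simps\<close>)
  with Suc show ?case by (simp add: algebra_simps)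
qed simp

text \<open>The summand 1 pays for moving from an arbitrary radius to a dyadic one, the other
  summand is the full geometric series of ratio \<open>2 powr - \<eta>\<close>.\<close>

definition tele :: "real \<Rightarrow> real" where
  "tele \<eta> = D * K * (1 + 1 / (1 - 2 powr - \<eta>))"

lemma two_powr_minus_less: "0 < \<eta> \<Longrightarrow> 2 powr - \<eta> < (1::real)"
  by (simp add: powr_minus inverse_less_1_iff)

lemma tele_pos: "0 < \<eta> \<Longrightarrow> 0 < tele \<eta>"
  unfolding tele_def using D K two_powr_minus_less[of \<eta>] by (intro mult_pos_pos add_pos_pos) auto

lemma averages_holder:
  assumes v: "poincare_pair v N" and \<eta>: "0 < \<eta>" and a: "0 \<le> a" and s: "0 < s" "s \<le> r"
    and bd: "\<And>t. 0 < t \<Longrightarrow> t \<le> r \<Longrightarrow>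
      t * (measure N (ball y (\<sigma> * t)) / measure M (ball y t)) powr (1 / p) \<le> a * t powr \<eta>"
  shows "\<bar>ball_average M v y s - ball_average M v y r\<bar> \<le> tele \<eta> * (a * r powr \<eta>)"
proof -
  define b where "b = (2::real) powr - \<eta>"
  have b: "0 < b" "b < 1" unfolding b_def using two_powr_minus_less[OF \<eta>] by auto
  have pow: "(r / 2 ^ k) powr \<eta> = r powr \<eta> * b ^ k" for k
    using s unfolding b_def
    by (simp add: powr_divide powr_realpow[symmetric] powr_powr powr_minus_divide power_one_over
        mult.commute flip: powr_minus)
  \<comment> \<open>The dyadic radius just above \<open>s\<close>: it is less than
    \<open>2 * s\<close>, so a single doubling compares the two balls.\<close>
  obtain n where n: "r / 2 ^ Suc n < s" "s \<le> r / 2 ^ n"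
  proof -
    have "\<exists>n. r / 2 ^ n < s"
    proof -
      obtain n where "r / s < 2 ^ n" using real_arch_pow[of 2 "r / s"] by auto
      then show ?thesis using s by (auto simp: field_simps intro!: exI[of _ n])
    qed
    define m where "m = (LEAST n. r / 2 ^ n < s)"
    have m: "r / 2 ^ m < s" unfolding m_def by (rule LeastI_ex) fact
    have "m \<noteq> 0" using m s by (cases m) auto
    then obtain n where mn: "m = Suc n" by (cases m) auto
    then have "\<not> r / 2 ^ n < s" using not_less_Least[of n "\<lambda>n. r / 2 ^ n < s"] unfolding m_def by auto
    with m mn that show ?thesis by auto
  qed
  have "\<bar>ball_average M v y s - ball_average M v y (r / 2 ^ n)\<bar>
    \<le> D * (K * (r / 2 ^ n *
        (measure N (ball y (\<sigma> * (r / 2 ^ n))) / measure M (ball y (r / 2 ^ n))) powr (1 / p)))"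
  proof (rule poincare_pair_compare[OF v s(1)])
    show "ball y s \<subseteq> ball y (r / 2 ^ n)" using n by (intro subset_ball) auto
    have "measure M (ball y (r / 2 ^ n)) \<le> measure M (ball y (2 * s))"
      using n by (intro measure_ball_mono subset_ball) auto
    also have "\<dots> \<le> D * measure M (ball y s)" using s by (intro doubling_D) auto
    finally show "measure M (ball y (r / 2 ^ n)) \<le> D * measure M (ball y s)" .
  qed
  also have "\<dots> \<le> D * (K * (a * (r / 2 ^ n) powr \<eta>))"
    using s D K by (intro mult_left_mono bd) (auto simp: field_simps)
  also have "\<dots> \<le> D * (K * (a * r powr \<eta>))"
    using s D K a \<eta> by (intro mult_left_mono powr_mono2) (auto simp: field_simps)
  finally have 1: "\<bar>ball_average M v y s - ball_average M v y (r / 2 ^ n)\<bar> \<le> D * K * (a * r powr \<eta>)"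
    by simp
  have "\<bar>ball_average M v y (r / 2 ^ n) - ball_average M v y r\<bar>
    \<le> D * K * (\<Sum>k<n. r / 2 ^ k *
        (measure N (ball y (\<sigma> * (r / 2 ^ k))) / measure M (ball y (r / 2 ^ k))) powr (1 / p))"
    using s by (intro dyadic_telescope[OF v]) auto
  also have "\<dots> \<le> D * K * (\<Sum>k<n. a * (r / 2 ^ k) powr \<eta>)"
    using s D K by (intro mult_left_mono sum_mono bd) (auto simp: field_simps)
  also have "\<dots> = D * K * (a * r powr \<eta>) * (\<Sum>k<n. b ^ k)"
    by (simp add: pow sum_distrib_left mult_ac)
  also have "\<dots> \<le> D * K * (a * r powr \<eta>) * (1 / (1 - b))"
  proof (intro mult_left_mono)
    have "(\<Sum>k<n. b ^ k) = (1 - b ^ n) / (1 - b)" using b by (subst sum_gp_strict) auto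
    also have "\<dots> \<le> 1 / (1 - b)" using b by (intro divide_right_mono) auto
    finally show "(\<Sum>k<n. b ^ k) \<le> 1 / (1 - b)" .
  qed (use D K a in auto)
  finally have 2: "\<bar>ball_average M v y (r / 2 ^ n) - ball_average M v y r\<bar>
    \<le> D * K * (a * r powr \<eta>) * (1 / (1 - b))" .
  have "tele \<eta> * (a * r powr \<eta>) = D * K * (a * r powr \<eta>) + D * K * (a * r powr \<eta>) * (1 / (1 - b))"
    unfolding tele_def b_def by (simp add: algebra_simps)
  with 1 2 show ?thesis by linarith
qed

text \<open>The bound between two radii does not depend on the smaller one. Along
  \<open>R / 2 ^ n\<close> it gives a Cauchy sequence and then the same bound against its limit;
  that bound holds for all small radii and yields the full limit.\<close>

lemma averages_converge:
  assumes v: "poincare_pair v N" and \<eta>: "0 < \<eta>" and a: "0 \<le> a" and R: "0 < R"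
    and bd: "\<And>t. 0 < t \<Longrightarrow> t \<le> R \<Longrightarrow>
      t * (measure N (ball y (\<sigma> * t)) / measure M (ball y t)) powr (1 / p) \<le> a * t powr \<eta>"
  obtains l where "(ball_average M v y \<longlongrightarrow> l) (at_right 0)"
    "\<And>r. 0 < r \<Longrightarrow> r \<le> R \<Longrightarrow> \<bar>ball_average M v y r - l\<bar> \<le> tele \<eta> * (a * r powr \<eta>)"
proof -
  have osc: "\<bar>ball_average M v y s - ball_average M v y r\<bar> \<le> tele \<eta> * (a * r powr \<eta>)"
    if "0 < s" "s \<le> r" "r \<le> R" for s r
    using that by (intro averages_holder[OF v \<eta> a]) (auto intro!: bd)
  have lim0: "((\<lambda>r. tele \<eta> * (a * r powr \<eta>)) \<longlongrightarrow> 0) (at_right 0)"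
    using tendsto_mult_left[OF tendsto_mult_left[OF powr_tendsto_0_at_right[OF \<eta>], of a], of "tele \<eta>"] by simp
  define X where "X n = ball_average M v y (R / 2 ^ n)" for n
  have seq0: "(\<lambda>n. R / 2 ^ n) \<longlonglongrightarrow> 0"
    using LIMSEQ_divide_realpow_zero[of 2 R] by simp
  have at0: "filterlim (\<lambda>n. R / 2 ^ n) (at_right 0) sequentially"
    using seq0 R by (auto simp: filterlim_at intro!: always_eventually)
  have "Cauchy X"
  proof (rule metric_CauchyI)
    fix e :: real assume "0 < e"
    have "((\<lambda>n. tele \<eta> * (a * (R / 2 ^ n) powr \<eta>)) \<longlongrightarrow> 0) sequentially"
      by (rule filterlim_compose[OF lim0 at0])
    then obtain n0 where n0: "tele \<eta> * (a * (R / 2 ^ n0) powr \<eta>) < e / 2"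
      using order_tendstoD(2)[of _ 0 sequentially "e / 2"] \<open>0 < e\<close>
      by (auto simp: eventually_sequentially)
    have "\<bar>X n - X n0\<bar> < e / 2" if "n \<ge> n0" for n
      unfolding X_def
      by (rule le_less_trans[OF osc n0]) (use R that in \<open>auto simp: field_simps power_increasing\<close>)
    then show "\<exists>n0. \<forall>m\<ge>n0. \<forall>n\<ge>n0. dist (X m) (X n) < e"
      unfolding dist_real_def by (intro exI[of _ n0]) (smt (verit) field_sum_of_halves)
  qed
  then obtain l where l: "X \<longlonglongrightarrow> l" using Cauchy_convergent convergent_def by blast
  have bound: "\<bar>ball_average M v y r - l\<bar> \<le> tele \<eta> * (a * r powr \<eta>)" if "0 < r" "r \<le> R" for r
  proof (rule tendsto_upperbound)
    show "(\<lambda>n. \<bar>ball_average M v y r - X n\<bar>) \<longlonglongrightarrow> \<bar>ball_average M v y r - l\<bar>"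
      using l by (intro tendsto_intros)
    have "eventually (\<lambda>n. R / 2 ^ n < r) sequentially"
      using order_tendstoD(2)[OF seq0] that by auto
    then show "eventually (\<lambda>n. \<bar>ball_average M v y r - X n\<bar> \<le> tele \<eta> * (a * r powr \<eta>)) sequentially"
    proof eventually_elim
      case (elim n)
      then show ?case using osc[of "R / 2 ^ n" r] R that unfolding X_def by (simp add: abs_minus_commute)
    qed
  qed simp
  have "((\<lambda>r. ball_average M v y r - l) \<longlongrightarrow> 0) (at_right 0)"
  proof (rule Lim_null_comparison[OF _ lim0])
    show "\<forall>\<^sub>F r in at_right 0. norm (ball_average M v y r - l) \<le> tele \<eta> * (a * r powr \<eta>)"
      using bound R unfolding eventually_at_right_field by (auto intro!: exI[of _ R])
  qed
  then have "(ball_average M v y \<longlongrightarrow> l) (at_right 0)" by (simp add: LIM_zero_iff)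
  with bound that show thesis by blast
qed

end

section \<open>Weak type estimate for the maximal function and Lebesgue points\<close>

context poincare_setting
begin

text \<open>The weak type (1,1) estimate for the maximal function of \<open>N\<close> relative to
  \<open>M\<close>, with a measurable cover because \<open>F\<close> may fail to be measurable.
  Disjointness is arranged for the dilated balls, on which \<open>N\<close> is evaluated; tripling
  these and returning to radius \<open>r\<close> in \<open>M\<close> costs
  \<open>dil (3 * \<sigma>)\<close>.\<close>

lemma maximal_cover:
  assumes N: "finite_measure N" "sets N = sets M" and \<tau>: "0 < \<tau>" and W: "W \<in> sets M"
    and F: "\<And>y. y \<in> F \<Longrightarrow> \<exists>r. 0 < r \<and> r \<le> L \<and> ball y (\<sigma> * r) \<subseteq> W \<and>
      \<tau> * measure M (ball y r) < measure N (ball y (\<sigma> * r))"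
  obtains A where "A \<in> sets M" "F \<subseteq> A" "emeasure M A \<le> ennreal (dil (3 * \<sigma>) / \<tau> * measure N W)"
proof -
  interpret N: finite_measure N by fact
  obtain r where r: "\<And>y. y \<in> F \<Longrightarrow> 0 < r y \<and> r y \<le> L \<and> ball y (\<sigma> * r y) \<subseteq> W \<and>
      \<tau> * measure M (ball y (r y)) < measure N (ball y (\<sigma> * r y))" using F by metis
  have pos: "0 < measure N (ball y (\<sigma> * r y))" if "y \<in> F" for y
    using r[OF that] measure_ball_pos[of "r y" y] \<tau> by (smt (verit) mult_pos_pos)
  obtain D' where D': "countable D'" "D' \<subseteq> F" "F \<subseteq> (\<Union>y\<in>D'. ball y (3 * (\<sigma> * r y)))"
    "(\<integral>\<^sup>+y. emeasure N (ball y (\<sigma> * r y)) \<partial>count_space D') \<le> emeasure N W"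
  proof (rule vitali_finite_measure[OF N(1), of W F "\<lambda>y. \<sigma> * r y" "\<sigma> * L"])
    fix y assume "y \<in> F"
    then show "0 < \<sigma> * r y \<and> \<sigma> * r y \<le> \<sigma> * L \<and> ball y (\<sigma> * r y) \<subseteq> W \<and> 0 < measure N (ball y (\<sigma> * r y))"
      using r[of y] pos[of y] \<sigma> by auto
  qed (use N(2) W borel_sets in auto)
  define A where "A = (\<Union>y\<in>D'. ball y (3 * (\<sigma> * r y)))"
  have "emeasure M A \<le> (\<integral>\<^sup>+y. emeasure M (ball y (3 * (\<sigma> * r y))) \<partial>count_space D')"
    unfolding A_def using D'(1) by (intro emeasure_UN_le_count_space) auto
  also have "\<dots> \<le> (\<integral>\<^sup>+y. ennreal (dil (3 * \<sigma>) / \<tau>) * emeasure N (ball y (\<sigma> * r y)) \<partial>count_space D')"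
  proof (intro nn_integral_mono)
    fix y assume "y \<in> space (count_space D')"
    then have y: "y \<in> F" using D'(2) by auto
    have "measure M (ball y (3 * (\<sigma> * r y))) \<le> dil (3 * \<sigma>) * measure M (ball y (r y))"
      using measure_ball_dil[of "r y" "3 * \<sigma>" y] r[OF y] \<sigma> by (simp add: mult.assoc)
    also have "\<dots> \<le> dil (3 * \<sigma>) * (measure N (ball y (\<sigma> * r y)) / \<tau>)"
      using r[OF y] \<tau> dil_ge_1[of "3 * \<sigma>"] by (intro mult_left_mono) (auto simp: field_simps)
    finally have "measure M (ball y (3 * (\<sigma> * r y))) \<le> dil (3 * \<sigma>) / \<tau> * measure N (ball y (\<sigma> * r y))"
      by simp
    then show "emeasure M (ball y (3 * (\<sigma> * r y)))
      \<le> ennreal (dil (3 * \<sigma>) / \<tau>) * emeasure N (ball y (\<sigma> * r y))"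
      using \<tau> dil_ge_1[of "3 * \<sigma>"]
      by (simp add: emeasure_ball N.emeasure_eq_measure ennreal_mult'[symmetric])
  qed
  also have "\<dots> = ennreal (dil (3 * \<sigma>) / \<tau>) * (\<integral>\<^sup>+y. emeasure N (ball y (\<sigma> * r y)) \<partial>count_space D')"
    by (rule nn_integral_cmult) auto
  also have "\<dots> \<le> ennreal (dil (3 * \<sigma>) / \<tau>) * emeasure N W"
    using D'(4) by (intro mult_left_mono) auto
  also have "\<dots> = ennreal (dil (3 * \<sigma>) / \<tau> * measure N W)"
    using \<tau> dil_ge_1[of "3 * \<sigma>"] by (simp add: N.emeasure_eq_measure ennreal_mult'[symmetric])
  finally have "emeasure M A \<le> ennreal (dil (3 * \<sigma>) / \<tau> * measure N W)" .
  moreover have "A \<in> sets M"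
    unfolding A_def using D'(1) by (intro sets.countable_UN') auto
  ultimately show ?thesis using that D'(3) unfolding A_def by blast
qed

text \<open>The exponent 1 instance of the growth condition \<open>r powr q * N \<le> m * M\<close>
  imposed later outside the exceptional set; here it gives the Poincare term the decay
  \<open>t powr (1 - 1 / p)\<close>.\<close>

definition good_point :: "'a measure \<Rightarrow> real \<Rightarrow> 'a \<Rightarrow> bool" where
  "good_point N m y \<longleftrightarrow> (\<forall>r. 0 < r \<longrightarrow> r \<le> 1 \<longrightarrow> r * measure N (ball y (\<sigma> * r)) \<le> m * measure M (ball y r))"

text \<open>As \<open>r \<le> 1\<close>, failure for \<open>m\<close> forces the maximal function of
  \<open>N\<close> above \<open>m\<close>, and the weak type estimate bounds that set by a multiple
  of \<open>1 / m\<close>.\<close>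

lemma AE_good_point:
  assumes N: "finite_measure N" "sets N = sets M"
  shows "{y. \<forall>m::nat. \<not> good_point N (real m) y} \<in> null_sets M" (is "?E \<in> _")
proof (rule null_sets_if_small)
  fix e :: real assume e: "0 < e"
  define B where "B = dil (3 * \<sigma>) * measure N (space M) / e"
  obtain m :: nat where m: "B < real m" using reals_Archimedean2 by blast
  have "0 \<le> B" unfolding B_def using e dil_ge_1[of "3 * \<sigma>"] by auto
  then have m0: "0 < real m" using m by linarith
  obtain A where A: "A \<in> sets M" "?E \<subseteq> A" "emeasure M A \<le> ennreal (dil (3 * \<sigma>) / real m * measure N (space M))"
  proof (rule maximal_cover[OF N m0, of "space M" ?E 1])
    fix y assume "y \<in> ?E"
    then obtain r where r: "0 < r" "r \<le> 1" "real m * measure M (ball y r) < r * measure N (ball y (\<sigma> * r))"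
      unfolding good_point_def by (auto simp: not_le)
    have "r * measure N (ball y (\<sigma> * r)) \<le> 1 * measure N (ball y (\<sigma> * r))"
      using r by (intro mult_right_mono) auto
    with r show "\<exists>r>0. r \<le> 1 \<and> ball y (\<sigma> * r) \<subseteq> space M \<and>
      real m * measure M (ball y r) < measure N (ball y (\<sigma> * r))"
      using space_eq by (intro exI[of _ r]) auto
  qed auto
  have "dil (3 * \<sigma>) / real m * measure N (space M) \<le> e"
    using m m0 e unfolding B_def by (simp add: field_simps)
  then show "\<exists>A\<in>sets M. ?E \<subseteq> A \<and> emeasure M A \<le> ennreal e"
    using A by (meson ennreal_leI order.trans)
qed

lemma good_point_bound:
  assumes "good_point N m y" and t: "0 < t" "t \<le> 1" and m: "0 \<le> m"
  shows "t * (measure N (ball y (\<sigma> * t)) / measure M (ball y t)) powr (1 / p)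
    \<le> m powr (1 / p) * t powr (1 - 1 / p)"
proof -
  have "measure N (ball y (\<sigma> * t)) / measure M (ball y t) \<le> m / t"
  proof -
    have "t * measure N (ball y (\<sigma> * t)) \<le> m * measure M (ball y t)"
      using assms(1) t unfolding good_point_def by blast
    then show ?thesis using t measure_ball_pos[of t y] by (simp add: divide_simps mult.commute)
  qed
  then have "t * (measure N (ball y (\<sigma> * t)) / measure M (ball y t)) powr (1 / p) \<le> t * (m / t) powr (1 / p)"
    using t p by (intro mult_left_mono powr_mono2) auto
  also have "\<dots> = m powr (1 / p) * t powr (1 - 1 / p)"
    using t m by (simp add: powr_divide powr_diff)
  finally show ?thesis .
qed

text \<open>Covering the set where the limit of averages is far from \<open>v\<close> by balls centred at good points,
  the Poincare inequality on these balls makes the measure of the set small; this replaces the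
  density of continuous functions in the usual proof.\<close>

theorem averages_tendsto_AE:
  assumes v: "poincare_pair v N"
  shows "AE y in M. (ball_average M v y \<longlongrightarrow> v y) (at_right 0)"
proof -
  note vD = poincare_pairD[OF v]
  define \<eta> where "\<eta> = 1 - 1 / p"
  have \<eta>: "0 < \<eta>" unfolding \<eta>_def using p by simp
  define l where "l y = Lim (at_right 0) (ball_average M v y)" for y
  have l: "(ball_average M v y \<longlongrightarrow> l y) (at_right 0) \<and>
      (\<forall>r. 0 < r \<longrightarrow> r \<le> 1 \<longrightarrow> \<bar>ball_average M v y r - l y\<bar> \<le> tele \<eta> * (m powr (1 / p) * r powr \<eta>))"
    if gp: "good_point N m y" "0 \<le> m" for y m
  proof -
    obtain k where k: "(ball_average M v y \<longlongrightarrow> k) (at_right 0)"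
      "\<And>r. 0 < r \<Longrightarrow> r \<le> 1 \<Longrightarrow> \<bar>ball_average M v y r - k\<bar> \<le> tele \<eta> * (m powr (1 / p) * r powr \<eta>)"
      using averages_converge[OF v \<eta>, of "m powr (1 / p)" 1 y] good_point_bound[OF gp(1) _ _ gp(2)]
      unfolding \<eta>_def by auto
    moreover have "l y = k" unfolding l_def using k(1) by (intro tendsto_Lim) auto
    ultimately show ?thesis by auto
  qed
  \<comment> \<open>With ball, growth bound \<open>m\<close> and tolerance \<open>e\<close> fixed,
    all constants are uniform and one scale \<open>t\<close> serves every point of the set.
    Countably many such sets, together with the points that are good for no \<open>m\<close>,
    exhaust the exceptional points.\<close>
  have null: "{y\<in>ball x0 n. good_point N m y \<and> e \<le> \<bar>v y - l y\<bar>} \<in> null_sets M" (is "?F \<in> _")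
    if e: "0 < e" and m: "0 \<le> m" for x0 n m e
  proof (rule null_sets_if_small)
    fix \<epsilon> :: real assume \<epsilon>: "0 < \<epsilon>"
    define a where "a = m powr (1 / p)"
    have a: "0 \<le> a" unfolding a_def by simp
    \<comment> \<open>\<open>G1 * t powr \<eta>\<close> will bound the distance from
      \<open>l z\<close> to the average over a ball of radius \<open>t\<close> centred near
      \<open>z\<close>; \<open>G2 * t powr \<eta>\<close> will bound the measure of the cover. Both
      tend to 0 with \<open>t\<close>.\<close>
    define G1 where "G1 = tele \<eta> * a + dil 3 * (K * a)"
    define G2 where "G2 = 2 / e * (K * a * dil 6) * measure M (ball x0 (n + 1))"
    have dp: "0 < dil b" for b using dil_ge_1[of b] by linarith
    note lim0 = powr_tendsto_0_at_right[OF \<eta>]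
    have "eventually (\<lambda>t. G1 * t powr \<eta> < e / 2) (at_right 0)" 
      using order_tendstoD(2)[OF tendsto_mult_left[OF lim0, of G1], of "e / 2"] e by simp
    moreover have "eventually (\<lambda>t. G2 * t powr \<eta> < \<epsilon>) (at_right 0)" 
      using order_tendstoD(2)[OF tendsto_mult_left[OF lim0, of G2], of \<epsilon>] \<epsilon> by simp
    moreover have "eventually (\<lambda>t::real. 0 < t \<and> t < 1) (at_right 0)"
      by (auto simp: eventually_at_right_field intro!: exI[of _ 1])
    ultimately have "eventually (\<lambda>t. G1 * t powr \<eta> < e / 2 \<and> G2 * t powr \<eta> < \<epsilon> \<and> 0 < t \<and> t < 1) (at_right 0)"
      by eventually_elim auto
    then obtain t :: real where t: "0 < t" "t < 1" "G1 * t powr \<eta> < e / 2" "G2 * t powr \<eta> < \<epsilon>"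
      using eventually_happens[of _ "at_right (0::real)"] trivial_limit_at_right_real by blast
    \<comment> \<open>The covering selects balls of radius \<open>d\<close> and covers with radius
      \<open>3 * d\<close>. For \<open>z\<close> within \<open>3 * d\<close> of \<open>y\<close>,
      the ball of radius \<open>3 * d\<close> at \<open>z\<close> then lies inside
      \<open>ball y t\<close>, which in turn lies inside \<open>ball z (9 * d)\<close>.\<close>
    define d where "d = t / 6"
    have d: "0 < d" "t = 6 * d" using t unfolding d_def by auto
    \<comment> \<open>\<open>M\<close> may be infinite, so the covering lemma is applied to its
      restriction to \<open>W\<close>, which contains every ball of radius \<open>d\<close> in
      question because \<open>d < 1\<close>.\<close>
    define W where "W = ball x0 (n + 1)"
    define N' where "N' = density M (indicator W)"
    have N': "emeasure N' X = emeasure M (X \<inter> W)" if "X \<in> sets M" for X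
    proof -
      have "emeasure N' X = (\<integral>\<^sup>+y. indicator W y * indicator X y \<partial>M)"
        using that unfolding N'_def W_def by (subst emeasure_density) auto
      also have "\<dots> = (\<integral>\<^sup>+y. indicator (X \<inter> W) y \<partial>M)"
        by (intro nn_integral_cong) (auto simp: indicator_def)
      finally show ?thesis using that unfolding W_def by simp
    qed
    have setsN': "sets N' = sets M" unfolding N'_def by simp
    have finN': "finite_measure N'"
    proof
      show "emeasure N' (space N') \<noteq> \<infinity>"
        using emeasure_ball_finite[of x0 "n + 1"] N'[of UNIV] sets.top[of M] space_eq
        unfolding N'_def W_def by simp
    qed
    have sub: "ball y d \<subseteq> W" if "y \<in> ?F" for y
    proof
      fix z assume "z \<in> ball y d"
      then show "z \<in> W" using that d t dist_triangle[of x0 z y] unfolding W_def by auto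
    qed
    have mN': "measure N' (ball y d) = measure M (ball y d)" if "y \<in> ?F" for y
      using N'[of "ball y d"] sub[OF that] by (simp add: measure_def Int_absorb2)
    obtain D' where D': "countable D'" "D' \<subseteq> ?F" "?F \<subseteq> (\<Union>y\<in>D'. ball y (3 * d))"
      "(\<integral>\<^sup>+y. emeasure N' (ball y d) \<partial>count_space D') \<le> emeasure N' W"
      using vitali_finite_measure[OF finN', of W ?F "\<lambda>_. d" d] setsN' borel_sets sub mN'
        measure_ball_pos[OF d(1)] d(1) unfolding W_def by auto
    \<comment> \<open>The part of \<open>ball y t\<close> where \<open>v\<close> is far from its
      average. A point \<open>z\<close> of \<open>?F\<close> covered from \<open>y\<close> lies in
      it: the average is within \<open>e / 2\<close> of \<open>l z\<close>, while \<open>v z\<close>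
      is at distance at least \<open>e\<close>. Markov's inequality and the Poincare inequality make
      it small.\<close>
    define G where "G y = {z\<in>ball y t. e / 2 \<le> \<bar>v z - ball_average M v y t\<bar>}" for y
    have Gm: "G y \<in> sets M" for y
    proof -
      have "G y = ball y t \<inter> {z\<in>space M. e / 2 \<le> \<bar>v z - ball_average M v y t\<bar>}"
        unfolding G_def space_eq by auto
      also have "\<dots> \<in> sets M" using vD(2) by auto
      finally show ?thesis .
    qed
    have cover: "?F \<subseteq> (\<Union>y\<in>D'. G y)"
    proof
      fix z assume z: "z \<in> ?F"
      then obtain y where y: "y \<in> D'" "z \<in> ball y (3 * d)" using D'(3) by blast
      then have yF: "y \<in> ?F" using D'(2) by blast
      have zt: "z \<in> ball y t" using y d by auto
      have "\<bar>ball_average M v z (3 * d) - ball_average M v y t\<bar> \<le>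
        dil 3 * (K * (t * (measure N (ball y (\<sigma> * t)) / measure M (ball y t)) powr (1 / p)))"
      proof (rule poincare_pair_compare[OF v])
        show "0 < 3 * d" using d by simp
        show "ball z (3 * d) \<subseteq> ball y t"
        proof
          fix w assume "w \<in> ball z (3 * d)"
          then show "w \<in> ball y t" using y d dist_triangle[of y w z] by auto
        qed
        have "ball y t \<subseteq> ball z (3 * (3 * d))"
        proof
          fix w assume "w \<in> ball y t"
          then show "w \<in> ball z (3 * (3 * d))"
            using y d dist_triangle[of z w y] by (auto simp: dist_commute)
        qed
        then show "measure M (ball y t) \<le> dil 3 * measure M (ball z (3 * d))"
          using measure_ball_dil[of "3 * d" 3 z] d measure_ball_mono[of y t z "3 * (3 * d)"] by auto
      qed
      also have "\<dots> \<le> dil 3 * (K * (a * t powr \<eta>))"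
        using good_point_bound[of N m y t] yF t m K dp[of 3] unfolding a_def \<eta>_def
        by (intro mult_left_mono) auto
      finally have 1: "\<bar>ball_average M v z (3 * d) - ball_average M v y t\<bar> \<le> dil 3 * (K * a) * t powr \<eta>"
        by (simp add: mult_ac)
      have "\<bar>ball_average M v z (3 * d) - l z\<bar> \<le> tele \<eta> * (a * (3 * d) powr \<eta>)"
        using l[of m z] z m d t unfolding a_def by auto
      also have "\<dots> \<le> tele \<eta> * (a * t powr \<eta>)"
        using tele_pos[OF \<eta>] a d \<eta> by (intro mult_left_mono powr_mono2) auto
      finally have "\<bar>ball_average M v y t - l z\<bar> \<le> G1 * t powr \<eta>"
        using 1 unfolding G1_def by (simp add: algebra_simps)
      moreover have "e \<le> \<bar>v z - l z\<bar>" using z by auto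
      ultimately have "e / 2 \<le> \<bar>v z - ball_average M v y t\<bar>" using t(3) by linarith
      then show "z \<in> (\<Union>y\<in>D'. G y)" using y zt unfolding G_def by auto
    qed
    have "emeasure M (\<Union>y\<in>D'. G y) \<le> (\<integral>\<^sup>+y. emeasure M (G y) \<partial>count_space D')"
      using D'(1) Gm by (intro emeasure_UN_le_count_space)
    also have "\<dots> \<le> (\<integral>\<^sup>+y. ennreal (2 / e * (K * a * dil 6) * t powr \<eta>) * emeasure N' (ball y d) \<partial>count_space D')"
    proof (intro nn_integral_mono)
      fix y assume "y \<in> space (count_space D')"
      then have y: "y \<in> ?F" using D'(2) by auto
      have "ball_average M (\<lambda>z. \<bar>v z - ball_average M v y t\<bar>) y t \<le> K * (a * t powr \<eta>)"
      proof (rule order.trans[OF vD(5)[OF t(1), of y]], intro mult_left_mono)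
        show "t * (measure N (ball y (\<sigma> * t)) / measure M (ball y t)) powr (1 / p) \<le> a * t powr \<eta>"
          using good_point_bound[of N m y t] y t m unfolding a_def \<eta>_def by auto
      qed (use K in simp)
      then have "measure M (ball y t) * ball_average M (\<lambda>z. \<bar>v z - ball_average M v y t\<bar>) y t
        \<le> (dil 6 * measure M (ball y d)) * (K * (a * t powr \<eta>))"
        using measure_ball_dil[of d 6 y] d ball_average_dev_nonneg dp[of 6] by (intro mult_mono) auto
      then have "2 / e * (measure M (ball y t) * ball_average M (\<lambda>z. \<bar>v z - ball_average M v y t\<bar>) y t)
        \<le> 2 / e * (K * a * dil 6) * t powr \<eta> * measure M (ball y d)"
        using e by (simp add: field_simps)
      then have "emeasure M (G y) \<le> ennreal (2 / e * (K * a * dil 6) * t powr \<eta> * measure M (ball y d))"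
        using emeasure_dev_le[OF vD(1), of "e / 2" t y "ball_average M v y t"] e t(1)
        unfolding G_def by (simp add: order.trans[OF _ ennreal_leI])
      also have "\<dots> = ennreal (2 / e * (K * a * dil 6) * t powr \<eta>) * emeasure N' (ball y d)"
      proof -
        have "emeasure N' (ball y d) = ennreal (measure M (ball y d))"
          using N'[of "ball y d"] sub[OF y] by (simp add: Int_absorb2 emeasure_ball)
        moreover have "0 \<le> 2 / e * (K * a * dil 6) * t powr \<eta>"
          using e K a dp[of 6] by (intro mult_nonneg_nonneg) auto
        ultimately show ?thesis by (simp only: ennreal_mult')
      qed
      finally show "emeasure M (G y) \<le> ennreal (2 / e * (K * a * dil 6) * t powr \<eta>) * emeasure N' (ball y d)" .
    qed
    also have "\<dots> = ennreal (2 / e * (K * a * dil 6) * t powr \<eta>) * (\<integral>\<^sup>+y. emeasure N' (ball y d) \<partial>count_space D')"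
      by (rule nn_integral_cmult) auto
    also have "\<dots> \<le> ennreal (2 / e * (K * a * dil 6) * t powr \<eta>) * emeasure N' W"
      using D'(4) by (intro mult_left_mono) auto
    also have "\<dots> = ennreal (G2 * t powr \<eta>)"
    proof -
      have "emeasure N' W = ennreal (measure M W)"
        using N'[of W] unfolding W_def by (simp add: emeasure_ball)
      moreover have "0 \<le> 2 / e * (K * a * dil 6) * t powr \<eta>"
        using e K a dp[of 6] by (intro mult_nonneg_nonneg) auto
      moreover have "G2 * t powr \<eta> = 2 / e * (K * a * dil 6) * t powr \<eta> * measure M W"
        unfolding G2_def W_def by simp
      ultimately show ?thesis by (simp only: ennreal_mult')
    qed
    also have "\<dots> \<le> ennreal \<epsilon>" using t by (intro ennreal_leI) auto
    finally have "emeasure M (\<Union>y\<in>D'. G y) \<le> ennreal \<epsilon>" .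
    moreover have "(\<Union>y\<in>D'. G y) \<in> sets M" using D'(1) Gm by (intro sets.countable_UN') auto
    ultimately show "\<exists>A\<in>sets M. ?F \<subseteq> A \<and> emeasure M A \<le> ennreal \<epsilon>" using cover by blast
  qed
  obtain x0 :: 'a where True by blast
  define Z where "Z = {y. \<forall>m::nat. \<not> good_point N (real m) y} \<union>
    (\<Union>n::nat. \<Union>m::nat. \<Union>j::nat. {y\<in>ball x0 (real n). good_point N (real m) y \<and> 1 / real (Suc j) \<le> \<bar>v y - l y\<bar>})"
  have "Z \<in> null_sets M"
    unfolding Z_def using AE_good_point[OF vD(3,4)] null by (intro null_sets.Un null_sets_UN) auto
  moreover have "{y\<in>space M. \<not> (ball_average M v y \<longlongrightarrow> v y) (at_right 0)} \<subseteq> Z"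
  proof
    fix y assume y: "y \<in> {y\<in>space M. \<not> (ball_average M v y \<longlongrightarrow> v y) (at_right 0)}"
    show "y \<in> Z"
    proof (rule ccontr)
      assume "y \<notin> Z"
      then obtain m :: nat where m: "good_point N (real m) y" unfolding Z_def by auto
      obtain n :: nat where n: "dist x0 y < real n" using reals_Archimedean2 by blast
      have "\<bar>v y - l y\<bar> < 1 / real (Suc j)" for j
        using \<open>y \<notin> Z\<close> m n unfolding Z_def by (auto simp: not_le)
      then have "\<not> 0 < \<bar>v y - l y\<bar>"
        using nat_approx_posE[of "\<bar>v y - l y\<bar>"] by (metis less_asym)
      then have "v y = l y" by simp
      with l[OF m] y show False by simp
    qed
  qed
  ultimately show ?thesis by (rule AE_I')
qed

end

section \<open>The Sobolev-Poincare inequality\<close>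

lemma Bex_dyadic_level:
  fixes z T :: real
  assumes "0 < T" "T < z"
  obtains j :: nat where "2 ^ j * T < z" "z \<le> 2 ^ Suc j * T"
proof -
  have ex: "\<exists>n. z \<le> 2 ^ n * T"
  proof -
    obtain n where "z / T < 2 ^ n" using real_arch_pow[of 2 "z / T"] by auto
    then show ?thesis using assms by (auto simp: field_simps intro!: exI[of _ n])
  qed
  define m where "m = (LEAST n. z \<le> 2 ^ n * T)"
  have m: "z \<le> 2 ^ m * T" unfolding m_def by (rule LeastI_ex) fact
  have "m \<noteq> 0" using m assms by (cases m) auto
  then obtain j where mj: "m = Suc j" by (cases m) auto
  then have "\<not> z \<le> 2 ^ j * T"
    using not_less_Least[of j "\<lambda>n. z \<le> 2 ^ n * T"] unfolding m_def by auto
  with m mj that[of j] show thesis by auto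
qed

definition truncation :: "real \<Rightarrow> real \<Rightarrow> real \<Rightarrow> real" where
  "truncation a b t = max a (min b t)"

context poincare_setting
begin

text \<open>The Sobolev exponent of \<open>p\<close> in dimension \<open>Q\<close>.\<close>

definition pstar :: real where
  "pstar = Q * p / (Q - p)"

lemma pstar: "0 < pstar" "1 / pstar = 1 / p - 1 / Q" "pstar / Q + 1 = pstar / p" "1 \<le> pstar / p"
  unfolding pstar_def using p by (auto simp: field_simps)

lemma measure_ball_shift:
  assumes "y \<in> ball x R"
  shows "measure M (ball x (2 * R)) \<le> dil 3 * measure M (ball y R)"
proof -
  have R: "0 < R" using assms zero_le_dist[of x y] unfolding mem_ball by linarith
  have "ball x (2 * R) \<subseteq> ball y (3 * R)"
  proof
    fix w assume "w \<in> ball x (2 * R)"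
    then show "w \<in> ball y (3 * R)"
      using assms dist_triangle[of y w x] by (auto simp: dist_commute)
  qed
  then show ?thesis
    using measure_ball_dil[of R 3 y] measure_ball_mono[of x "2 * R" y "3 * R"] R by linarith
qed

text \<open>A choice of the constant of \<open>hedberg_sum_bound\<close>, so that it can be named in
  the constants built from it.\<close>

definition hedberg_const :: real where
  "hedberg_const = (SOME H. 0 < H \<and> (\<forall>A \<tau> n. 0 < A \<longrightarrow> 0 < \<tau> \<longrightarrow>
      (\<Sum>k<n. (1/2) ^ k * (min \<tau> (A * (2 ^ k) powr Q)) powr (1 / p))
        \<le> H * (\<tau> powr (1 / p - 1 / Q) * A powr (1 / Q))))"

lemma hedberg_const:
  "0 < hedberg_const"
  "0 < A \<Longrightarrow> 0 < \<tau> \<Longrightarrow> (\<Sum>k<n. (1/2) ^ k * (min \<tau> (A * (2 ^ k) powr Q)) powr (1 / p))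
        \<le> hedberg_const * (\<tau> powr (1 / p - 1 / Q) * A powr (1 / Q))"
proof -
  have "\<exists>H. 0 < H \<and> (\<forall>A \<tau> n. 0 < A \<longrightarrow> 0 < \<tau> \<longrightarrow>
      (\<Sum>k<n. (1/2) ^ k * (min \<tau> (A * (2 ^ k) powr Q)) powr (1 / p))
        \<le> H * (\<tau> powr (1 / p - 1 / Q) * A powr (1 / Q)))"
  proof (rule hedberg_sum_bound[OF p])
    fix H :: real
    assume "0 < H" "\<And>A \<tau> n. 0 < A \<Longrightarrow> 0 < \<tau> \<Longrightarrow>
      (\<Sum>k<n. (1/2) ^ k * (min \<tau> (A * (2 ^ k) powr Q)) powr (1 / p))
        \<le> H * (\<tau> powr (1 / p - 1 / Q) * A powr (1 / Q))"
    then show ?thesis by (intro exI[of _ H]) simp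
  qed
  from someI_ex[OF this] show
    "0 < hedberg_const"
    "0 < A \<Longrightarrow> 0 < \<tau> \<Longrightarrow> (\<Sum>k<n. (1/2) ^ k * (min \<tau> (A * (2 ^ k) powr Q)) powr (1 / p))
        \<le> hedberg_const * (\<tau> powr (1 / p - 1 / Q) * A powr (1 / Q))"
    unfolding hedberg_const_def[symmetric] by auto
qed

text \<open>The first summand is the telescoping sum at \<open>y\<close>;
  \<open>(1 / c) powr (1 / Q)\<close> appears because volume decay replaces \<open>A\<close> by
  \<open>A / c\<close>. The second summand moves the centre from \<open>y\<close> to
  \<open>x\<close> through \<open>ball x (2 * R)\<close>: two comparisons, each at radius
  \<open>2 * R\<close>.\<close>

definition osc_const :: real where
  "osc_const = D * K * hedberg_const * (1 / c) powr (1 / Q) + 4 * (dil 3 * K)"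

lemma osc_const_pos: "0 < osc_const"
  unfolding osc_const_def using D K hedberg_const(1) c dil_ge_1[of 3] 
  by (intro add_pos_pos mult_pos_pos) auto

text \<open>The telescoping series reaches \<open>v y\<close> because \<open>y\<close> is a Lebesgue
  point. Each density in it has two bounds: \<open>\<tau>\<close> by the assumption on
  \<open>y\<close>, and \<open>A / c * (2 ^ k) powr Q\<close> because \<open>N\<close> of the small
  ball is at most \<open>N\<close> of the large one and \<open>M\<close> decays at most with order
  \<open>Q\<close>. \<open>hedberg_sum_bound\<close> combines them.\<close>

lemma pointwise_oscillation:
  assumes v: "poincare_pair v N" and R: "0 < R" and A: "0 < A" "A \<le> \<tau>"
    and NA: "measure N (ball x (2 * \<sigma> * R)) \<le> A * measure M (ball x R)"
    and y: "y \<in> ball x R" and leb: "(ball_average M v y \<longlongrightarrow> v y) (at_right 0)"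
    and good: "\<And>k. measure N (ball y (\<sigma> * (R / 2 ^ k))) \<le> \<tau> * measure M (ball y (R / 2 ^ k))"
  shows "\<bar>v y - ball_average M v x R\<bar> \<le> osc_const * R * (\<tau> powr (1 / pstar) * A powr (1 / Q))"
proof -
  note vD = poincare_pairD[OF v]
  interpret N: finite_measure N by (rule vD(3))
  have t: "0 < \<tau>" using A by simp
  define Z where "Z = \<tau> powr (1 / pstar) * A powr (1 / Q)"
  have ballN: "ball z r \<in> sets N" for z r using vD(4) by simp
  have trm: "R / 2 ^ k * (measure N (ball y (\<sigma> * (R / 2 ^ k))) / measure M (ball y (R / 2 ^ k))) powr (1 / p)
      \<le> R * ((1 / 2) ^ k * (min \<tau> (A / c * (2 ^ k) powr Q)) powr (1 / p))" for k
  proof -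
    have Rk: "0 < R / 2 ^ k" "R / 2 ^ k \<le> R" using R by (auto simp: field_simps)
    note pos = measure_ball_pos[OF Rk(1), of y]
    have "ball y (\<sigma> * (R / 2 ^ k)) \<subseteq> ball x (2 * \<sigma> * R)"
    proof
      fix w assume "w \<in> ball y (\<sigma> * (R / 2 ^ k))"
      moreover have "\<sigma> * (R / 2 ^ k) \<le> \<sigma> * R" "R \<le> \<sigma> * R" using mult_left_mono[OF Rk(2), of \<sigma>] \<sigma> R by auto
      ultimately show "w \<in> ball x (2 * \<sigma> * R)"
        using y dist_triangle[of x w y] by auto
    qed
    then have "measure N (ball y (\<sigma> * (R / 2 ^ k))) \<le> measure N (ball x (2 * \<sigma> * R))"
      using ballN by (intro N.finite_measure_mono) auto
    also have "\<dots> \<le> A * measure M (ball x R)" by (rule NA)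
    also have "\<dots> \<le> A * ((2 ^ k) powr Q / c * measure M (ball y (R / 2 ^ k)))"
    proof (intro mult_left_mono)
      have eq: "(R / 2 ^ k / R) powr Q = 1 / (2 ^ k) powr Q"
        using R by (simp add: powr_divide)
      have "c * (1 / (2 ^ k) powr Q) * measure M (ball x R) \<le> measure M (ball y (R / 2 ^ k))"
        using decay[OF y Rk] unfolding eq .
      then show "measure M (ball x R) \<le> (2 ^ k) powr Q / c * measure M (ball y (R / 2 ^ k))"
        using c by (simp add: field_simps)
    qed (use A in simp)
    finally have 1: "measure N (ball y (\<sigma> * (R / 2 ^ k))) / measure M (ball y (R / 2 ^ k))
      \<le> A / c * (2 ^ k) powr Q"
      using pos by (simp add: pos_divide_le_eq mult_ac)
    have 2: "measure N (ball y (\<sigma> * (R / 2 ^ k))) / measure M (ball y (R / 2 ^ k)) \<le> \<tau>"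
      using good[of k] pos by (simp add: divide_simps mult_ac)
    have "(measure N (ball y (\<sigma> * (R / 2 ^ k))) / measure M (ball y (R / 2 ^ k))) powr (1 / p)
      \<le> (min \<tau> (A / c * (2 ^ k) powr Q)) powr (1 / p)"
      using 1 2 p by (intro powr_mono2) auto
    then have "R / 2 ^ k * (measure N (ball y (\<sigma> * (R / 2 ^ k))) / measure M (ball y (R / 2 ^ k))) powr (1 / p)
      \<le> R / 2 ^ k * (min \<tau> (A / c * (2 ^ k) powr Q)) powr (1 / p)"
      using Rk by (intro mult_left_mono) auto
    moreover have "R / 2 ^ k * Y = R * ((1 / 2) ^ k * Y)" for Y by (simp add: power_one_over)
    ultimately show ?thesis by (simp only:)
  qed
  have tel: "\<bar>ball_average M v y (R / 2 ^ n) - ball_average M v y R\<bar>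
      \<le> D * K * hedberg_const * (1 / c) powr (1 / Q) * R * Z" for n
  proof -
    have "\<bar>ball_average M v y (R / 2 ^ n) - ball_average M v y R\<bar>
    \<le> D * K * (\<Sum>k<n. R / 2 ^ k *
        (measure N (ball y (\<sigma> * (R / 2 ^ k))) / measure M (ball y (R / 2 ^ k))) powr (1 / p))"
      by (rule dyadic_telescope[OF v R])
    also have "\<dots> \<le> D * K * (\<Sum>k<n. R * ((1 / 2) ^ k * (min \<tau> (A / c * (2 ^ k) powr Q)) powr (1 / p)))"
      using D K by (intro mult_left_mono sum_mono trm) auto
    also have "\<dots> = D * K * R * (\<Sum>k<n. (1 / 2) ^ k * (min \<tau> (A / c * (2 ^ k) powr Q)) powr (1 / p))"
      by (simp only: sum_distrib_left mult.assoc)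
    also have "\<dots> \<le> D * K * R * (hedberg_const * (\<tau> powr (1 / p - 1 / Q) * (A / c) powr (1 / Q)))"
      using D K R A c t by (intro mult_left_mono hedberg_const(2)) auto
    also have "\<dots> = D * K * hedberg_const * (1 / c) powr (1 / Q) * R * Z"
      unfolding Z_def pstar(2) using A c by (simp add: powr_divide)
    finally show ?thesis .
  qed
  have lim: "(\<lambda>n. ball_average M v y (R / 2 ^ n)) \<longlonglongrightarrow> v y"
  proof (rule filterlim_compose[OF leb])
    show "filterlim (\<lambda>n. R / 2 ^ n) (at_right 0) sequentially"
      using LIMSEQ_divide_realpow_zero[of 2 R] R by (auto simp: filterlim_at intro!: always_eventually)
  qed
  have 1: "\<bar>v y - ball_average M v y R\<bar> \<le> D * K * hedberg_const * (1 / c) powr (1 / Q) * R * Z"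
  proof (rule tendsto_upperbound)
    show "(\<lambda>n. \<bar>ball_average M v y (R / 2 ^ n) - ball_average M v y R\<bar>)
      \<longlonglongrightarrow> \<bar>v y - ball_average M v y R\<bar>"
      using lim by (intro tendsto_intros)
  qed (use tel in auto)
  \<comment> \<open>Used for \<open>z = y\<close> and for \<open>z = x\<close>. Here
    \<open>A \<le> \<tau>\<close> enters: \<open>A powr (1 / p)\<close> factors as
    \<open>A powr (1 / pstar) * A powr (1 / Q)\<close>, which is at most \<open>Z\<close>.\<close>
  have big: "\<bar>ball_average M v z R - ball_average M v x (2 * R)\<bar> \<le> 2 * (dil 3 * K) * R * Z"
    if z: "z \<in> ball x R" for z
  proof -
    have "\<bar>ball_average M v z R - ball_average M v x (2 * R)\<bar> \<le> dil 3 * (K * (2 * R *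
      (measure N (ball x (\<sigma> * (2 * R))) / measure M (ball x (2 * R))) powr (1 / p)))"
    proof (rule poincare_pair_compare[OF v R])
      show "ball z R \<subseteq> ball x (2 * R)"
      proof
        fix w assume "w \<in> ball z R"
        then show "w \<in> ball x (2 * R)" using z dist_triangle[of x w z] by auto
      qed
    qed (rule measure_ball_shift[OF z])
    also have "\<dots> \<le> dil 3 * (K * (2 * R * Z))"
    proof (intro mult_left_mono)
      have "measure N (ball x (\<sigma> * (2 * R))) \<le> A * measure M (ball x R)"
        using NA by (simp add: mult_ac)
      also have "\<dots> \<le> A * measure M (ball x (2 * R))"
        using A R by (intro mult_left_mono measure_ball_mono subset_ball) auto
      finally have "measure N (ball x (\<sigma> * (2 * R))) / measure M (ball x (2 * R)) \<le> A"
        using measure_ball_pos[of "2 * R" x] R by (simp add: divide_simps)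
      then have "(measure N (ball x (\<sigma> * (2 * R))) / measure M (ball x (2 * R))) powr (1 / p) \<le> A powr (1 / p)"
        using p by (intro powr_mono2) auto
      also have "\<dots> = A powr (1 / pstar) * A powr (1 / Q)"
        using A unfolding pstar(2) by (simp add: powr_add[symmetric])
      also have "\<dots> \<le> Z"
        unfolding Z_def using A pstar(1) by (intro mult_right_mono powr_mono2) auto
      finally show "(measure N (ball x (\<sigma> * (2 * R))) / measure M (ball x (2 * R))) powr (1 / p) \<le> Z" .
    qed (use K R dil_ge_1[of 3] in auto)
    finally show ?thesis by (simp add: mult_ac)
  qed
  have "\<bar>ball_average M v y R - ball_average M v x R\<bar> \<le> 4 * (dil 3 * K) * R * Z"
    using big[OF y] big[of x] R by auto
  with 1 have "\<bar>v y - ball_average M v x R\<bar>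
    \<le> D * K * hedberg_const * (1 / c) powr (1 / Q) * R * Z + 4 * (dil 3 * K) * R * Z" by linarith
  then show ?thesis unfolding osc_const_def Z_def by (simp add: algebra_simps)
qed

definition weak_const :: real where
  "weak_const = osc_const powr pstar * dil (3 * \<sigma>)"

lemma weak_const_pos: "0 < weak_const"
  unfolding weak_const_def using osc_const_pos dil_ge_1[of "3 * \<sigma>"] by auto

lemma level_set_measurable:
  fixes v :: "'a \<Rightarrow> real"
  assumes [measurable]: "v \<in> borel_measurable M"
  shows "{y\<in>ball x R. s < \<bar>v y - k\<bar>} \<in> sets M"
proof -
  have "{y\<in>ball x R. s < \<bar>v y - k\<bar>} = ball x R \<inter> {y\<in>space M. s < \<bar>v y - k\<bar>}"
    using space_eq by auto
  moreover have "{y\<in>space M. s < \<bar>v y - k\<bar>} \<in> sets M" by measurable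
  ultimately show ?thesis by simp
qed

lemma weak_type_aux:
  assumes v: "poincare_pair v N" and R: "0 < R" and s: "0 < s" and A: "0 < A"
    and NA: "measure N (ball x (2 * \<sigma> * R)) \<le> A * measure M (ball x R)"
  shows "measure M {y\<in>ball x R. s < \<bar>v y - ball_average M v x R\<bar>}
    \<le> weak_const * (R / s) powr pstar * A powr (pstar / p) * measure M (ball x R)" (is "measure M ?S \<le> _")
proof -
  note vD = poincare_pairD[OF v]
  define G where "G = osc_const"
  have G: "0 < G" unfolding G_def by (rule osc_const_pos)
  note Sm = level_set_measurable[OF vD(2)]
  show ?thesis
  proof (cases "G * R * A powr (1 / p) \<le> s")
    case True
    \<comment> \<open>Makes the bound of \<open>pointwise_oscillation\<close> equal to
      \<open>s\<close>; hence, up to a null set, \<open>?S\<close> lies where some density of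
      \<open>N\<close> exceeds \<open>\<tau>\<close>. The case assumption on \<open>s\<close> is
      equivalent to \<open>A \<le> \<tau>\<close>.\<close>
    define \<tau> where "\<tau> = (s / (G * R * A powr (1 / Q))) powr pstar"
    have t: "0 < \<tau>" unfolding \<tau>_def using s G R A by auto
    have "A powr (1 / pstar) \<le> s / (G * R * A powr (1 / Q))"
    proof -
      have "A powr (1 / pstar) * A powr (1 / Q) = A powr (1 / p)"
        using A unfolding pstar(2) by (simp add: powr_add[symmetric])
      then have "G * R * (A powr (1 / pstar) * A powr (1 / Q)) \<le> s" using True by simp
      then show ?thesis using G R A by (simp add: pos_le_divide_eq mult_ac)
    qed
    then have "(A powr (1 / pstar)) powr pstar \<le> \<tau>"
      unfolding \<tau>_def using pstar(1) by (intro powr_mono2) auto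
    then have At: "A \<le> \<tau>" using A pstar(1) by (simp add: powr_powr)
    have seq: "osc_const * R * (\<tau> powr (1 / pstar) * A powr (1 / Q)) = s"
      unfolding \<tau>_def G_def[symmetric] using s G R A pstar(1) by (simp add: powr_powr)
    define F where "F = {y\<in>ball x R. \<exists>k. \<tau> * measure M (ball y (R / 2 ^ k)) < measure N (ball y (\<sigma> * (R / 2 ^ k)))}"
    obtain B where B: "B \<in> sets M" "F \<subseteq> B"
      "emeasure M B \<le> ennreal (dil (3 * \<sigma>) / \<tau> * measure N (ball x (2 * \<sigma> * R)))"
    proof (rule maximal_cover[OF vD(3,4) t, of "ball x (2 * \<sigma> * R)" F R])
      fix y assume "y \<in> F"
      then obtain k where k: "y \<in> ball x R"
        "\<tau> * measure M (ball y (R / 2 ^ k)) < measure N (ball y (\<sigma> * (R / 2 ^ k)))"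
        unfolding F_def by auto
      have Rk: "0 < R / 2 ^ k" "R / 2 ^ k \<le> R" using R by (auto simp: field_simps)
      have "ball y (\<sigma> * (R / 2 ^ k)) \<subseteq> ball x (2 * \<sigma> * R)"
      proof
        fix w assume "w \<in> ball y (\<sigma> * (R / 2 ^ k))"
        moreover have "\<sigma> * (R / 2 ^ k) \<le> \<sigma> * R" "R \<le> \<sigma> * R" using mult_left_mono[OF Rk(2), of \<sigma>] \<sigma> R by auto
        ultimately show "w \<in> ball x (2 * \<sigma> * R)"
          using k dist_triangle[of x w y] by auto
      qed
      with k Rk show "\<exists>r>0. r \<le> R \<and> ball y (\<sigma> * r) \<subseteq> ball x (2 * \<sigma> * R) \<and>
        \<tau> * measure M (ball y r) < measure N (ball y (\<sigma> * r))" by blast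
    qed auto
    have "AE y in M. y \<in> ?S \<longrightarrow> y \<in> B"
      using averages_tendsto_AE[OF v]
    proof eventually_elim
      case (elim y)
      show ?case
      proof
        assume y: "y \<in> ?S"
        have "y \<in> F"
        proof (rule ccontr)
          assume "y \<notin> F"
          then have "\<bar>v y - ball_average M v x R\<bar> \<le> s"
            using pointwise_oscillation[OF v R A At NA _ elim] y seq unfolding F_def by (auto simp: not_less)
          with y show False by auto
        qed
        then show "y \<in> B" using B by blast
      qed
    qed
    then have "emeasure M ?S \<le> emeasure M B"
      using B(1) by (intro emeasure_mono_AE) auto
    also have "\<dots> \<le> ennreal (dil (3 * \<sigma>) / \<tau> * measure N (ball x (2 * \<sigma> * R)))" by (rule B(3))
    also have "\<dots> \<le> ennreal (dil (3 * \<sigma>) / \<tau> * (A * measure M (ball x R)))"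
      using NA t dil_ge_1[of "3 * \<sigma>"] by (intro ennreal_leI mult_left_mono) auto
    finally have "measure M ?S \<le> dil (3 * \<sigma>) / \<tau> * (A * measure M (ball x R))"
      unfolding measure_def[of M ?S] using t A dil_ge_1[of "3 * \<sigma>"]
      by (intro enn2real_leI) auto
    also have "\<dots> = dil (3 * \<sigma>) * (A / \<tau>) * measure M (ball x R)" by simp
    also have "A / \<tau> = G powr pstar * (R / s) powr pstar * A powr (pstar / p)"
    proof -
      have "A / \<tau> = A * ((G * R * A powr (1 / Q)) powr pstar / s powr pstar)"
        unfolding \<tau>_def using s G R A by (simp add: powr_divide)
      also have "\<dots> = G powr pstar * (R / s) powr pstar * (A * A powr (pstar / Q))"
        using s G R A by (simp add: powr_mult powr_divide powr_powr)
      also have "A * A powr (pstar / Q) = A powr (pstar / p)"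
        using A unfolding pstar(3)[symmetric] by (simp add: powr_add)
      finally show ?thesis .
    qed
    finally show ?thesis unfolding weak_const_def G_def by (simp add: mult_ac)
  next
    case False
    \<comment> \<open>For small \<open>s\<close> the claimed bound already exceeds the measure of
      the whole ball.\<close>
    have "1 \<le> G powr pstar * (R / s) powr pstar * A powr (pstar / p)"
    proof -
      have "1 \<le> (G * R * A powr (1 / p) / s) powr pstar"
        using False s pstar(1) by (intro ge_one_powr_ge_zero) auto
      also have "\<dots> = G powr pstar * (R / s) powr pstar * A powr (pstar / p)"
        using s G R A by (simp add: powr_mult powr_divide powr_powr)
      finally show ?thesis .
    qed
    also have "\<dots> \<le> G powr pstar * (R / s) powr pstar * A powr (pstar / p) * dil (3 * \<sigma>)"
      using mult_left_mono[OF dil_ge_1[of "3 * \<sigma>"], of "G powr pstar * (R / s) powr pstar * A powr (pstar / p)"]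
      by simp
    finally have 1: "1 \<le> weak_const * (R / s) powr pstar * A powr (pstar / p)"
      unfolding weak_const_def G_def by (simp add: mult_ac)
    have "measure M ?S \<le> measure M (ball x R)"
      using Sm by (intro measure_mono_fmeasurable) auto
    also have "\<dots> \<le> weak_const * (R / s) powr pstar * A powr (pstar / p) * measure M (ball x R)"
      using mult_right_mono[OF 1, of "measure M (ball x R)"] by simp
    finally show ?thesis .
  qed
qed

text \<open>The splitting argument divides by powers of \<open>A\<close>. Since the hypothesis holds
  for every \<open>B > A\<close>, letting \<open>B\<close> decrease to \<open>A\<close> admits
  \<open>A = 0\<close> as well.\<close>

lemma weak_type:
  assumes v: "poincare_pair v N" and R: "0 < R" and s: "0 < s" and A: "0 \<le> A"
    and NA: "measure N (ball x (2 * \<sigma> * R)) \<le> A * measure M (ball x R)"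
  shows "measure M {y\<in>ball x R. s < \<bar>v y - ball_average M v x R\<bar>}
    \<le> weak_const * (R / s) powr pstar * A powr (pstar / p) * measure M (ball x R)"
proof (rule tendsto_lowerbound)
  have "((\<lambda>B. B powr (pstar / p)) \<longlongrightarrow> A powr (pstar / p)) (at_right A)"
  proof (rule tendsto_powr')
    have "eventually (\<lambda>B. 0 \<le> B) (at_right A)"
      by (rule eventually_mono[OF eventually_at_right_less[of A]]) (use A in auto)
    then show "A \<noteq> 0 \<or> 0 < pstar / p \<and> (\<forall>\<^sub>F B in at_right A. 0 \<le> B)"
      using pstar(4) by linarith
  qed auto
  then show "((\<lambda>B. weak_const * (R / s) powr pstar * B powr (pstar / p) * measure M (ball x R)) \<longlongrightarrow>
    weak_const * (R / s) powr pstar * A powr (pstar / p) * measure M (ball x R)) (at_right A)"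
    by (intro tendsto_mult tendsto_const)
  show "\<forall>\<^sub>F B in at_right A. measure M {y \<in> ball x R. s < \<bar>v y - ball_average M v x R\<bar>}
           \<le> weak_const * (R / s) powr pstar * B powr (pstar / p) * measure M (ball x R)"
    using eventually_at_right_less[of A]
  proof (rule eventually_mono)
    fix B assume "A < B"
    then have "measure N (ball x (2 * \<sigma> * R)) \<le> B * measure M (ball x R)"
      using mult_right_mono[of A B "measure M (ball x R)"] NA by simp
    then show "measure M {y \<in> ball x R. s < \<bar>v y - ball_average M v x R\<bar>}
           \<le> weak_const * (R / s) powr pstar * B powr (pstar / p) * measure M (ball x R)"
      using A \<open>A < B\<close> by (intro weak_type_aux[OF v R s]) auto
  qed
qed simp

end

lemma finite_measure_density_indicator:
  assumes "finite_measure N" "S \<in> sets N"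
  shows "finite_measure (density N (indicator S))"
    "A \<in> sets N \<Longrightarrow> measure (density N (indicator S)) A = measure N (S \<inter> A)"
proof -
  interpret finite_measure N by fact
  have em: "emeasure (density N (indicator S)) A = emeasure N (S \<inter> A)" if "A \<in> sets N" for A
  proof -
    have "emeasure (density N (indicator S)) A = (\<integral>\<^sup>+y. indicator S y * indicator A y \<partial>N)"
      using that assms(2) by (subst emeasure_density) auto
    also have "\<dots> = (\<integral>\<^sup>+y. indicator (S \<inter> A) y \<partial>N)"
      by (intro nn_integral_cong) (auto simp: indicator_def)
    finally show ?thesis using that assms(2) by simp
  qed
  show "finite_measure (density N (indicator S))"
    using em[of "space N"] by (intro finite_measureI) simp
  show "A \<in> sets N \<Longrightarrow> measure (density N (indicator S)) A = measure N (S \<inter> A)"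
    using em[of A] by (simp add: measure_def)
qed

text \<open>The left side vanishes unless \<open>t\<close> exceeds the lower level, and is then at
  most \<open>t - (m + X / 2)\<close>. So the mean deviation of a truncation from its lower level is
  controlled by the oscillation of the function itself.\<close>

lemma truncation_dev: "0 < X \<Longrightarrow> \<bar>truncation (m + X / 2) (m + X) t - (m + X / 2)\<bar> \<le> \<bar>t - m\<bar>"
  unfolding truncation_def by (auto simp: max_def min_def abs_if)

section \<open>From weak to strong type by truncation\<close>

context poincare_setting
begin

lemma ball_average_mono:
  assumes "set_integrable M (ball x r) f" "set_integrable M (ball x r) g"
    "\<And>y. y \<in> ball x r \<Longrightarrow> f y \<le> g y"
  shows "ball_average M f x r \<le> ball_average M g x r"
  unfolding ball_average_def using assms by (intro divide_right_mono set_integral_mono) auto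

lemma ball_average_uminus: "ball_average M (\<lambda>y. - v y) x r = - ball_average M v x r"
  unfolding ball_average_def set_lebesgue_integral_def by simp

lemma poincare_pair_uminus:
  assumes "poincare_pair v N"
  shows "poincare_pair (\<lambda>y. - v y) N"
proof -
  have "\<bar>- a - - b\<bar> = \<bar>a - b\<bar>" for a b :: real by simp
  moreover have "locally_integrable (\<lambda>y. - v y)"
    using poincare_pairD(1)[OF assms] unfolding locally_integrable_def set_integrable_def by auto
  ultimately show ?thesis
    using assms unfolding poincare_pair_def ball_average_uminus by simp
qed

text \<open>The strict inequalities make consecutive layers disjoint, so the restricted measures of
  all layers together have at most the mass of \<open>N\<close>.\<close>

definition truncation_pair :: "('a \<Rightarrow> real) \<Rightarrow> 'a measure \<Rightarrow> bool" where
  "truncation_pair u N \<longleftrightarrow> poincare_pair u N \<and>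
    (\<forall>a b. a < b \<longrightarrow>
      poincare_pair (\<lambda>y. truncation a b (u y)) (density N (indicator {y. a < u y \<and> u y < b})))"

text \<open>The symmetry by which an estimate of the positive part of \<open>u - m\<close> also
  yields that of the negative part.\<close>

lemma truncation_pair_uminus:
  assumes "truncation_pair u N"
  shows "truncation_pair (\<lambda>y. - u y) N"
  unfolding truncation_pair_def
proof (intro conjI allI impI)
  show "poincare_pair (\<lambda>y. - u y) N"
    using assms poincare_pair_uminus unfolding truncation_pair_def by blast
  fix a b :: real assume "a < b"
  then have "poincare_pair (\<lambda>y. truncation (- b) (- a) (u y)) (density N (indicator {y. - b < u y \<and> u y < - a}))"
    using assms unfolding truncation_pair_def by auto
  from poincare_pair_uminus[OF this]
  have "poincare_pair (\<lambda>y. - truncation (- b) (- a) (u y)) (density N (indicator {y. - b < u y \<and> u y < - a}))" .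
  moreover have "(\<lambda>y. - truncation (- b) (- a) (u y)) = (\<lambda>y. truncation a b (- u y))"
    using \<open>a < b\<close> by (auto simp: truncation_def min_def max_def)
  moreover have "{y. - b < u y \<and> u y < - a} = {y. a < - u y \<and> - u y < b}" by auto
  ultimately show "poincare_pair (\<lambda>y. truncation a b (- u y)) (density N (indicator {y. a < - u y \<and> - u y < b}))"
    by simp
qed

text \<open>\<open>4 * K\<close> is the ratio \<open>T / t\<close> of the threshold below which
  nothing has to be estimated; 16 is the quotient of \<open>2 ^ Suc j * T\<close>, the largest value
  on layer \<open>j\<close>, and \<open>2 ^ j * T / 8\<close>, the level used in the weak type
  estimate.\<close>

definition strong_const :: real where
  "strong_const = (4 * K) powr pstar + weak_const * 16 powr pstar"

lemma strong_const_pos: "0 < strong_const"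
  unfolding strong_const_def using K weak_const_pos by (intro add_pos_pos) auto

text \<open>Maz'ya's truncation argument: the weak type estimate is applied to the truncations of \<open>u\<close>
  between consecutive dyadic levels.\<close>

lemma strong_type_upper:
  assumes u: "truncation_pair u N" and R: "0 < R" and t: "0 < t"
    and Rt: "R * (measure N (ball x (2 * \<sigma> * R)) / measure M (ball x R)) powr (1 / p) \<le> t"
  shows "(\<integral>\<^sup>+y\<in>ball x R. ennreal ((max 0 (u y - ball_average M u x R)) powr pstar) \<partial>M)
    \<le> ennreal (strong_const * t powr pstar * measure M (ball x R))"
proof -
  define B where "B = ball x R"
  define W where "W = ball x (2 * \<sigma> * R)"
  define m where "m = ball_average M u x R"
  \<comment> \<open>Chosen so that the mean oscillation of \<open>u\<close> is at most
    \<open>K * t = T / 4\<close>; then each truncation has its average within \<open>T / 4\<close>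
    of its lower level.\<close>
  define T where "T = 4 * K * t"
  define A where "A = measure N W / measure M B"
  define S where "S j = {y. m + 2 ^ j * T / 2 < u y \<and> u y < m + 2 ^ j * T}" for j :: nat
  define Aj where "Aj j = measure N (S j \<inter> W) / measure M B" for j
  define L where "L j = {y\<in>B. 2 ^ j * T < u y - m}" for j :: nat
  have uP: "poincare_pair u N"
    and tr: "\<And>a b. a < b \<Longrightarrow> poincare_pair (\<lambda>y. truncation a b (u y)) (density N (indicator {y. a < u y \<and> u y < b}))"
    using u unfolding truncation_pair_def by auto
  note uD = poincare_pairD[OF uP]
  have um [measurable]: "u \<in> borel_measurable M" by (rule uD(2))
  interpret N: finite_measure N by (rule uD(3))
  have T: "0 < T" unfolding T_def using K t by simp
  have mB: "0 < measure M B" unfolding B_def using R by (rule measure_ball_pos)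
  have BM [measurable]: "B \<in> sets M" unfolding B_def by simp
  have WN: "W \<in> sets N" unfolding W_def uD(4) by simp
  have collect: "{y. P y} = {y\<in>space M. P y}" for P using space_eq by auto
  have SN: "S j \<in> sets N" for j
    unfolding S_def uD(4) by (subst collect) measurable
  have LM [measurable]: "L j \<in> sets M" for j
  proof -
    have "L j = B \<inter> {y\<in>space M. 2 ^ j * T < u y - m}" unfolding L_def using space_eq by auto
    moreover have "{y\<in>space M. 2 ^ j * T < u y - m} \<in> sets M" by measurable
    ultimately show ?thesis by simp
  qed
  have A0: "0 \<le> A" "0 \<le> Aj j" for j unfolding A_def Aj_def by auto
  have osc: "ball_average M (\<lambda>y. \<bar>u y - m\<bar>) x R \<le> T / 4"
  proof -
    have "ball_average M (\<lambda>y. \<bar>u y - m\<bar>) x R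
      \<le> K * (R * (measure N (ball x (\<sigma> * R)) / measure M (ball x R)) powr (1 / p))"
      using uD(5)[OF R, of x] unfolding m_def .
    also have "\<dots> \<le> K * (R * (measure N (ball x (2 * \<sigma> * R)) / measure M (ball x R)) powr (1 / p))"
    proof (intro mult_left_mono powr_mono2 divide_right_mono)
      show "measure N (ball x (\<sigma> * R)) \<le> measure N (ball x (2 * \<sigma> * R))"
        using WN R \<sigma> unfolding W_def by (intro N.finite_measure_mono subset_ball) auto
    qed (use K R p in auto)
    also have "\<dots> \<le> K * t" using Rt K by (intro mult_left_mono) auto
    finally show ?thesis unfolding T_def by simp
  qed
  have level: "measure M (L j) \<le> weak_const * (8 * R / (2 ^ j * T)) powr pstar * Aj j powr (pstar / p) * measure M B"
    for j
  proof -
    define a where "a = m + 2 ^ j * T / 2"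
    define b where "b = m + 2 ^ j * T"
    define v where "v y = truncation a b (u y)" for y
    have ab: "a < b" unfolding a_def b_def using T by simp
    have vP: "poincare_pair v (density N (indicator (S j)))"
      using tr[OF ab] unfolding v_def S_def a_def b_def .
    have T1: "T \<le> 2 ^ j * T" using T by simp
    have "\<bar>ball_average M v x R - a\<bar> \<le> 1 * ball_average M (\<lambda>z. \<bar>v z - a\<bar>) x R"
      by (rule ball_average_compare[OF poincare_pairD(1)[OF vP] R]) auto
    also have "\<dots> \<le> ball_average M (\<lambda>y. \<bar>u y - m\<bar>) x R"
      unfolding mult_1
    proof (rule ball_average_mono)
      show "\<bar>v y - a\<bar> \<le> \<bar>u y - m\<bar>" for y
        using truncation_dev[of "2 ^ j * T" m "u y"] T unfolding v_def a_def b_def by simp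
    qed (use locally_integrable_dev(2) poincare_pairD(1)[OF vP] uD(1) in auto)
    also note osc
    finally have dev: "\<bar>ball_average M v x R - a\<bar> \<le> T / 4" .
    have "L j \<subseteq> {y\<in>B. 2 ^ j * T / 8 < \<bar>v y - ball_average M v x R\<bar>}"
    proof
      fix y assume y: "y \<in> L j"
      then have "v y = b" using ab unfolding L_def v_def truncation_def b_def by auto
      moreover have "b - a = 2 ^ j * T / 2" unfolding a_def b_def by simp
      \<comment> \<open>On \<open>L j\<close> the truncation equals \<open>b\<close>, at distance
        \<open>2 ^ j * T / 2\<close> from \<open>a\<close>; the average is within
        \<open>T / 4 \<le> 2 ^ j * T / 4\<close> of \<open>a\<close>, which leaves more than
        \<open>2 ^ j * T / 8\<close>.\<close>
      ultimately have "2 ^ j * T / 8 < \<bar>v y - ball_average M v x R\<bar>" using dev T1 T by linarith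
      then show "y \<in> {y\<in>B. 2 ^ j * T / 8 < \<bar>v y - ball_average M v x R\<bar>}" using y unfolding L_def by auto
    qed
    then have "measure M (L j) \<le> measure M {y\<in>ball x R. 2 ^ j * T / 8 < \<bar>v y - ball_average M v x R\<bar>}"
      unfolding B_def
    proof (intro measure_mono_fmeasurable)
      show "{y\<in>ball x R. 2 ^ j * T / 8 < \<bar>v y - ball_average M v x R\<bar>} \<in> fmeasurable M"
        by (intro fmeasurableI2[OF ball_fmeasurable[of x R]]
            level_set_measurable[OF poincare_pairD(2)[OF vP]]) auto
    qed auto
    also have "\<dots> \<le> weak_const * (R / (2 ^ j * T / 8)) powr pstar * Aj j powr (pstar / p) * measure M (ball x R)"
    proof (rule weak_type[OF vP R])
      show "measure (density N (indicator (S j))) (ball x (2 * \<sigma> * R)) \<le> Aj j * measure M (ball x R)"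
        using finite_measure_density_indicator(2)[OF uD(3) SN WN] mB
        unfolding Aj_def W_def B_def by simp
    qed (use T A0 in auto)
    finally show ?thesis unfolding B_def by (simp add: mult.commute)
  qed
  have sumA: "(\<Sum>j<n. Aj j) \<le> A" for n
  proof -
    have disj: "disjoint_family_on (\<lambda>j. S j \<inter> W) {..<n}"
    proof -
      have "S i \<inter> S j = {}" if "i < j" for i j
      proof -
        have "(2::real) ^ Suc i * T \<le> 2 ^ j * T"
          using that T by (intro mult_right_mono power_increasing) auto
        then show ?thesis unfolding S_def by auto
      qed
      then have "S i \<inter> S j = {}" if "i \<noteq> j" for i j
        using that by (metis inf_commute nat_neq_iff)
      then show ?thesis unfolding disjoint_family_on_def by blast
    qed
    have "(\<Sum>j<n. measure N (S j \<inter> W)) = measure N (\<Union>j<n. S j \<inter> W)"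
      using SN WN disj by (intro N.finite_measure_finite_Union[symmetric]) auto
    also have "\<dots> \<le> measure N W" using WN by (intro N.finite_measure_mono) auto
    finally show ?thesis
      unfolding A_def Aj_def sum_divide_distrib[symmetric] using mB by (intro divide_right_mono) auto
  qed
  have AjA: "Aj j \<le> A" for j
  proof -
    have "Aj j \<le> (\<Sum>i<Suc j. Aj i)" using A0 by (simp add: sum_nonneg)
    with sumA[of "Suc j"] show ?thesis by linarith
  qed
  define \<theta> where "\<theta> = pstar / p"
  have \<theta>: "1 \<le> \<theta>" unfolding \<theta>_def by (rule pstar(4))
  \<comment> \<open>Since \<open>\<theta> \<ge> 1\<close>, a sum of powers is at most the power of
    the sum. This lets the separate weak type estimates add up without loss.\<close>
  have powA: "Aj j powr \<theta> \<le> Aj j * A powr (\<theta> - 1)" for j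
  proof (cases "Aj j = 0")
    case False
    then have "0 < Aj j" using A0(2)[of j] by simp
    then have "Aj j powr \<theta> = Aj j * Aj j powr (\<theta> - 1)" by (simp add: powr_diff)
    also have "\<dots> \<le> Aj j * A powr (\<theta> - 1)"
      using A0 AjA \<theta> by (intro mult_left_mono powr_mono2) auto
    finally show ?thesis .
  qed simp
  have sumpow: "R powr pstar * (\<Sum>j<n. Aj j powr \<theta>) \<le> t powr pstar" for n
  proof -
    have "(\<Sum>j<n. Aj j powr \<theta>) \<le> (\<Sum>j<n. Aj j * A powr (\<theta> - 1))" by (intro sum_mono powA)
    also have "\<dots> = (\<Sum>j<n. Aj j) * A powr (\<theta> - 1)" by (simp add: sum_distrib_right)
    also have "\<dots> \<le> A * A powr (\<theta> - 1)" using sumA by (intro mult_right_mono) auto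
    also have "\<dots> = A powr \<theta>" using A0 by (cases "A = 0") (auto simp: powr_diff)
    finally have "R powr pstar * (\<Sum>j<n. Aj j powr \<theta>) \<le> R powr pstar * A powr \<theta>"
      by (intro mult_left_mono) auto
    also have "\<dots> = (R * A powr (1 / p)) powr pstar"
      using R A0 unfolding \<theta>_def by (simp add: powr_mult powr_powr)
    also have "\<dots> \<le> t powr pstar"
      using Rt pstar(1) R unfolding A_def W_def B_def by (intro powr_mono2) auto
    finally show ?thesis .
  qed
  \<comment> \<open>Values up to \<open>T\<close> cost at most \<open>T powr pstar\<close>. A larger
    value lies in a dyadic interval above \<open>2 ^ j * T\<close>, and the single term
    \<open>j\<close> of the series dominates it.\<close>
  have pointwise: "ennreal ((max 0 (u y - m)) powr pstar) * indicator B y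
    \<le> ennreal (T powr pstar) * indicator B y + (\<Sum>j. ennreal ((2 ^ Suc j * T) powr pstar) * indicator (L j) y)"
    for y
  proof (cases "y \<in> B \<and> T < u y - m")
    case True
    obtain j where j: "2 ^ j * T < u y - m" "u y - m \<le> 2 ^ Suc j * T"
      using Bex_dyadic_level[OF T] True by blast
    have "ennreal ((max 0 (u y - m)) powr pstar) * indicator B y
      \<le> ennreal ((2 ^ Suc j * T) powr pstar) * indicator (L j) y"
      using True j T pstar(1) unfolding L_def by (auto intro!: ennreal_leI powr_mono2)
    also have "\<dots> \<le> (\<Sum>j. ennreal ((2 ^ Suc j * T) powr pstar) * indicator (L j) y)"
    proof -
      define f where "f i = ennreal ((2 ^ Suc i * T) powr pstar) * indicator (L i) y" for i
      have "f j \<le> suminf f" using sum_le_suminf[of f "{j}"] by (simp add: summableI)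
      then show ?thesis unfolding f_def .
    qed
    finally show ?thesis by (simp add: add_increasing)
  next
    case False
    then have "ennreal ((max 0 (u y - m)) powr pstar) * indicator B y \<le> ennreal (T powr pstar) * indicator B y"
      using T pstar(1) by (auto simp: indicator_def intro!: ennreal_leI powr_mono2)
    then show ?thesis by (simp add: add_increasing2)
  qed
  have "(\<integral>\<^sup>+y\<in>B. ennreal ((max 0 (u y - m)) powr pstar) \<partial>M)
    \<le> (\<integral>\<^sup>+y. ennreal (T powr pstar) * indicator B y + (\<Sum>j. ennreal ((2 ^ Suc j * T) powr pstar) * indicator (L j) y) \<partial>M)"
    by (intro nn_integral_mono pointwise)
  also have "\<dots> = ennreal (T powr pstar) * emeasure M B
      + (\<Sum>j. ennreal ((2 ^ Suc j * T) powr pstar) * emeasure M (L j))"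
    by (subst nn_integral_add) (auto simp: nn_integral_suminf nn_integral_cmult)
  also have "(\<Sum>j. ennreal ((2 ^ Suc j * T) powr pstar) * emeasure M (L j))
    \<le> ennreal (weak_const * 16 powr pstar * t powr pstar * measure M B)"
  proof (rule suminf_le_const)
    fix n
    have "ennreal ((2 ^ Suc j * T) powr pstar) * emeasure M (L j)
      \<le> ennreal (weak_const * 16 powr pstar * measure M B * (R powr pstar * Aj j powr \<theta>))" for j
    proof -
      have fin: "L j \<in> fmeasurable M"
        by (rule fmeasurableI2[OF ball_fmeasurable[of x R] _ LM]) (auto simp: L_def B_def)
      have "(2 ^ Suc j * T) powr pstar * measure M (L j)
        \<le> (2 ^ Suc j * T) powr pstar * (weak_const * (8 * R / (2 ^ j * T)) powr pstar * Aj j powr \<theta> * measure M B)"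
        using level[of j] unfolding \<theta>_def by (intro mult_left_mono) auto
      also have "\<dots> = weak_const * ((2 ^ Suc j * T) powr pstar * (8 * R / (2 ^ j * T)) powr pstar) * Aj j powr \<theta> * measure M B"
        by (simp add: mult_ac)
      \<comment> \<open>The level cancels, so the bound depends on \<open>j\<close> only through
        \<open>Aj j\<close>; the sum over all levels is then finite.\<close>
      also have "(2 ^ Suc j * T) powr pstar * (8 * R / (2 ^ j * T)) powr pstar = (16 * R) powr pstar"
        using T R by (subst powr_mult[symmetric]) auto
      also have "(16 * R) powr pstar = 16 powr pstar * R powr pstar" using R by (simp add: powr_mult)
      finally have "(2 ^ Suc j * T) powr pstar * measure M (L j)
        \<le> weak_const * 16 powr pstar * measure M B * (R powr pstar * Aj j powr \<theta>)"
        by (simp add: mult_ac)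
      then show ?thesis
        using fin by (simp add: emeasure_eq_measure2 ennreal_mult'[symmetric] ennreal_leI)
    qed
    then have "(\<Sum>j<n. ennreal ((2 ^ Suc j * T) powr pstar) * emeasure M (L j))
      \<le> (\<Sum>j<n. ennreal (weak_const * 16 powr pstar * measure M B * (R powr pstar * Aj j powr \<theta>)))"
      by (intro sum_mono)
    also have "\<dots> = ennreal (\<Sum>j<n. weak_const * 16 powr pstar * measure M B * (R powr pstar * Aj j powr \<theta>))"
      using weak_const_pos by (intro sum_ennreal) auto
    also have "(\<Sum>j<n. weak_const * 16 powr pstar * measure M B * (R powr pstar * Aj j powr \<theta>))
      = weak_const * 16 powr pstar * measure M B * (R powr pstar * (\<Sum>j<n. Aj j powr \<theta>))"
      by (simp only: sum_distrib_left)
    also have "ennreal \<dots> \<le> ennreal (weak_const * 16 powr pstar * measure M B * t powr pstar)"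
      using weak_const_pos sumpow[of n] by (intro ennreal_leI mult_left_mono) auto
    finally show "(\<Sum>j<n. ennreal ((2 ^ Suc j * T) powr pstar) * emeasure M (L j))
      \<le> ennreal (weak_const * 16 powr pstar * t powr pstar * measure M B)"
      by (simp add: mult_ac)
  qed (rule summableI)
  also have "ennreal (T powr pstar) * emeasure M B = ennreal ((4 * K) powr pstar * t powr pstar * measure M B)"
    unfolding T_def B_def using K t by (simp add: emeasure_ball powr_mult ennreal_mult'[symmetric])
  also have "ennreal ((4 * K) powr pstar * t powr pstar * measure M B)
    + ennreal (weak_const * 16 powr pstar * t powr pstar * measure M B)
    = ennreal (strong_const * t powr pstar * measure M B)"
    unfolding strong_const_def using weak_const_pos
    by (subst ennreal_plus[symmetric]) (auto simp: algebra_simps)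
  finally show ?thesis unfolding B_def m_def by simp
qed

lemma strong_type:
  assumes u: "truncation_pair u N" and R: "0 < R" and t: "0 < t"
    and Rt: "R * (measure N (ball x (2 * \<sigma> * R)) / measure M (ball x R)) powr (1 / p) \<le> t"
  shows "(\<integral>\<^sup>+y\<in>ball x R. ennreal (\<bar>u y - ball_average M u x R\<bar> powr pstar) \<partial>M)
    \<le> ennreal (2 * strong_const * t powr pstar * measure M (ball x R))"
proof -
  define m where "m = ball_average M u x R"
  have um [measurable]: "u \<in> borel_measurable M"
    using u poincare_pairD(2) unfolding truncation_pair_def by blast
  have "(\<integral>\<^sup>+y\<in>ball x R. ennreal (\<bar>u y - m\<bar> powr pstar) \<partial>M) \<le>
    (\<integral>\<^sup>+y. ennreal ((max 0 (u y - m)) powr pstar) * indicator (ball x R) y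
      + ennreal ((max 0 (- u y - (- m))) powr pstar) * indicator (ball x R) y \<partial>M)"
    by (intro nn_integral_mono) (auto simp: indicator_def max_def abs_if)
  also have "\<dots> = (\<integral>\<^sup>+y\<in>ball x R. ennreal ((max 0 (u y - m)) powr pstar) \<partial>M)
    + (\<integral>\<^sup>+y\<in>ball x R. ennreal ((max 0 (- u y - (- m))) powr pstar) \<partial>M)"
    by (intro nn_integral_add) auto
  also have "\<dots> \<le> ennreal (strong_const * t powr pstar * measure M (ball x R))
    + ennreal (strong_const * t powr pstar * measure M (ball x R))"
    using strong_type_upper[OF u R t Rt]
      strong_type_upper[OF truncation_pair_uminus[OF u] R t Rt]
    unfolding ball_average_uminus m_def by (intro add_mono) auto
  also have "\<dots> = ennreal (2 * strong_const * t powr pstar * measure M (ball x R))"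
    using strong_const_pos by (subst ennreal_plus[symmetric]) auto
  finally show ?thesis unfolding m_def .
qed

text \<open>The growth condition turns \<open>r * (N / M) powr (1 / p)\<close> into a multiple of
  \<open>r powr (1 - q / p)\<close>. This one scale controls the distance of the averages from their
  limit and, by \<open>strong_type\<close>, the mean oscillation with exponent
  \<open>pstar\<close>.\<close>

lemma oscillation_decay_at_point:
  assumes u: "truncation_pair u N" and q: "0 < q" "q < p" and h: "0 < h" "h \<le> pstar"
    and m: "0 \<le> m"
    and Nm: "\<And>r. 0 < r \<Longrightarrow> r \<le> 2 \<Longrightarrow> r powr q * measure N (ball x (\<sigma> * r)) \<le> m * measure M (ball x r)"
  obtains l C where "0 \<le> C" "(ball_average M u x \<longlongrightarrow> l) (at_right 0)"
    "\<And>R. 0 < R \<Longrightarrow> R \<le> 1 \<Longrightarrow> (\<integral>\<^sup>+y\<in>ball x R. ennreal (\<bar>u y - l\<bar> powr h) \<partial>M)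
      \<le> ennreal (C * R powr ((1 - q / p) * h) * measure M (ball x R))"
proof -
  define \<eta> where "\<eta> = 1 - q / p"
  have \<eta>: "0 < \<eta>" unfolding \<eta>_def using q by simp
  \<comment> \<open>\<open>D\<close> accounts for replacing radius \<open>2 * r\<close> by
    \<open>r\<close>; the summand 1 keeps \<open>a\<close> positive when \<open>m = 0\<close>, since
    \<open>strong_type\<close> wants a positive scale \<open>t\<close>.\<close>
  define a where "a = (m * D + 1) powr (1 / p)"
  have mD: "0 < m * D + 1" using m D by (simp add: add_nonneg_pos)
  have a: "0 < a" unfolding a_def using mD by simp
  have uP: "poincare_pair u N" using u unfolding truncation_pair_def by blast
  note uD = poincare_pairD[OF uP]
  have um [measurable]: "u \<in> borel_measurable M" by (rule uD(2))
  interpret N: finite_measure N by (rule uD(3))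
  have scale: "r * (X / measure M (ball x r)) powr (1 / p) \<le> a * r powr \<eta>"
    if "0 < r" "r powr q * X \<le> m * D * measure M (ball x r)" "0 \<le> X" for r X
  proof -
    have "X / measure M (ball x r) \<le> (m * D + 1) / r powr q"
    proof -
      have "r powr q * X \<le> (m * D + 1) * measure M (ball x r)"
        using that(2) measure_ball_pos[OF that(1), of x] by (simp add: distrib_right)
      then show ?thesis using that measure_ball_pos[OF that(1), of x] by (simp add: divide_simps mult_ac)
    qed
    then have "r * (X / measure M (ball x r)) powr (1 / p) \<le> r * ((m * D + 1) / r powr q) powr (1 / p)"
      using that p by (intro mult_left_mono powr_mono2) auto
    also have "\<dots> = a * r powr \<eta>"
      unfolding a_def \<eta>_def using that mD by (simp add: powr_divide powr_powr powr_diff)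
    finally show ?thesis .
  qed
  have small: "r * (measure N (ball x (\<sigma> * r)) / measure M (ball x r)) powr (1 / p) \<le> a * r powr \<eta>"
    if r: "0 < r" "r \<le> 1" for r
  proof (rule scale[OF r(1)])
    have "m * measure M (ball x r) \<le> m * D * measure M (ball x r)"
      using m D by (intro mult_right_mono) (auto simp: mult_le_cancel_left1)
    then show "r powr q * measure N (ball x (\<sigma> * r)) \<le> m * D * measure M (ball x r)"
      using Nm[of r] r by linarith
  qed simp
  \<comment> \<open>\<open>strong_type\<close> evaluates \<open>N\<close> on
    \<open>ball x (2 * \<sigma> * r)\<close>, which is the growth condition at radius
    \<open>2 * r\<close>; hence its range up to 2.\<close>
  have double: "r * (measure N (ball x (2 * \<sigma> * r)) / measure M (ball x r)) powr (1 / p) \<le> a * r powr \<eta>"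
    if r: "0 < r" "r \<le> 1" for r
  proof (rule scale[OF r(1)])
    have "r powr q * measure N (ball x (2 * \<sigma> * r)) \<le> (2 * r) powr q * measure N (ball x (\<sigma> * (2 * r)))"
      using r q by (intro mult_mono powr_mono2) (auto simp: mult_ac)
    also have "\<dots> \<le> m * measure M (ball x (2 * r))" using r by (intro Nm) auto
    also have "\<dots> \<le> m * (D * measure M (ball x r))" using r m doubling_D by (intro mult_left_mono) auto
    finally show "r powr q * measure N (ball x (2 * \<sigma> * r)) \<le> m * D * measure M (ball x r)" by simp
  qed simp
  obtain l where l: "(ball_average M u x \<longlongrightarrow> l) (at_right 0)"
    "\<And>r. 0 < r \<Longrightarrow> r \<le> 1 \<Longrightarrow> \<bar>ball_average M u x r - l\<bar> \<le> tele \<eta> * (a * r powr \<eta>)"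
    using averages_converge[OF uP \<eta>, of a 1 x] a small by auto
  define k where "k = tele \<eta> + 1"
  have k: "0 < k" "tele \<eta> \<le> k" unfolding k_def using tele_pos[OF \<eta>] by auto
  define C0 where "C0 = (2 * k) powr h + 2 powr h * k powr (h - pstar) * (2 * strong_const)"
  have C0: "0 \<le> C0" unfolding C0_def using strong_const_pos by auto
  have "(\<integral>\<^sup>+y\<in>ball x R. ennreal (\<bar>u y - l\<bar> powr h) \<partial>M)
      \<le> ennreal (C0 * a powr h * R powr ((1 - q / p) * h) * measure M (ball x R))"
    if R: "0 < R" "R \<le> 1" for R
  proof -
    define t where "t = a * R powr \<eta>"
    have t: "0 < t" unfolding t_def using a R by simp
    define w where "w = ball_average M u x R"
    have wl: "\<bar>w - l\<bar> \<le> k * t"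
      using l(2)[OF R] mult_right_mono[OF k(2), of t] t unfolding w_def t_def by linarith
    have kt: "0 < k * t" using k t by simp
    \<comment> \<open>Lowers the exponent from \<open>pstar\<close> to \<open>h\<close> pointwise.
      If \<open>\<bar>u y - w\<bar> \<le> k * t\<close>, then
      \<open>\<bar>u y - l\<bar> \<le> 2 * (k * t)\<close>. Otherwise
      \<open>\<bar>u y - l\<bar> \<le> 2 * \<bar>u y - w\<bar>\<close>, and since
      \<open>h - pstar \<le> 0\<close> the surplus power is bounded by its value at
      \<open>k * t\<close>.\<close>
    have pw: "ennreal (\<bar>u y - l\<bar> powr h) * indicator (ball x R) y
      \<le> ennreal ((2 * (k * t)) powr h) * indicator (ball x R) y +
        ennreal (2 powr h * (k * t) powr (h - pstar)) * (ennreal (\<bar>u y - w\<bar> powr pstar) * indicator (ball x R) y)"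
      for y
    proof (cases "\<bar>u y - w\<bar> \<le> k * t")
      case True
      then have "\<bar>u y - l\<bar> powr h \<le> (2 * (k * t)) powr h"
        using wl h by (intro powr_mono2) auto
      then have "ennreal (\<bar>u y - l\<bar> powr h) * indicator (ball x R) y \<le> ennreal ((2 * (k * t)) powr h) * indicator (ball x R) y"
        by (intro mult_right_mono ennreal_leI) auto
      then show ?thesis by (simp add: add_increasing2)
    next
      case False
      define z where "z = \<bar>u y - w\<bar>"
      have z: "k * t < z" "0 < z" using False kt unfolding z_def by auto
      have "\<bar>u y - l\<bar> \<le> z + \<bar>w - l\<bar>" unfolding z_def by linarith
      then have "\<bar>u y - l\<bar> \<le> 2 * z" using wl z(1) by linarith
      then have "\<bar>u y - l\<bar> powr h \<le> (2 * z) powr h"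
        using h by (intro powr_mono2) auto
      also have "\<dots> = 2 powr h * (z powr (h - pstar) * z powr pstar)"
        using z by (simp add: powr_mult powr_add[symmetric])
      also have "\<dots> \<le> 2 powr h * ((k * t) powr (h - pstar) * z powr pstar)"
        using z kt h by (intro mult_left_mono mult_right_mono powr_mono2') auto
      finally have "ennreal (\<bar>u y - l\<bar> powr h)
        \<le> ennreal (2 powr h * (k * t) powr (h - pstar) * z powr pstar)"
        by (intro ennreal_leI) (simp add: mult_ac)
      also have "\<dots> = ennreal (2 powr h * (k * t) powr (h - pstar)) * ennreal (z powr pstar)"
        by (rule ennreal_mult') simp
      finally have "ennreal (\<bar>u y - l\<bar> powr h) * indicator (ball x R) y
        \<le> ennreal (2 powr h * (k * t) powr (h - pstar)) * (ennreal (\<bar>u y - w\<bar> powr pstar) * indicator (ball x R) y)"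
        unfolding z_def by (auto simp: indicator_def)
      then show ?thesis by (simp add: add_increasing)
    qed
    have "(\<integral>\<^sup>+y\<in>ball x R. ennreal (\<bar>u y - l\<bar> powr h) \<partial>M)
      \<le> (\<integral>\<^sup>+y. ennreal ((2 * (k * t)) powr h) * indicator (ball x R) y +
        ennreal (2 powr h * (k * t) powr (h - pstar)) * (ennreal (\<bar>u y - w\<bar> powr pstar) * indicator (ball x R) y) \<partial>M)"
      by (intro nn_integral_mono pw)
    also have "\<dots> = ennreal ((2 * (k * t)) powr h) * emeasure M (ball x R) +
        ennreal (2 powr h * (k * t) powr (h - pstar)) * (\<integral>\<^sup>+y\<in>ball x R. ennreal (\<bar>u y - w\<bar> powr pstar) \<partial>M)"
      by (subst nn_integral_add) (auto simp: nn_integral_cmult)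
    also have "\<dots> \<le> ennreal ((2 * (k * t)) powr h) * ennreal (measure M (ball x R)) +
        ennreal (2 powr h * (k * t) powr (h - pstar)) *
          ennreal (2 * strong_const * t powr pstar * measure M (ball x R))"
      using strong_type[OF u R(1) t, of x] double[OF R] unfolding w_def t_def
      by (intro add_mono mult_left_mono) (auto simp: emeasure_ball)
    also have "\<dots> = ennreal ((2 * (k * t)) powr h * measure M (ball x R) +
        2 powr h * (k * t) powr (h - pstar) * (2 * strong_const * t powr pstar * measure M (ball x R)))"
      using strong_const_pos by (simp add: ennreal_mult'[symmetric])
    also have "(2 * (k * t)) powr h * measure M (ball x R) +
        2 powr h * (k * t) powr (h - pstar) * (2 * strong_const * t powr pstar * measure M (ball x R))
      = C0 * t powr h * measure M (ball x R)"
    proof -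
      have e1: "(2 * (k * t)) powr h = (2 * k) powr h * t powr h" using k t by (simp add: powr_mult)
      have eq: "(k * t) powr (h - pstar) * t powr pstar = k powr (h - pstar) * t powr h"
        using k t by (simp add: powr_mult powr_add[symmetric])
      have e2: "2 powr h * (k * t) powr (h - pstar) * (2 * strong_const * t powr pstar * measure M (ball x R))
        = 2 powr h * (2 * strong_const) * measure M (ball x R) * ((k * t) powr (h - pstar) * t powr pstar)"
        by (simp only: mult_ac)
      show ?thesis unfolding e1 e2[unfolded eq] C0_def by (simp only: distrib_right distrib_left mult_ac)
    qed
    also have "t powr h = a powr h * R powr ((1 - q / p) * h)"
      unfolding t_def \<eta>_def using a R by (simp add: powr_mult powr_powr)
    finally show ?thesis by (simp add: mult_ac)
  qed
  then show thesis using that[of "C0 * a powr h" l] C0 l(1) by simp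
qed

end

section \<open>Truncation of functions of one variable whose increments are bounded by
  integrals\<close>

lemma truncation_mirror: "a \<le> b \<Longrightarrow> truncation (- b) (- a) (- t) = - truncation a b t"
  by (auto simp: truncation_def max_def min_def)

lemma measure_eq_nn_integral_density:
  assumes [measurable]: "G \<in> borel_measurable N" "A \<in> sets N"
  shows "emeasure (density N G) A = (\<integral>\<^sup>+t\<in>A. G t \<partial>N)"
  by (subst emeasure_density) auto

text \<open>The finite measure with density \<open>G\<close> on \<open>{0..l}\<close> has no atoms,
  so its distribution function is continuous, and it dominates the increments of \<open>f\<close>.
  Applied to a curve: a function is continuous along every curve on which its upper gradient is
  integrable.\<close>

lemma continuous_on_if_dominated_by_integral:
  fixes f :: "real \<Rightarrow> real" and G :: "real \<Rightarrow> ennreal"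
  assumes Gm: "(\<lambda>t. G t * indicator {0..l} t) \<in> borel_measurable borel"
    and fin: "(\<integral>\<^sup>+t\<in>{0..l}. G t \<partial>lborel) < \<infinity>"
    and le: "\<And>s t. 0 \<le> s \<Longrightarrow> s \<le> t \<Longrightarrow> t \<le> l \<Longrightarrow> ennreal \<bar>f s - f t\<bar> \<le> (\<integral>\<^sup>+\<tau>\<in>{s..t}. G \<tau> \<partial>lborel)"
  shows "continuous_on {0..l} f"
proof -
  define N where "N = density lborel (\<lambda>t. G t * indicator {0..l} t)"
  have Gm' [measurable]: "(\<lambda>t. G t * indicator {0..l} t) \<in> borel_measurable lborel" using Gm by simp
  have em: "emeasure N A = (\<integral>\<^sup>+t\<in>A. G t * indicator {0..l} t \<partial>lborel)" if "A \<in> sets borel" for A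
    unfolding N_def using that by (intro measure_eq_nn_integral_density) auto
  interpret N: finite_borel_measure N
  proof (intro finite_borel_measure.intro finite_borel_measure_axioms.intro finite_measureI)
    show "emeasure N (space N) \<noteq> \<infinity>"
      using em[of UNIV] fin unfolding N_def by simp
  qed (simp add: N_def)
  have null: "emeasure N {t} = 0" for t
  proof -
    have "(\<integral>\<^sup>+\<tau>\<in>{t}. G \<tau> * indicator {0..l} \<tau> \<partial>lborel) = (\<integral>\<^sup>+\<tau>. 0 \<partial>(lborel :: real measure))"
    proof (rule nn_integral_cong_AE)
      show "AE \<tau> in lborel. G \<tau> * indicator {0..l} \<tau> * indicator {t} \<tau> = 0"
        using AE_lborel_singleton[of t] by eventually_elim (auto simp: indicator_def)
    qed
    then show ?thesis using em[of "{t}"] by simp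
  qed
  have cont: "isCont (cdf N) t" for t
    using null[of t] unfolding N.isCont_cdf by (simp add: measure_def)
  have bound: "\<bar>f s - f t\<bar> \<le> cdf N t - cdf N s" if "0 \<le> s" "s < t" "t \<le> l" for s t
  proof -
    have "ennreal \<bar>f s - f t\<bar> \<le> (\<integral>\<^sup>+\<tau>\<in>{s..t}. G \<tau> \<partial>lborel)" using le that by simp
    also have "\<dots> = (\<integral>\<^sup>+\<tau>\<in>{s..t}. G \<tau> * indicator {0..l} \<tau> \<partial>lborel)"
      using that by (intro nn_integral_cong) (auto simp: indicator_def)
    also have "\<dots> = emeasure N {s..t}" by (simp add: em)
    also have "\<dots> \<le> emeasure N ({s} \<union> {s<..t})"
      by (intro emeasure_mono) (auto simp: N_def)
    also have "\<dots> \<le> emeasure N {s} + emeasure N {s<..t}"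
      by (intro emeasure_subadditive) (auto simp: N_def)
    also have "\<dots> = ennreal (cdf N t - cdf N s)"
      using null[of s] by (simp add: N.emeasure_eq_measure N.cdf_diff_eq[OF that(2)])
    finally show ?thesis using N.cdf_nondecreasing[of s t] that by simp
  qed
  show ?thesis
    unfolding continuous_on_iff
  proof (intro ballI allI impI)
    fix x e :: real assume x: "x \<in> {0..l}" and e: "0 < e"
    obtain d where d: "0 < d" "\<And>y. dist y x < d \<Longrightarrow> dist (cdf N y) (cdf N x) < e"
      using cont[of x] e unfolding continuous_at_eps_delta by blast
    show "\<exists>d>0. \<forall>x'\<in>{0..l}. dist x' x < d \<longrightarrow> dist (f x') (f x) < e"
    proof (intro exI conjI ballI impI)
      fix y assume y: "y \<in> {0..l}" "dist y x < d"
      have "dist (f y) (f x) \<le> dist (cdf N y) (cdf N x)"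
        using bound[of y x] bound[of x y] x y unfolding dist_real_def
        by (cases y x rule: linorder_cases) auto
      then show "dist (f y) (f x) < e" using d(2)[OF y(2)] by simp
    qed (rule d)
  qed
qed

text \<open>Between the last time with value \<open>c\<close> and the first time with value \<open>d\<close> the path stays in
  \<open>{c<..<d}\<close>.\<close>

lemma truncated_increase:
  fixes f :: "real \<Rightarrow> real" and G :: "real \<Rightarrow> ennreal"
  assumes cont: "continuous_on {0..l} f" and l: "0 \<le> l"
    and le: "\<And>s t. 0 \<le> s \<Longrightarrow> s \<le> t \<Longrightarrow> t \<le> l \<Longrightarrow> ennreal \<bar>f s - f t\<bar> \<le> (\<integral>\<^sup>+\<tau>\<in>{s..t}. G \<tau> \<partial>lborel)"
    and c: "f 0 \<le> c" "c < d" "d \<le> f l"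
  shows "ennreal (d - c) \<le> (\<integral>\<^sup>+\<tau>\<in>{0..l}. G \<tau> * indicator {\<tau>. c < f \<tau> \<and> f \<tau> < d} \<tau> \<partial>lborel)"
proof -
  \<comment> \<open>Times with value at least \<open>d\<close>, whose minimum exists by continuity;
    below, the last time before it with value at most \<open>c\<close> is found in the same
    way.\<close>
  define X where "X = {0..l} \<inter> f -` {d..}"
  have "compact ({0..l} \<inter> X)"
    using continuous_closed_preimage[OF cont closed_atLeastAtMost closed_atLeast[of d]]
    unfolding X_def by (intro compact_Int_closed compact_Icc)
  moreover have "{0..l} \<inter> X = X" unfolding X_def by auto
  moreover have "X \<noteq> {}" using c l unfolding X_def by auto
  ultimately obtain t2 where X2: "t2 \<in> X" "\<And>t. t \<in> X \<Longrightarrow> t2 \<le> t"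
    using compact_attains_inf[of X] by auto
  have t2: "0 \<le> t2" "t2 \<le> l" "d \<le> f t2" "\<And>t. 0 \<le> t \<Longrightarrow> t < t2 \<Longrightarrow> f t < d"
  proof -
    show b: "0 \<le> t2" "t2 \<le> l" "d \<le> f t2" using X2(1) unfolding X_def by auto
    show "f t < d" if "0 \<le> t" "t < t2" for t
      using X2(2)[of t] that b unfolding X_def by (cases "f t < d") auto
  qed
  have cont2: "continuous_on {0..t2} f" by (rule continuous_on_subset[OF cont]) (use t2 in auto)
  define Y where "Y = {0..t2} \<inter> f -` {..c}"
  have "compact ({0..t2} \<inter> Y)"
    using continuous_closed_preimage[OF cont2 closed_atLeastAtMost closed_atMost[of c]]
    unfolding Y_def by (intro compact_Int_closed compact_Icc)
  moreover have "{0..t2} \<inter> Y = Y" unfolding Y_def by auto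
  moreover have "Y \<noteq> {}" using c t2 unfolding Y_def by auto
  ultimately obtain t1 where Y1: "t1 \<in> Y" "\<And>t. t \<in> Y \<Longrightarrow> t \<le> t1"
    using compact_attains_sup[of Y] by auto
  have t1: "0 \<le> t1" "t1 \<le> t2" "f t1 \<le> c" "\<And>t. t1 < t \<Longrightarrow> t \<le> t2 \<Longrightarrow> c < f t"
  proof -
    show b: "0 \<le> t1" "t1 \<le> t2" "f t1 \<le> c" using Y1(1) unfolding Y_def by auto
    show "c < f t" if "t1 < t" "t \<le> t2" for t
      using Y1(2)[of t] that b unfolding Y_def by (cases "c < f t") auto
  qed
  have inside: "c < f t \<and> f t < d" if "t \<in> {t1<..<t2}" for t
    using t1(1,4) t2(4) that by auto
  \<comment> \<open>At the two end times the strict inequalities may fail, but these times form a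
    null set.\<close>
  have ae: "AE \<tau> in lborel. \<tau> \<noteq> t1 \<and> \<tau> \<noteq> t2"
    using AE_lborel_singleton[of t1] AE_lborel_singleton[of t2] by eventually_elim simp
  have "ennreal (d - c) \<le> ennreal \<bar>f t1 - f t2\<bar>"
    using t1(3) t2(3) by (intro ennreal_leI) auto
  also have "\<dots> \<le> (\<integral>\<^sup>+\<tau>\<in>{t1..t2}. G \<tau> \<partial>lborel)" using t1 t2 by (intro le) auto
  also have "\<dots> \<le> (\<integral>\<^sup>+\<tau>\<in>{0..l}. G \<tau> * indicator {\<tau>. c < f \<tau> \<and> f \<tau> < d} \<tau> \<partial>lborel)"
  proof (rule nn_integral_mono_AE)
    show "AE \<tau> in lborel. G \<tau> * indicator {t1..t2} \<tau>
      \<le> G \<tau> * indicator {\<tau>. c < f \<tau> \<and> f \<tau> < d} \<tau> * indicator {0..l} \<tau>"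
      using ae
    proof eventually_elim
      case (elim \<tau>)
      then show ?case using inside[of \<tau>] t1(1) t2(2) by (auto simp: indicator_def)
    qed
  qed
  finally show ?thesis .
qed

lemma truncated_variation:
  fixes f :: "real \<Rightarrow> real" and G :: "real \<Rightarrow> ennreal"
  assumes Gm: "(\<lambda>t. G t * indicator {0..l} t) \<in> borel_measurable borel" and l: "0 \<le> l" and ab: "a < b"
    and fin: "(\<integral>\<^sup>+t\<in>{0..l}. G t \<partial>lborel) < \<infinity>"
    and le: "\<And>s t. 0 \<le> s \<Longrightarrow> s \<le> t \<Longrightarrow> t \<le> l \<Longrightarrow> ennreal \<bar>f s - f t\<bar> \<le> (\<integral>\<^sup>+\<tau>\<in>{s..t}. G \<tau> \<partial>lborel)"
  shows "ennreal \<bar>truncation a b (f 0) - truncation a b (f l)\<bar>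
    \<le> (\<integral>\<^sup>+\<tau>\<in>{0..l}. G \<tau> * indicator {\<tau>. a < f \<tau> \<and> f \<tau> < b} \<tau> \<partial>lborel)"
proof -
  have cont: "continuous_on {0..l} f"
    by (rule continuous_on_if_dominated_by_integral[OF Gm fin le])
  \<comment> \<open>Stated for any \<open>h\<close> with the increments of \<open>f\<close>, so that
    the decreasing case can be reduced to \<open>- f\<close> with mirrored levels.\<close>
  have up: "ennreal (truncation a' b' (h l) - truncation a' b' (h 0))
      \<le> (\<integral>\<^sup>+\<tau>\<in>{0..l}. G \<tau> * indicator {\<tau>. a' < h \<tau> \<and> h \<tau> < b'} \<tau> \<partial>lborel)"
    if h: "continuous_on {0..l} h" "truncation a' b' (h 0) < truncation a' b' (h l)"
      "\<And>s t. \<bar>h s - h t\<bar> = \<bar>f s - f t\<bar>" for h a' b'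
  proof -
    \<comment> \<open>The increase is measured between the truncated end values, since the path need
      not cross all of the interval from \<open>a'\<close> to \<open>b'\<close>.\<close>
    let ?c = "truncation a' b' (h 0)" and ?d = "truncation a' b' (h l)"
    have cd: "h 0 \<le> ?c" "?d \<le> h l" "a' \<le> ?c" "?d \<le> b'"
      using h(2) by (auto simp: truncation_def max_def min_def split: if_splits)
    have "ennreal (?d - ?c) \<le> (\<integral>\<^sup>+\<tau>\<in>{0..l}. G \<tau> * indicator {\<tau>. ?c < h \<tau> \<and> h \<tau> < ?d} \<tau> \<partial>lborel)"
      using le h cd by (intro truncated_increase[OF h(1) l]) auto
    also have "\<dots> \<le> (\<integral>\<^sup>+\<tau>\<in>{0..l}. G \<tau> * indicator {\<tau>. a' < h \<tau> \<and> h \<tau> < b'} \<tau> \<partial>lborel)"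
      using cd by (intro nn_integral_mono) (auto simp: indicator_def)
    finally show ?thesis .
  qed
  consider "truncation a b (f 0) = truncation a b (f l)" | "truncation a b (f 0) < truncation a b (f l)"
    | "truncation a b (f l) < truncation a b (f 0)" by linarith
  then show ?thesis
  proof cases
    case 2
    then show ?thesis using up[OF cont 2] by simp
  next
    case 3
    have "ennreal (truncation (-b) (-a) (- f l) - truncation (-b) (-a) (- f 0))
      \<le> (\<integral>\<^sup>+\<tau>\<in>{0..l}. G \<tau> * indicator {\<tau>. - b < - f \<tau> \<and> - f \<tau> < - a} \<tau> \<partial>lborel)"
      by (rule up) (use cont 3 ab in \<open>auto intro: continuous_intros simp: truncation_mirror\<close>)
    moreover have "{\<tau>. - b < - f \<tau> \<and> - f \<tau> < - a} = {\<tau>. a < f \<tau> \<and> f \<tau> < b}" by auto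
    ultimately show ?thesis using 3 ab by (simp add: truncation_mirror)
  qed simp
qed

section \<open>Curves\<close>

lemma arc_length_curve_dist_le:
  assumes "arc_length_curve l \<gamma>" "0 \<le> a" "a \<le> b" "b \<le> l"
  shows "dist (\<gamma> a) (\<gamma> b) \<le> b - a"
proof -
  let ?t = "\<lambda>i::nat. if i = 0 then a else b"
  have "ennreal (dist (\<gamma> a) (\<gamma> b)) \<le> curve_length \<gamma> a b"
    unfolding curve_length_def
    by (rule SUP_upper2[of "(1, ?t)"]) (use assms in auto)
  also have "\<dots> = ennreal (b - a)" using assms unfolding arc_length_curve_def by auto
  finally show ?thesis using assms by simp
qed

lemma curve_length_shift_le:
  "curve_length (\<lambda>\<tau>. \<gamma> (s + \<tau>)) a b \<le> curve_length \<gamma> (s + a) (s + b)"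
  unfolding curve_length_def
proof (rule SUP_least)
  fix nt assume "nt \<in> {(n::nat, t::nat \<Rightarrow> real). t 0 = a \<and> t n = b \<and> (\<forall>i<n. t i \<le> t (Suc i))}"
  then obtain n t where nt: "nt = (n, t)" "t 0 = a" "t n = b" "\<forall>i<n. t i \<le> t (Suc i)" by auto
  show "(case nt of (n, t) \<Rightarrow> \<Sum>i<n. ennreal (dist (\<gamma> (s + t i)) (\<gamma> (s + t (Suc i)))))
    \<le> (SUP (n, t) \<in> {(n::nat, t::nat \<Rightarrow> real). t 0 = s + a \<and> t n = s + b \<and> (\<forall>i<n. t i \<le> t (Suc i))}.
      \<Sum>i<n. ennreal (dist (\<gamma> (t i)) (\<gamma> (t (Suc i)))))"
    by (rule SUP_upper2[of "(n, \<lambda>i. s + t i)"]) (use nt in auto)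
qed

lemma curve_length_shift:
  "curve_length (\<lambda>\<tau>. \<gamma> (s + \<tau>)) a b = curve_length \<gamma> (s + a) (s + b)"
  using curve_length_shift_le[of \<gamma> s a b] curve_length_shift_le[of "\<lambda>\<tau>. \<gamma> (s + \<tau>)" "- s" "s + a" "s + b"]
  by simp

lemma arc_length_curve_subcurve:
  assumes "arc_length_curve l \<gamma>" "0 \<le> s" "s < t" "t \<le> l"
  shows "arc_length_curve (t - s) (\<lambda>\<tau>. \<gamma> (s + \<tau>))"
  unfolding arc_length_curve_def
proof (intro conjI allI impI)
  have "continuous_on {0..l} \<gamma>" using assms unfolding arc_length_curve_def by auto
  then show "continuous_on {0..t - s} (\<lambda>\<tau>. \<gamma> (s + \<tau>))"
    by (rule continuous_on_compose2) (use assms in \<open>auto intro!: continuous_intros\<close>)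
  show "curve_length (\<lambda>\<tau>. \<gamma> (s + \<tau>)) a b = ennreal (b - a)" if "0 \<le> a" "a \<le> b" "b \<le> t - s" for a b
    using assms that unfolding curve_length_shift arc_length_curve_def by auto
qed (use assms in auto)

text \<open>A curve is arbitrary outside its parameter interval, so only the product with an
  indicator is measurable.\<close>

lemma curve_integrand_measurable:
  fixes g :: "'a::metric_space \<Rightarrow> ennreal"
  assumes "arc_length_curve l \<gamma>" "0 \<le> s" "t \<le> l" "g \<in> borel_measurable borel"
  shows "(\<lambda>\<tau>. g (\<gamma> \<tau>) * indicator {s..t} \<tau>) \<in> borel_measurable borel"
proof -
  have "continuous_on {s..t} \<gamma>"
    using assms unfolding arc_length_curve_def by (auto intro: continuous_on_subset)
  then have "\<gamma> \<in> borel_measurable (restrict_space borel {s..t})"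
    by (rule borel_measurable_continuous_on_restrict)
  then have "(\<lambda>\<tau>. g (\<gamma> \<tau>)) \<in> borel_measurable (restrict_space borel {s..t})"
    using assms(4) by (rule measurable_compose)
  then show ?thesis
    by (subst (asm) borel_measurable_restrict_space_iff_ennreal) auto
qed

lemma curve_integral_subcurve:
  fixes g :: "'a::metric_space \<Rightarrow> ennreal"
  assumes "arc_length_curve l \<gamma>" "0 \<le> s" "s \<le> t" "t \<le> l" "g \<in> borel_measurable borel"
  shows "curve_integral (t - s) (\<lambda>\<tau>. \<gamma> (s + \<tau>)) g = (\<integral>\<^sup>+\<tau>\<in>{s..t}. g (\<gamma> \<tau>) \<partial>lborel)"
proof -
  have "(\<integral>\<^sup>+\<tau>\<in>{s..t}. g (\<gamma> \<tau>) \<partial>lborel) =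
    ennreal \<bar>1\<bar> * (\<integral>\<^sup>+\<tau>. g (\<gamma> (s + 1 * \<tau>)) * indicator {s..t} (s + 1 * \<tau>) \<partial>lborel)"
    by (rule nn_integral_real_affine) (use curve_integrand_measurable[OF assms(1,2,4,5)] in auto)
  also have "\<dots> = (\<integral>\<^sup>+\<tau>. g (\<gamma> (s + \<tau>)) * indicator {0..t - s} \<tau> \<partial>lborel)"
    by (simp, intro nn_integral_cong) (auto simp: indicator_def)
  finally show ?thesis unfolding curve_integral_def by simp
qed

lemma upper_gradient_subcurve:
  assumes "upper_gradient u g" "arc_length_curve l \<gamma>" "0 \<le> s" "s \<le> t" "t \<le> l"
  shows "ennreal \<bar>u (\<gamma> s) - u (\<gamma> t)\<bar> \<le> (\<integral>\<^sup>+\<tau>\<in>{s..t}. g (\<gamma> \<tau>) \<partial>lborel)"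
proof (cases "s = t")
  case False
  then have "s < t" using assms by simp
  then have "ennreal \<bar>u (\<gamma> (s + 0)) - u (\<gamma> (s + (t - s)))\<bar> \<le> curve_integral (t - s) (\<lambda>\<tau>. \<gamma> (s + \<tau>)) g"
    using assms arc_length_curve_subcurve[of l \<gamma> s t] unfolding upper_gradient_def by blast
  then show ?thesis
    using curve_integral_subcurve[of l \<gamma> s t g] assms unfolding upper_gradient_def by simp
qed simp

text \<open>Allowing any superset \<open>A\<close> of the level set makes room for a Borel set when
  the level set itself is not Borel.\<close>

lemma upper_gradient_truncation_on_curve:
  assumes ug: "upper_gradient u g" and \<gamma>: "arc_length_curve l \<gamma>" and ab: "a < b"
    and fin: "curve_integral l \<gamma> g < \<infinity>" and A: "{x. a < u x \<and> u x < b} \<subseteq> A"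
  shows "ennreal \<bar>truncation a b (u (\<gamma> 0)) - truncation a b (u (\<gamma> l))\<bar> \<le> curve_integral l \<gamma> (\<lambda>x. g x * indicator A x)"
proof -
  have l: "0 \<le> l" using \<gamma> unfolding arc_length_curve_def by auto
  have "ennreal \<bar>truncation a b (u (\<gamma> 0)) - truncation a b (u (\<gamma> l))\<bar>
    \<le> (\<integral>\<^sup>+\<tau>\<in>{0..l}. g (\<gamma> \<tau>) * indicator {\<tau>. a < u (\<gamma> \<tau>) \<and> u (\<gamma> \<tau>) < b} \<tau> \<partial>lborel)"
    using fin upper_gradient_subcurve[OF ug \<gamma>] curve_integrand_measurable[OF \<gamma>, of 0 l g] ug
    unfolding curve_integral_def upper_gradient_def
    by (intro truncated_variation[where f = "\<lambda>\<tau>. u (\<gamma> \<tau>)" and G = "\<lambda>\<tau>. g (\<gamma> \<tau>)", OF _ l ab]) auto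
  also have "\<dots> \<le> curve_integral l \<gamma> (\<lambda>x. g x * indicator A x)"
    unfolding curve_integral_def using A by (intro nn_integral_mono) (auto simp: indicator_def)
  finally show ?thesis .
qed

text \<open>The exceptional curves are those with infinite integral of \<open>g\<close>. Since
  \<open>g\<close> has a finite integral of its \<open>s\<close>-th power, \<open>g\<close> itself
  is the witness that they are negligible.\<close>

lemma weak_upper_gradient_truncation:
  fixes u :: "'a::metric_space \<Rightarrow> real"
  assumes ug: "upper_gradient u g" and gp: "(\<integral>\<^sup>+x. epowr (g x) s \<partial>M) < \<infinity>" and ab: "a < b"
    and A: "{x. a < u x \<and> u x < b} \<subseteq> A" "A \<in> sets borel"
  shows "weak_upper_gradient M s (\<lambda>x. truncation a b (u x)) (\<lambda>x. g x * indicator A x)"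
  unfolding weak_upper_gradient_def almost_every_curve_def
proof (intro conjI exI[of _ g] allI impI)
  have g [measurable]: "g \<in> borel_measurable borel" using ug unfolding upper_gradient_def by simp
  then show "g \<in> borel_measurable borel" .
  show "(\<lambda>x. g x * indicator A x) \<in> borel_measurable borel" using A by measurable
  fix l and \<gamma> :: "real \<Rightarrow> 'a"
  assume \<gamma>: "arc_length_curve l \<gamma>"
    "\<not> ennreal \<bar>truncation a b (u (\<gamma> 0)) - truncation a b (u (\<gamma> l))\<bar> \<le> curve_integral l \<gamma> (\<lambda>x. g x * indicator A x)"
  show "curve_integral l \<gamma> g = \<infinity>"
  proof (rule ccontr)
    assume "curve_integral l \<gamma> g \<noteq> \<infinity>"
    then have "curve_integral l \<gamma> g < \<infinity>" by (simp add: less_top)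
    with upper_gradient_truncation_on_curve[OF ug \<gamma>(1) ab _ A(1)] \<gamma>(2) show False by blast
  qed
qed (rule gp)

section \<open>Cut-off functions\<close>

definition cutoff :: "'a::metric_space \<Rightarrow> real \<Rightarrow> 'a \<Rightarrow> real" where
  "cutoff x R y = truncation 0 1 (2 - dist x y / R)"

text \<open>It vanishes where \<open>dist x y \<le> R\<close>, and so contributes nothing to the
  right side of a Poincare inequality on \<open>ball x R\<close>.\<close>

definition cutoff_gradient :: "'a::metric_space \<Rightarrow> real \<Rightarrow> 'a \<Rightarrow> ennreal" where
  "cutoff_gradient x R y = ennreal (1 / R) * indicator {y. R < dist x y \<and> dist x y < 2 * R} y"

lemma cutoff:
  assumes "0 < R"
  shows "0 \<le> cutoff x R y" "cutoff x R y \<le> 1" "dist x y \<le> R \<Longrightarrow> cutoff x R y = 1"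
    "2 * R \<le> dist x y \<Longrightarrow> cutoff x R y = 0" "continuous_on UNIV (cutoff x R)"
proof -
  show "0 \<le> cutoff x R y" "cutoff x R y \<le> 1" "dist x y \<le> R \<Longrightarrow> cutoff x R y = 1"
    "2 * R \<le> dist x y \<Longrightarrow> cutoff x R y = 0"
    using assms unfolding cutoff_def truncation_def by (auto simp: field_simps max_def min_def)
  show "continuous_on UNIV (cutoff x R)"
    unfolding cutoff_def truncation_def using assms by (intro continuous_intros) auto
qed

text \<open>Along a curve \<open>2 - dist x y / R\<close> has Lipschitz constant
  \<open>1 / R\<close>. \<open>truncated_variation\<close> confines the constant gradient to the
  times with values strictly between 0 and 1, which form the annulus.\<close>

lemma upper_gradient_cutoff:
  assumes R: "0 < R"
  shows "upper_gradient (cutoff x R) (cutoff_gradient x R)"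
  unfolding upper_gradient_def
proof (intro conjI allI impI)
  have "open {y. R < dist x y \<and> dist x y < 2 * R}"
    by (intro open_Collect_conj open_Collect_less continuous_intros)
  from borel_open[OF this] show "cutoff_gradient x R \<in> borel_measurable borel"
    unfolding cutoff_gradient_def[abs_def]
    by (intro borel_measurable_times_ennreal borel_measurable_const borel_measurable_indicator)
  fix l and \<gamma> :: "real \<Rightarrow> 'a" assume \<gamma>: "arc_length_curve l \<gamma>"
  define f where "f \<tau> = 2 - dist x (\<gamma> \<tau>) / R" for \<tau>
  have l: "0 \<le> l" using \<gamma> unfolding arc_length_curve_def by auto
  have const: "(\<integral>\<^sup>+\<tau>\<in>{s..t}. ennreal (1 / R) \<partial>lborel) = ennreal ((t - s) / R)" if "s \<le> t" for s t
    using R that by (simp add: nn_integral_cmult ennreal_mult'[symmetric])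
  have "ennreal \<bar>truncation 0 1 (f 0) - truncation 0 1 (f l)\<bar>
    \<le> (\<integral>\<^sup>+\<tau>\<in>{0..l}. ennreal (1 / R) * indicator {\<tau>. 0 < f \<tau> \<and> f \<tau> < 1} \<tau> \<partial>lborel)"
  proof (rule truncated_variation)
    fix s t :: real assume st: "0 \<le> s" "s \<le> t" "t \<le> l"
    have "\<bar>f s - f t\<bar> = \<bar>dist x (\<gamma> s) - dist x (\<gamma> t)\<bar> / R"
      unfolding f_def using R by (simp add: diff_divide_distrib[symmetric] abs_minus_commute)
    also have "\<dots> \<le> dist (\<gamma> s) (\<gamma> t) / R"
      using R dist_triangle[of x "\<gamma> s" "\<gamma> t"] dist_triangle[of x "\<gamma> t" "\<gamma> s"]
      by (intro divide_right_mono) (auto simp: dist_commute)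
    also have "\<dots> \<le> (t - s) / R"
      using arc_length_curve_dist_le[OF \<gamma> st] R by (intro divide_right_mono) auto
    finally show "ennreal \<bar>f s - f t\<bar> \<le> (\<integral>\<^sup>+\<tau>\<in>{s..t}. ennreal (1 / R) \<partial>lborel)"
      unfolding const[OF st(2)] by (rule ennreal_leI)
  next
    show "(\<integral>\<^sup>+\<tau>\<in>{0..l}. ennreal (1 / R) \<partial>lborel) < \<infinity>" unfolding const[OF l] by simp
  qed (use l in auto)
  also have "\<dots> \<le> curve_integral l \<gamma> (cutoff_gradient x R)"
    unfolding curve_integral_def cutoff_gradient_def f_def using R
    by (intro nn_integral_mono) (auto simp: indicator_def field_simps)
  finally show "ennreal \<bar>cutoff x R (\<gamma> 0) - cutoff x R (\<gamma> l)\<bar> \<le> curve_integral l \<gamma> (cutoff_gradient x R)"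
    unfolding cutoff_def f_def .
qed

text \<open>Clamping \<open>v\<close> between \<open>- k * \<phi>\<close> and
  \<open>k * \<phi>\<close> replaces multiplication by \<open>\<phi>\<close>. The clamped value is
  1-Lipschitz in the pair of value and bound for the maximum norm, so the gradients combine by
  \<open>max\<close> and no product rule is needed. The exceptional curves are those of
  \<open>v\<close>.\<close>

lemma weak_upper_gradient_localise:
  assumes v: "weak_upper_gradient M s v g" and \<phi>: "upper_gradient \<phi> g'" and k: "0 \<le> k"
  shows "weak_upper_gradient M s (\<lambda>x. truncation (- (k * \<phi> x)) (k * \<phi> x) (v x)) (\<lambda>x. max (g x) (ennreal k * g' x))"
proof -
  obtain \<rho> where \<rho>: "\<rho> \<in> borel_measurable borel" "(\<integral>\<^sup>+x. epowr (\<rho> x) s \<partial>M) < \<infinity>"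
    "\<And>l \<gamma>. arc_length_curve l \<gamma> \<Longrightarrow> \<not> ennreal \<bar>v (\<gamma> 0) - v (\<gamma> l)\<bar> \<le> curve_integral l \<gamma> g \<Longrightarrow>
      curve_integral l \<gamma> \<rho> = \<infinity>"
    using v unfolding weak_upper_gradient_def almost_every_curve_def by blast
  have g [measurable]: "g \<in> borel_measurable borel" using v unfolding weak_upper_gradient_def by simp
  have g' [measurable]: "g' \<in> borel_measurable borel" using \<phi> unfolding upper_gradient_def by simp
  have le: "ennreal \<bar>truncation (- (k * \<phi> (\<gamma> 0))) (k * \<phi> (\<gamma> 0)) (v (\<gamma> 0)) - truncation (- (k * \<phi> (\<gamma> l))) (k * \<phi> (\<gamma> l)) (v (\<gamma> l))\<bar>
    \<le> curve_integral l \<gamma> (\<lambda>x. max (g x) (ennreal k * g' x))"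
    if \<gamma>: "arc_length_curve l \<gamma>" "ennreal \<bar>v (\<gamma> 0) - v (\<gamma> l)\<bar> \<le> curve_integral l \<gamma> g" for l \<gamma>
  proof -
    define X where "X = curve_integral l \<gamma> (\<lambda>x. max (g x) (ennreal k * g' x))"
    have "ennreal \<bar>v (\<gamma> 0) - v (\<gamma> l)\<bar> \<le> X"
      unfolding X_def
      by (rule order.trans[OF \<gamma>(2)]) (auto simp: curve_integral_def intro!: nn_integral_mono mult_right_mono)
    moreover have "ennreal \<bar>k * \<phi> (\<gamma> 0) - k * \<phi> (\<gamma> l)\<bar> \<le> X"
    proof -
      have "ennreal \<bar>k * \<phi> (\<gamma> 0) - k * \<phi> (\<gamma> l)\<bar> = ennreal k * ennreal \<bar>\<phi> (\<gamma> 0) - \<phi> (\<gamma> l)\<bar>"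
        using k by (simp add: ennreal_mult'[symmetric] right_diff_distrib[symmetric] abs_mult)
      also have "\<dots> \<le> ennreal k * curve_integral l \<gamma> g'"
        using \<phi> \<gamma>(1) unfolding upper_gradient_def by (intro mult_left_mono) auto
      also have "\<dots> = (\<integral>\<^sup>+\<tau>. ennreal k * (g' (\<gamma> \<tau>) * indicator {0..l} \<tau>) \<partial>lborel)"
        unfolding curve_integral_def
        using curve_integrand_measurable[OF \<gamma>(1) _ _ g', of 0 l] by (intro nn_integral_cmult[symmetric]) auto
      also have "\<dots> \<le> X"
        unfolding X_def curve_integral_def by (intro nn_integral_mono) (auto simp: indicator_def)
      finally show ?thesis .
    qed
    moreover have truncation_le: "\<bar>truncation (- s) s x - truncation (- t) t y\<bar> \<le> max \<bar>x - y\<bar> \<bar>s - t\<bar>" for s t x y :: real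
      unfolding truncation_def by (auto simp: max_def min_def)
    ultimately have "ennreal (max \<bar>v (\<gamma> 0) - v (\<gamma> l)\<bar> \<bar>k * \<phi> (\<gamma> 0) - k * \<phi> (\<gamma> l)\<bar>) \<le> X"
      by (simp add: max_def)
    then show ?thesis
      unfolding X_def[symmetric] by (rule order.trans[OF ennreal_leI[OF truncation_le]])
  qed
  show ?thesis
    unfolding weak_upper_gradient_def almost_every_curve_def
  proof (intro conjI exI[of _ \<rho>] allI impI)
    show "(\<lambda>x. max (g x) (ennreal k * g' x)) \<in> borel_measurable borel" by measurable
  qed (use \<rho> le in blast)+
qed

section \<open>Truncations and the Poincare inequality\<close>

lemma epowr_measurable [measurable (raw)]:
  assumes [measurable]: "f \<in> borel_measurable N"
  shows "(\<lambda>x. epowr (f x) a) \<in> borel_measurable N"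
  unfolding epowr_def by measurable

lemma epowr_ennreal: "0 \<le> t \<Longrightarrow> epowr (ennreal t) a = ennreal (t powr a)"
  by (simp add: epowr_def)

lemma epowr_0 [simp]: "epowr 0 a = 0"
  by (simp add: epowr_def)

lemma diameter_ball_le:
  fixes x :: "'a::metric_space"
  assumes "0 < r"
  shows "diameter (ball x r) \<le> 2 * r"
proof -
  have "(SUP (y, z)\<in>ball x r \<times> ball x r. dist y z) \<le> 2 * r"
  proof (rule cSUP_least)
    show "ball x r \<times> ball x r \<noteq> {}" using assms by auto
    fix yz assume "yz \<in> ball x r \<times> ball x r"
    then show "(case yz of (y, z) \<Rightarrow> dist y z) \<le> 2 * r"
      using dist_triangle[of "fst yz" "snd yz" x] by (auto simp: dist_commute)
  qed
  then show ?thesis using assms unfolding diameter_def by auto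
qed

context doubling_metric_measure_space
begin

lemma locally_integrable_bounded:
  assumes [measurable]: "v \<in> borel_measurable M" and bd: "\<And>y. \<bar>v y\<bar> \<le> k"
  shows "locally_integrable v"
  unfolding locally_integrable_def set_integrable_def
proof (intro conjI allI)
  fix x r
  show "integrable M (\<lambda>y. indicator (ball x r) y *\<^sub>R v y)"
  proof (rule Bochner_Integration.integrable_bound)
    show "integrable M (\<lambda>y. k * indicator (ball x r) y :: real)"
      using emeasure_ball_finite[of x r] by simp
    show "AE y in M. norm (indicator (ball x r) y *\<^sub>R v y) \<le> norm (k * indicator (ball x r) y :: real)"
      using order.trans[OF bd abs_ge_self] by (intro AE_I2) (auto simp: indicator_def)
  qed measurable
qed simp

lemma locally_integrable_Lp:
  assumes [measurable]: "u \<in> borel_measurable M" and up: "(\<integral>\<^sup>+x. ennreal (\<bar>u x\<bar> powr p) \<partial>M) < \<infinity>"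
    and p: "1 \<le> p"
  shows "locally_integrable u"
  unfolding locally_integrable_def set_integrable_def
proof (intro conjI allI)
  fix x r
  show "integrable M (\<lambda>y. indicator (ball x r) y *\<^sub>R u y)"
  proof (rule integrableI_bounded)
    have "(\<integral>\<^sup>+y. ennreal (norm (indicator (ball x r) y *\<^sub>R u y)) \<partial>M)
      \<le> (\<integral>\<^sup>+y. indicator (ball x r) y + ennreal (\<bar>u y\<bar> powr p) \<partial>M)"
    proof (rule nn_integral_mono)
      fix y
      have "\<bar>u y\<bar> \<le> 1 + \<bar>u y\<bar> powr p"
      proof (cases "\<bar>u y\<bar> \<le> 1")
        case False
        then have "\<bar>u y\<bar> powr 1 \<le> \<bar>u y\<bar> powr p" using p by (intro powr_mono) auto
        then show ?thesis by (simp split: if_splits)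
      qed (simp add: add_increasing2)
      then have "ennreal \<bar>u y\<bar> \<le> 1 + ennreal (\<bar>u y\<bar> powr p)"
        by (simp add: ennreal_leI flip: ennreal_1 ennreal_plus)
      then show "ennreal (norm (indicator (ball x r) y *\<^sub>R u y))
        \<le> indicator (ball x r) y + ennreal (\<bar>u y\<bar> powr p)"
        by (auto simp: indicator_def)
    qed
    also have "\<dots> = emeasure M (ball x r) + (\<integral>\<^sup>+x. ennreal (\<bar>u x\<bar> powr p) \<partial>M)"
      by (subst nn_integral_add) auto
    also have "\<dots> < \<infinity>" using up emeasure_ball_finite[of x r] by (simp add: less_top[symmetric])
    finally show "(\<integral>\<^sup>+y. ennreal (norm (indicator (ball x r) y *\<^sub>R u y)) \<partial>M) < \<infinity>" .
  qed measurable
qed simp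

lemma ball_average_cong:
  "(\<And>y. y \<in> ball x r \<Longrightarrow> f y = g y) \<Longrightarrow> ball_average M f x r = ball_average M g x r"
  unfolding ball_average_def by (metis (mono_tags, lifting) ball_in_sets set_lebesgue_integral_cong)

text \<open>The truncation agrees on the ball with a compactly supported function that has the same
  weak upper gradient there.\<close>

lemma poincare_truncation:
  assumes PI: "\<And>x r u g. 0 < r \<Longrightarrow> integrable M u \<Longrightarrow> weak_upper_gradient M p u g \<Longrightarrow>
      ennreal (ball_average M (\<lambda>y. \<bar>u y - ball_average M u x r\<bar>) x r)
        \<le> ennreal (C * diameter (ball x r)) *
           epowr (ball_nn_average M (\<lambda>y. epowr (g y) p) x (\<sigma> * r)) (1 / p)"
    and C: "0 < C" and \<sigma>: "1 \<le> \<sigma>" and p: "1 < p"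
    and um [measurable]: "u \<in> borel_measurable M" and ug: "upper_gradient u g"
    and gp: "(\<integral>\<^sup>+x. epowr (g x) p \<partial>M) < \<infinity>" and ab: "a < b" and r: "0 < r"
  defines "v \<equiv> \<lambda>y. truncation a b (u y)" and "N \<equiv> density M (\<lambda>y. epowr (g y) p)"
  shows "ball_average M (\<lambda>y. \<bar>v y - ball_average M v x r\<bar>) x r
    \<le> 2 * C * (r * (measure N ({y. a < u y \<and> u y < b} \<inter> ball x (\<sigma> * r)) / measure M (ball x r)) powr (1 / p))"
proof -
  have gb [measurable]: "g \<in> borel_measurable borel" using ug unfolding upper_gradient_def by simp
  have gm [measurable]: "g \<in> borel_measurable M" using gb by (rule borel_measurable_lift)
  define R where "R = \<sigma> * r"
  have R: "0 < R" "r \<le> R" unfolding R_def using r \<sigma> by auto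
  define B where "B = ball x R"
  have BM [measurable]: "B \<in> sets M" "B \<in> sets borel" unfolding B_def by auto
  define S where "S = {y. a < u y \<and> u y < b}"
  have "S = {y\<in>space M. a < u y \<and> u y < b}" unfolding S_def space_eq by auto
  also have "\<dots> \<in> sets M" by measurable
  finally have SM [measurable]: "S \<in> sets M" .
  \<comment> \<open>\<open>S\<close> is only M-measurable, whereas a gradient must be Borel; the
    hull differs from \<open>S \<inter> B\<close> by a null set.\<close>
  obtain A where A: "A \<in> sets borel" "S \<inter> B \<subseteq> A" "emeasure M A = emeasure M (S \<inter> B)"
    using borel_regular[of "S \<inter> B"] by auto
  have AM [measurable]: "A \<in> sets M" using A(1) by (rule borel_in_sets)
  have finSB: "emeasure M (S \<inter> B) \<noteq> \<infinity>"
    using emeasure_mono[of "S \<inter> B" B M] emeasure_ball_finite[of x R] unfolding B_def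
    by (auto simp: top_unique)
  have "emeasure M (A - S \<inter> B) = 0"
    using A finSB by (subst emeasure_Diff) auto
  then have null: "AE y in M. y \<notin> A - S \<inter> B"
    by (intro AE_not_in) auto
  define k where "k = max \<bar>a\<bar> \<bar>b\<bar>"
  have k: "0 \<le> k" "\<bar>v y\<bar> \<le> k" for y
    unfolding k_def v_def truncation_def by (auto simp: max_def min_def)
  \<comment> \<open>Outside \<open>B\<close> the whole gradient is kept, so that the Borel set
    \<open>A \<union> - B\<close> contains the level set; inside \<open>B\<close> only the hull
    remains.\<close>
  define g1 where "g1 y = g y * indicator (A \<union> - B) y" for y
  have w1: "weak_upper_gradient M p v g1"
    unfolding v_def g1_def
    by (rule weak_upper_gradient_truncation[OF ug gp ab]) (use A in \<open>auto simp: S_def B_def\<close>)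
  \<comment> \<open>\<open>w\<close> vanishes outside \<open>ball x (2 * R)\<close> and is bounded,
    hence integrable as \<open>PI\<close> demands. On \<open>ball x r\<close> the cut-off is 1 and
    \<open>\<bar>v\<bar> \<le> k\<close>, so there \<open>w\<close> equals \<open>v\<close>.\<close>
  define w where "w y = truncation (- (k * cutoff x R y)) (k * cutoff x R y) (v y)" for y
  define g' where "g' y = max (g1 y) (ennreal k * cutoff_gradient x R y)" for y
  have w: "weak_upper_gradient M p w g'"
    unfolding w_def g'_def by (rule weak_upper_gradient_localise[OF w1 upper_gradient_cutoff[OF R(1)] k(1)])
  have g'B: "epowr (g' y) p * indicator B y = epowr (g y) p * indicator (A \<inter> B) y" for y
    unfolding g'_def g1_def cutoff_gradient_def B_def by (auto simp: indicator_def max_def)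
  have cm [measurable]: "cutoff x R \<in> borel_measurable M"
    using cutoff(5)[OF R(1)] by (intro borel_measurable_lift borel_measurable_continuous_onI)
  have vm [measurable]: "v \<in> borel_measurable M" unfolding v_def truncation_def by measurable
  have int: "integrable M w"
  proof (rule Bochner_Integration.integrable_bound)
    show "integrable M (\<lambda>y. k * indicator (ball x (2 * R)) y :: real)"
      using emeasure_ball_finite[of x "2 * R"] by simp
    show "w \<in> borel_measurable M" unfolding w_def truncation_def by measurable
    have "\<bar>w y\<bar> \<le> k * indicator (ball x (2 * R)) y" for y
    proof -
      have "0 \<le> k * cutoff x R y" by (rule mult_nonneg_nonneg[OF k(1) cutoff(1)[OF R(1)]])
      then have "\<bar>w y\<bar> \<le> k * cutoff x R y"
        unfolding w_def truncation_def by (auto simp: max_def min_def)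
      also have "\<dots> \<le> k * indicator (ball x (2 * R)) y"
        using k(1) cutoff(2,4)[OF R(1), of x y] by (intro mult_left_mono) (auto simp: indicator_def)
      finally show ?thesis .
    qed
    then show "AE y in M. norm (w y) \<le> norm (k * indicator (ball x (2 * R)) y :: real)"
      using k(1) by (intro AE_I2) (auto simp: indicator_def intro: order.trans)
  qed
  have wv: "w y = v y" if "y \<in> ball x r" for y
  proof -
    have "cutoff x R y = 1" using that R by (intro cutoff(3)) auto
    then show ?thesis using k(2)[of y] unfolding w_def truncation_def by (auto simp: max_def min_def abs_le_iff)
  qed
  have avg: "ball_average M w x r = ball_average M v x r"
    by (rule ball_average_cong) (rule wv)
  have avg2: "ball_average M (\<lambda>y. \<bar>w y - ball_average M w x r\<bar>) x r
    = ball_average M (\<lambda>y. \<bar>v y - ball_average M v x r\<bar>) x r"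
    by (rule ball_average_cong) (simp add: wv avg)
  have finN: "finite_measure N"
    unfolding N_def using gp by (intro finite_measureI) (simp add: emeasure_density cong: nn_integral_cong)
  interpret N: finite_measure N by fact
  have "(\<integral>\<^sup>+y\<in>B. epowr (g' y) p \<partial>M) = (\<integral>\<^sup>+y. epowr (g y) p * indicator (A \<inter> B) y \<partial>M)"
    by (simp only: g'B)
  also have "\<dots> = (\<integral>\<^sup>+y. epowr (g y) p * indicator (S \<inter> B) y \<partial>M)"
  proof (rule nn_integral_cong_AE)
    show "AE y in M. epowr (g y) p * indicator (A \<inter> B) y = epowr (g y) p * indicator (S \<inter> B) y"
      using null
    proof eventually_elim
      case (elim y)
      then show ?case using A(2) by (auto simp: indicator_def)
    qed
  qed
  also have "\<dots> = emeasure N (S \<inter> B)"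
    unfolding N_def by (subst emeasure_density) auto
  also have "\<dots> = ennreal (measure N (S \<inter> B))" by (rule N.emeasure_eq_measure)
  finally have nn: "(\<integral>\<^sup>+y\<in>B. epowr (g' y) p \<partial>M) = ennreal (measure N (S \<inter> B))" .
  have mB: "0 < measure M B" unfolding B_def by (rule measure_ball_pos[OF R(1)])
  have "ball_nn_average M (\<lambda>y. epowr (g' y) p) x (\<sigma> * r) = ennreal (measure N (S \<inter> B) / measure M B)"
    using nn mB unfolding ball_nn_average_def R_def[symmetric] B_def
    by (simp add: emeasure_ball divide_ennreal)
  then have "ennreal (ball_average M (\<lambda>y. \<bar>v y - ball_average M v x r\<bar>) x r)
    \<le> ennreal (C * diameter (ball x r)) * ennreal ((measure N (S \<inter> B) / measure M B) powr (1 / p))"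
    using PI[OF r int w, of x] unfolding avg2 by (simp add: epowr_ennreal)
  \<comment> \<open>The bound on the diameter produces the factor 2 of the constant
    \<open>2 * C\<close>; the smaller ball in the denominator increases the right side.\<close>
  also have "\<dots> \<le> ennreal (C * (2 * r)) * ennreal ((measure N (S \<inter> B) / measure M (ball x r)) powr (1 / p))"
  proof (intro mult_mono ennreal_leI mult_left_mono powr_mono2 divide_left_mono)
    show "measure M (ball x r) \<le> measure M B"
      unfolding B_def using R by (intro measure_ball_mono subset_ball)
  qed (use C p r mB measure_ball_pos[OF r, of x] diameter_ball_le[OF r, of x] diameter_ge_0[OF bounded_ball, of x r] in auto)
  also have "\<dots> = ennreal (2 * C * (r * (measure N (S \<inter> B) / measure M (ball x r)) powr (1 / p)))"
    using C r by (simp add: ennreal_mult'[symmetric] mult_ac)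
  finally show ?thesis
    using C r unfolding S_def B_def R_def by (subst (asm) ennreal_le_iff) auto
qed

end

context poincare_setting
begin

text \<open>\<open>u\<close> need not be integrable over the space, so its own inequality is
  obtained from those of its truncations between \<open>- n\<close> and \<open>n\<close>, whose
  restricted measures are at most \<open>N\<close>.\<close>

lemma truncation_pairI:
  assumes u: "locally_integrable u" and N: "finite_measure N" "sets N = sets M"
    and PI: "\<And>a b x r. a < b \<Longrightarrow> 0 < r \<Longrightarrow>
      ball_average M (\<lambda>y. \<bar>truncation a b (u y) - ball_average M (\<lambda>y. truncation a b (u y)) x r\<bar>) x r
      \<le> K * (r * (measure N ({y. a < u y \<and> u y < b} \<inter> ball x (\<sigma> * r)) / measure M (ball x r)) powr (1 / p))"
  shows "truncation_pair u N"
  unfolding truncation_pair_def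
proof (intro conjI allI impI)
  interpret N: finite_measure N by fact
  have um [measurable]: "u \<in> borel_measurable M" using u unfolding locally_integrable_def by simp
  have SM: "{y. a < u y \<and> u y < b} \<in> sets M" for a b
  proof -
    have "{y. a < u y \<and> u y < b} = {y\<in>space M. a < u y \<and> u y < b}" unfolding space_eq by auto
    also have "\<dots> \<in> sets M" by measurable
    finally show ?thesis .
  qed
  have truncint: "locally_integrable (\<lambda>y. truncation a b (u y))" for a b
  proof (rule locally_integrable_bounded)
    show "(\<lambda>y. truncation a b (u y)) \<in> borel_measurable M" unfolding truncation_def by measurable
    show "\<bar>truncation a b (u y)\<bar> \<le> max \<bar>a\<bar> \<bar>b\<bar>" for y
      unfolding truncation_def by (auto simp: max_def min_def)
  qed
  fix a b :: real assume ab: "a < b"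
  have mN: "measure (density N (indicator {y. a < u y \<and> u y < b})) (ball x r)
      = measure N ({y. a < u y \<and> u y < b} \<inter> ball x r)" for x r
    using SM N by (intro finite_measure_density_indicator(2)) auto
  show "poincare_pair (\<lambda>y. truncation a b (u y)) (density N (indicator {y. a < u y \<and> u y < b}))"
    unfolding poincare_pair_def mN
    using truncint PI[OF ab] finite_measure_density_indicator(1)[OF N(1)] SM N(2) by auto
next
  interpret N: finite_measure N by fact
  have um [measurable]: "u \<in> borel_measurable M" using u unfolding locally_integrable_def by simp
  have "ball_average M (\<lambda>y. \<bar>u y - ball_average M u x r\<bar>) x r
      \<le> K * (r * (measure N (ball x (\<sigma> * r)) / measure M (ball x r)) powr (1 / p))" (is "?L \<le> ?R")
    if r: "0 < r" for x r
  proof -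
    define v where "v n y = truncation (- real n) (real n) (u y)" for n y
    have vm [measurable]: "v n \<in> borel_measurable M" for n unfolding v_def[abs_def] truncation_def by measurable
    have vint: "locally_integrable (v n)" for n
    proof (rule locally_integrable_bounded)
      show "\<bar>v n y\<bar> \<le> real n" for y unfolding v_def truncation_def by (auto simp: max_def min_def)
    qed measurable
    \<comment> \<open>The error tends to 0 by dominated convergence on the ball. It enters twice
      below, for the function and for its average.\<close>
    define e where "e n = ball_average M (\<lambda>y. \<bar>v n y - u y\<bar>) x r" for n
    have diffint: "set_integrable M (ball x r) (\<lambda>y. \<bar>v n y - u y\<bar>)" for n
      using vint[of n] u unfolding locally_integrable_def by (intro set_integrable_abs set_integral_diff(1)) auto
    have e: "e \<longlonglongrightarrow> 0"
    proof -
      have "(\<lambda>n. LINT y:ball x r|M. \<bar>v n y - u y\<bar>) \<longlonglongrightarrow> (LINT y:ball x r|M. 0)"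
        unfolding set_lebesgue_integral_def
      proof (rule integral_dominated_convergence)
        show "integrable M (\<lambda>y. indicator (ball x r) y *\<^sub>R \<bar>u y\<bar>)"
          using u set_integrable_abs unfolding locally_integrable_def set_integrable_def[symmetric] by blast
        show "AE y in M. (\<lambda>n. indicator (ball x r) y *\<^sub>R \<bar>v n y - u y\<bar>) \<longlonglongrightarrow> indicator (ball x r) y *\<^sub>R 0"
        proof (intro AE_I2)
          fix y
          obtain n0 :: nat where n0: "\<bar>u y\<bar> \<le> real n0" using real_arch_simple by blast
          have "\<forall>n\<ge>n0. v n y = u y"
            using n0 unfolding v_def truncation_def by (auto simp: max_def min_def abs_le_iff)
          then show "(\<lambda>n. indicator (ball x r) y *\<^sub>R \<bar>v n y - u y\<bar>) \<longlonglongrightarrow> indicator (ball x r) y *\<^sub>R 0"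
            by (intro tendsto_eventually) (auto simp: eventually_sequentially)
        qed
        show "AE y in M. norm (indicator (ball x r) y *\<^sub>R \<bar>v n y - u y\<bar>) \<le> indicator (ball x r) y *\<^sub>R \<bar>u y\<bar>" for n
          unfolding v_def truncation_def by (intro AE_I2) (auto simp: indicator_def max_def min_def)
      qed measurable
      then have "e \<longlonglongrightarrow> (LINT y:ball x r|M. 0) / measure M (ball x r)"
        unfolding e_def ball_average_def using measure_ball_pos[OF r, of x] by (intro tendsto_divide tendsto_const) auto
      then show ?thesis by simp
    qed
    have "?L \<le> ?R + 2 * e n" if n: "0 < n" for n :: nat
    proof -
      let ?m = "ball_average M u x r" and ?mn = "ball_average M (v n) x r"
      have dm: "\<bar>?mn - ?m\<bar> \<le> e n"
      proof -
        have "?mn - ?m = (LINT y:ball x r|M. v n y - u y) / measure M (ball x r)"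
          using vint[of n] u unfolding ball_average_def locally_integrable_def
          by (subst set_integral_diff(2)) (auto simp: diff_divide_distrib)
        also have "\<bar>\<dots>\<bar> \<le> (LINT y:ball x r|M. \<bar>v n y - u y\<bar>) / measure M (ball x r)"
          using integral_norm_bound[of M "\<lambda>y. indicator (ball x r) y *\<^sub>R (v n y - u y)"]
          unfolding set_lebesgue_integral_def by (simp add: abs_mult divide_right_mono)
        finally show ?thesis unfolding e_def ball_average_def .
      qed
      have "?L \<le> ball_average M (\<lambda>y. \<bar>v n y - ?mn\<bar> + (\<bar>v n y - u y\<bar> + e n)) x r"
      proof (rule ball_average_mono)
        show "set_integrable M (ball x r) (\<lambda>y. \<bar>u y - ?m\<bar>)" by (rule locally_integrable_dev(2)[OF u])
        show "set_integrable M (ball x r) (\<lambda>y. \<bar>v n y - ?mn\<bar> + (\<bar>v n y - u y\<bar> + e n))"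
          using emeasure_ball_finite[of x r]
          by (intro set_integral_add(1) diffint locally_integrable_dev(2)[OF vint]) (simp add: set_integrable_def)
        show "\<bar>u y - ?m\<bar> \<le> \<bar>v n y - ?mn\<bar> + (\<bar>v n y - u y\<bar> + e n)" for y using dm by linarith
      qed
      also have "\<dots> = ball_average M (\<lambda>y. \<bar>v n y - ?mn\<bar>) x r + (e n + e n)"
      proof -
        have c: "set_integrable M (ball x r) (\<lambda>y. e n)"
          using emeasure_ball_finite[of x r] by (simp add: set_integrable_def)
        have "(LINT y:ball x r|M. \<bar>v n y - ?mn\<bar> + (\<bar>v n y - u y\<bar> + e n))
          = (LINT y:ball x r|M. \<bar>v n y - ?mn\<bar>) + ((LINT y:ball x r|M. \<bar>v n y - u y\<bar>) + (LINT y:ball x r|M. e n))"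
          using diffint[of n] locally_integrable_dev(2)[OF vint[of n], of x r ?mn] c
          by (subst set_integral_add(2), simp, simp, subst set_integral_add(2)) auto
        moreover have "(LINT y:ball x r|M. e n) = e n * measure M (ball x r)"
          unfolding set_lebesgue_integral_def by simp
        ultimately show ?thesis
          using measure_ball_pos[OF r, of x] unfolding ball_average_def e_def[of n]
          by (simp add: add_divide_distrib)
      qed
      also have "ball_average M (\<lambda>y. \<bar>v n y - ?mn\<bar>) x r \<le> ?R"
      proof -
        have "ball_average M (\<lambda>y. \<bar>v n y - ?mn\<bar>) x r \<le> K * (r * (measure N ({y. - real n < u y \<and> u y < real n} \<inter> ball x (\<sigma> * r)) / measure M (ball x r)) powr (1 / p))"
          using PI[of "- real n" "real n" r x] n r unfolding v_def by simp
        also have "\<dots> \<le> ?R"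
          using K r p N(2) by (intro mult_left_mono powr_mono2 divide_right_mono N.finite_measure_mono) auto
        finally show ?thesis .
      qed
      finally show ?thesis by simp
    qed
    then have "\<forall>\<^sub>F n in sequentially. ?L \<le> ?R + 2 * e n"
      by (auto simp: eventually_sequentially intro!: exI[of _ 1])
    moreover have "(\<lambda>n. ?R + 2 * e n) \<longlonglongrightarrow> ?R + 2 * 0" by (intro tendsto_intros e)
    ultimately show ?thesis by (intro tendsto_lowerbound[of "\<lambda>n. ?R + 2 * e n" ?R]) auto
  qed
  then show "poincare_pair u N" unfolding poincare_pair_def using u N by auto
qed

end

section \<open>Capacity\<close>

lemma epowr_mono:
  assumes "0 \<le> a" "s \<le> t"
  shows "epowr s a \<le> epowr t a"
proof (cases "t = \<infinity>")
  case False
  then have "s \<noteq> \<infinity>" "t < \<infinity>" using assms by (auto simp: top_unique less_top)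
  then have "enn2real s \<le> enn2real t" using assms by (intro enn2real_mono) auto
  then show ?thesis
    using assms False \<open>s \<noteq> \<infinity>\<close> unfolding epowr_def by (simp add: ennreal_leI powr_mono2)
qed (simp add: epowr_def)

lemma epowr_epowr_inverse:
  assumes "0 < a"
  shows "epowr (epowr t (1 / a)) a = t" "epowr (epowr t a) (1 / a) = t"
  using assms by (cases t; simp add: epowr_def powr_powr)+

lemma capacity_le_energy:
  assumes q: "0 < q" and v: "v \<in> borel_measurable M" "\<And>x. x \<in> E \<Longrightarrow> 1 \<le> v x"
    and g: "upper_gradient v g"
  shows "capacity M q E \<le> (\<integral>\<^sup>+x. ennreal (\<bar>v x\<bar> powr q) \<partial>M) + (\<integral>\<^sup>+x. epowr (g x) q \<partial>M)"
    (is "_ \<le> ?a + ?b")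
proof (cases "?a + ?b = \<infinity>")
  case False
  then have "?a < \<infinity>" "?b < \<infinity>" by (auto simp: less_top)
  then have "v \<in> {u \<in> newtonian M q. \<forall>x\<in>E. 1 \<le> u x}"
    using v g unfolding newtonian_def by auto
  then have "capacity M q E \<le> epowr (newtonian_norm M q v) q"
    unfolding capacity_def by (intro INF_lower)
  also have "\<dots> = ?a + (INF g\<in>{g. upper_gradient v g}. \<integral>\<^sup>+x. epowr (g x) q \<partial>M)"
    unfolding newtonian_norm_def using q by (simp add: epowr_epowr_inverse)
  also have "\<dots> \<le> ?a + ?b"
    using g by (intro add_left_mono INF_lower) auto
  finally show ?thesis .
next
  case True
  then show ?thesis by (simp only: infinity_ennreal_def top_greatest)
qed

lemma quasi_everywhereI:
  assumes "capacity M s E = 0" "\<And>x. x \<notin> E \<Longrightarrow> P x"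
  shows "quasi_everywhere M s P"
proof -
  have "{x. \<not> P x} \<subseteq> E" using assms(2) by blast
  then have "capacity M s {x. \<not> P x} \<le> capacity M s E"
    unfolding capacity_def by (intro INF_superset_mono) auto
  then show ?thesis using assms(1) unfolding quasi_everywhere_def by simp
qed

text \<open>All increments are bounded by the integral of the supremum of the gradients, and such a
  bound passes to the supremum. The bound \<open>\<phi> i x \<le> 1\<close> makes the real supremum
  meaningful; countability gives Borel measurability.\<close>

lemma upper_gradient_SUP:
  fixes \<phi> :: "'i \<Rightarrow> 'a::metric_space \<Rightarrow> real"
  assumes I: "countable I" "I \<noteq> {}" and ug: "\<And>i. i \<in> I \<Longrightarrow> upper_gradient (\<phi> i) (g i)"
    and bd: "\<And>i x. i \<in> I \<Longrightarrow> \<phi> i x \<le> 1"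
  shows "upper_gradient (\<lambda>x. SUP i\<in>I. \<phi> i x) (\<lambda>x. SUP i\<in>I. g i x)"
  unfolding upper_gradient_def
proof (intro conjI allI impI)
  show "(\<lambda>x. SUP i\<in>I. g i x) \<in> borel_measurable borel"
    using I ug unfolding upper_gradient_def by (intro borel_measurable_SUP) auto
  fix l and \<gamma> :: "real \<Rightarrow> 'a" assume \<gamma>: "arc_length_curve l \<gamma>"
  define X where "X = curve_integral l \<gamma> (\<lambda>x. SUP i\<in>I. g i x)"
  have le: "ennreal \<bar>\<phi> i (\<gamma> 0) - \<phi> i (\<gamma> l)\<bar> \<le> X" if "i \<in> I" for i
  proof -
    have "ennreal \<bar>\<phi> i (\<gamma> 0) - \<phi> i (\<gamma> l)\<bar> \<le> curve_integral l \<gamma> (g i)"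
      using ug[OF that] \<gamma> unfolding upper_gradient_def by blast
    also have "\<dots> \<le> X"
      unfolding X_def curve_integral_def using that
      by (intro nn_integral_mono mult_right_mono SUP_upper) auto
    finally show ?thesis .
  qed
  have bdd: "bdd_above ((\<lambda>i. \<phi> i x) ` I)" for x using bd by (auto intro!: bdd_aboveI[of _ 1])
  show "ennreal \<bar>(SUP i\<in>I. \<phi> i (\<gamma> 0)) - (SUP i\<in>I. \<phi> i (\<gamma> l))\<bar> \<le> X"
  proof (cases X)
    case (real x)
    have "\<bar>\<phi> i (\<gamma> 0) - \<phi> i (\<gamma> l)\<bar> \<le> x" if "i \<in> I" for i
      using le[OF that] real by simp
    then have d: "\<phi> i (\<gamma> 0) \<le> \<phi> i (\<gamma> l) + x" "\<phi> i (\<gamma> l) \<le> \<phi> i (\<gamma> 0) + x" if "i \<in> I" for i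
      using that by (fastforce simp: abs_le_iff)+
    have "(SUP i\<in>I. \<phi> i (\<gamma> 0)) \<le> (SUP i\<in>I. \<phi> i (\<gamma> l)) + x"
    proof (rule cSUP_least[OF I(2)])
      fix i assume i: "i \<in> I"
      show "\<phi> i (\<gamma> 0) \<le> (SUP i\<in>I. \<phi> i (\<gamma> l)) + x"
        using d(1)[OF i] cSUP_upper[OF i bdd, of "\<gamma> l"] by linarith
    qed
    moreover have "(SUP i\<in>I. \<phi> i (\<gamma> l)) \<le> (SUP i\<in>I. \<phi> i (\<gamma> 0)) + x"
    proof (rule cSUP_least[OF I(2)])
      fix i assume i: "i \<in> I"
      show "\<phi> i (\<gamma> l) \<le> (SUP i\<in>I. \<phi> i (\<gamma> 0)) + x"
        using d(2)[OF i] cSUP_upper[OF i bdd, of "\<gamma> 0"] by linarith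
    qed
    ultimately show ?thesis unfolding real by (intro ennreal_leI) (auto simp: abs_le_iff)
  qed simp
qed

context poincare_setting
begin

text \<open>The test function is the supremum of cut-offs, one for each ball. Replacing suprema by
  sums after taking \<open>q\<close>-th powers requires no control of the overlap of the
  balls.\<close>

lemma capacity_cover_le:
  assumes q: "0 < q" and D': "countable D'" and \<rho>: "\<And>y. y \<in> D' \<Longrightarrow> 0 < \<rho> y"
    and E: "E \<subseteq> (\<Union>y\<in>D'. ball y (\<rho> y))"
  shows "capacity M q E \<le> (\<integral>\<^sup>+y. ennreal (1 + (1 / \<rho> y) powr q) * emeasure M (ball y (2 * \<rho> y)) \<partial>count_space D')"
proof -
  \<comment> \<open>The index \<open>None\<close> carries the zero function: the supremum is then
    over a nonempty set even for empty \<open>D'\<close>, and it is non-negative.\<close>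
  define I where "I = insert None (Some ` D')"
  define \<phi> where "\<phi> i = (case i of None \<Rightarrow> (\<lambda>_. 0) | Some y \<Rightarrow> cutoff y (\<rho> y))" for i
  define g where "g i = (case i of None \<Rightarrow> (\<lambda>_. 0) | Some y \<Rightarrow> cutoff_gradient y (\<rho> y))" for i
  define v where "v x = (SUP i\<in>I. \<phi> i x)" for x
  define G where "G x = (SUP i\<in>I. g i x)" for x
  have I: "countable I" "I \<noteq> {}" unfolding I_def using D' by auto
  have bd: "\<phi> i x \<le> 1" "0 \<le> \<phi> i x" if "i \<in> I" for i x
    using that cutoff(1,2)[OF \<rho>] unfolding I_def \<phi>_def by auto
  have ug: "upper_gradient (\<phi> i) (g i)" if "i \<in> I" for i
  proof (cases i)
    case None
    then show ?thesis unfolding \<phi>_def g_def upper_gradient_def by simp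
  next
    case (Some y)
    then have "y \<in> D'" using that unfolding I_def by auto
    then show ?thesis using upper_gradient_cutoff[OF \<rho>] unfolding \<phi>_def g_def Some by simp
  qed
  have uG: "upper_gradient v G"
    unfolding v_def G_def by (rule upper_gradient_SUP[OF I ug bd(1)])
  have bdd: "bdd_above ((\<lambda>i. \<phi> i x) ` I)" for x using bd by (auto intro!: bdd_aboveI[of _ 1])
  have vm: "v \<in> borel_measurable M"
    unfolding v_def[abs_def]
  proof (rule borel_measurable_cSUP[OF I(1) _ bdd])
    fix i assume "i \<in> I"
    then show "\<phi> i \<in> borel_measurable M"
      using cutoff(5)[OF \<rho>] unfolding I_def \<phi>_def
      by (auto intro!: borel_measurable_lift borel_measurable_continuous_onI)
  qed
  have v01: "0 \<le> v x" "v x \<le> 1" for x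
  proof -
    have "\<phi> None x \<le> v x" unfolding v_def by (intro cSUP_upper bdd) (simp add: I_def)
    then show "0 \<le> v x" by (simp add: \<phi>_def)
    show "v x \<le> 1" unfolding v_def using I(2) bd(1) by (intro cSUP_least) auto
  qed
  have vE: "1 \<le> v x" if "x \<in> E" for x
  proof -
    obtain y where y: "y \<in> D'" "x \<in> ball y (\<rho> y)" using E \<open>x \<in> E\<close> by blast
    then have "\<phi> (Some y) x = 1" using cutoff(3)[OF \<rho>, of y y x] by (simp add: \<phi>_def)
    moreover have "\<phi> (Some y) x \<le> v x" unfolding v_def using y by (intro cSUP_upper bdd) (simp add: I_def)
    ultimately show ?thesis by simp
  qed
  have v_le: "ennreal (\<bar>v x\<bar> powr q) \<le> (\<integral>\<^sup>+y. indicator (ball y (2 * \<rho> y)) x \<partial>count_space D')" for x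
  proof (cases "\<exists>y\<in>D'. x \<in> ball y (2 * \<rho> y)")
    case True
    then obtain y where y: "y \<in> D'" "x \<in> ball y (2 * \<rho> y)" by blast
    have "ennreal (\<bar>v x\<bar> powr q) \<le> ennreal 1"
      using v01 q by (intro ennreal_leI powr_le1) auto
    also have "ennreal 1 = indicator (ball y (2 * \<rho> y)) x" using y by simp
    also have "\<dots> \<le> (\<integral>\<^sup>+y. indicator (ball y (2 * \<rho> y)) x \<partial>count_space D')"
      by (rule ennreal_le_nn_integral_count_space[OF y(1), of "\<lambda>y. indicator (ball y (2 * \<rho> y)) x"])
    finally show ?thesis .
  next
    case False
    have "\<phi> i x \<le> 0" if "i \<in> I" for i
    proof (cases i)
      case (Some y)
      then have y: "y \<in> D'" using that unfolding I_def by auto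
      then have "2 * \<rho> y \<le> dist y x" using False by auto
      then show ?thesis using cutoff(4)[OF \<rho>[OF y], of y x] unfolding \<phi>_def Some by simp
    qed (simp add: \<phi>_def)
    then have "v x \<le> 0" unfolding v_def using I(2) by (intro cSUP_least) auto
    then show ?thesis using v01(1)[of x] by simp
  qed
  have G_le: "epowr (G x) q
    \<le> (\<integral>\<^sup>+y. ennreal ((1 / \<rho> y) powr q) * indicator (ball y (2 * \<rho> y)) x \<partial>count_space D')" (is "_ \<le> ?T") for x
  proof -
    \<comment> \<open>Bounding every \<open>g i\<close> by the \<open>1 / q\<close>-th power of the
      sum avoids moving the power through the supremum.\<close>
    have "g i x \<le> epowr ?T (1 / q)" if "i \<in> I" for i
    proof (cases i)
      case (Some y)
      then have y: "y \<in> D'" using that unfolding I_def by auto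
      have "epowr (g i x) q \<le> ennreal ((1 / \<rho> y) powr q) * indicator (ball y (2 * \<rho> y)) x"
        using \<rho>[OF y] unfolding g_def Some cutoff_gradient_def
        by (auto simp: indicator_def epowr_ennreal)
      also have "\<dots> \<le> ?T"
        by (rule ennreal_le_nn_integral_count_space[OF y, of "\<lambda>y. ennreal ((1 / \<rho> y) powr q) * indicator (ball y (2 * \<rho> y)) x"])
      finally have "epowr (epowr (g i x) q) (1 / q) \<le> epowr ?T (1 / q)" using q by (intro epowr_mono) auto
      then show ?thesis using q by (simp add: epowr_epowr_inverse)
    qed (simp add: g_def)
    then have "G x \<le> epowr ?T (1 / q)" unfolding G_def by (intro SUP_least)
    then have "epowr (G x) q \<le> epowr (epowr ?T (1 / q)) q" using q by (intro epowr_mono) auto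
    then show ?thesis using q by (simp add: epowr_epowr_inverse)
  qed
  have "capacity M q E \<le> (\<integral>\<^sup>+x. ennreal (\<bar>v x\<bar> powr q) \<partial>M) + (\<integral>\<^sup>+x. epowr (G x) q \<partial>M)"
    by (rule capacity_le_energy[OF q vm vE uG])
  also have "\<dots> \<le> (\<integral>\<^sup>+x. (\<integral>\<^sup>+y. indicator (ball y (2 * \<rho> y)) x \<partial>count_space D') \<partial>M) +
    (\<integral>\<^sup>+x. (\<integral>\<^sup>+y. ennreal ((1 / \<rho> y) powr q) * indicator (ball y (2 * \<rho> y)) x \<partial>count_space D') \<partial>M)"
    by (intro add_mono nn_integral_mono v_le G_le)
  also have "\<dots> = (\<integral>\<^sup>+y. emeasure M (ball y (2 * \<rho> y)) \<partial>count_space D') +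
    (\<integral>\<^sup>+y. ennreal ((1 / \<rho> y) powr q) * emeasure M (ball y (2 * \<rho> y)) \<partial>count_space D')"
    using D' by (simp add: nn_integral_count_space_nn_integral nn_integral_cmult)
  also have "\<dots> = (\<integral>\<^sup>+y. emeasure M (ball y (2 * \<rho> y)) + ennreal ((1 / \<rho> y) powr q) * emeasure M (ball y (2 * \<rho> y)) \<partial>count_space D')"
    by (intro nn_integral_add[symmetric]) auto
  also have "\<dots> = (\<integral>\<^sup>+y. ennreal (1 + (1 / \<rho> y) powr q) * emeasure M (ball y (2 * \<rho> y)) \<partial>count_space D')"
    by (intro nn_integral_cong) (simp add: ennreal_plus distrib_right)
  finally show ?thesis .
qed

text \<open>For each positive \<open>m\<close> the set is covered by dilates of disjoint balls on
  which \<open>r powr q * N\<close> exceeds \<open>m * M\<close>. The capacity estimate of the cover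
  is then a sum of values of \<open>N\<close> divided by \<open>m\<close>, at most
  \<open>H / m\<close>.\<close>

lemma capacity_exceptional_set:
  assumes N: "finite_measure N" "sets N = sets M" and q: "0 < q"
  shows "capacity M q {x. \<forall>m::nat. \<exists>r. 0 < r \<and> r \<le> 2 \<and>
    real m * measure M (ball x r) < r powr q * measure N (ball x (\<sigma> * r))} = 0" (is "capacity M q ?E = 0")
proof -
  interpret N: finite_measure N by fact
  define E where "E = {x. \<forall>m::nat. \<exists>r. 0 < r \<and> r \<le> 2 \<and>
    real m * measure M (ball x r) < r powr q * measure N (ball x (\<sigma> * r))}"
  define H where "H = dil (6 * \<sigma>) * (2 powr q + 1) * measure N (space N)"
  have H: "0 \<le> H" unfolding H_def using dil_ge_1[of "6 * \<sigma>"] by auto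
  have bound: "capacity M q E \<le> ennreal (H / real (Suc n))" for n
  proof -
    define m where "m = real (Suc n)"
    have m: "0 < m" unfolding m_def by simp
    have "\<forall>x\<in>E. \<exists>r. 0 < r \<and> r \<le> 2 \<and> m * measure M (ball x r) < r powr q * measure N (ball x (\<sigma> * r))"
      unfolding m_def E_def by blast
    from bchoice[OF this] obtain r where r: "\<And>x. x \<in> E \<Longrightarrow> 0 < r x \<and> r x \<le> 2 \<and>
      m * measure M (ball x (r x)) < r x powr q * measure N (ball x (\<sigma> * r x))" by blast
    have pos: "0 < measure N (ball y (\<sigma> * r y))" if "y \<in> E" for y
    proof -
      have "0 < m * measure M (ball y (r y))" using r[OF that] m measure_ball_pos[of "r y" y] by simp
      then have "0 < r y powr q * measure N (ball y (\<sigma> * r y))" using r[OF that] by linarith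
      then show ?thesis by (simp add: zero_less_mult_iff)
    qed
    obtain D' where D': "countable D'" "D' \<subseteq> E" "E \<subseteq> (\<Union>y\<in>D'. ball y (3 * (\<sigma> * r y)))"
      "(\<integral>\<^sup>+y. emeasure N (ball y (\<sigma> * r y)) \<partial>count_space D') \<le> emeasure N (space N)"
    proof (rule vitali_finite_measure[OF N(1), of "space N" E "\<lambda>y. \<sigma> * r y" "\<sigma> * 2"])
      show "sets borel \<subseteq> sets N" using N(2) borel_sets by simp
      fix y assume y: "y \<in> E"
      have "space N = UNIV" using sets_eq_imp_space_eq[OF N(2)] space_eq by simp
      then show "0 < \<sigma> * r y \<and> \<sigma> * r y \<le> \<sigma> * 2 \<and> ball y (\<sigma> * r y) \<subseteq> space N \<and> 0 < measure N (ball y (\<sigma> * r y))"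
        using r[OF y] pos[OF y] \<sigma> by auto
    qed auto
    have D'E: "y \<in> E" if "y \<in> D'" for y using D'(2) that by blast
    define \<rho> where "\<rho> y = 3 * (\<sigma> * r y)" for y
    have \<rho>: "0 < \<rho> y" if "y \<in> D'" for y
      using r[OF D'E[OF that]] \<sigma> unfolding \<rho>_def by simp
    have "capacity M q E \<le> (\<integral>\<^sup>+y. ennreal (1 + (1 / \<rho> y) powr q) * emeasure M (ball y (2 * \<rho> y)) \<partial>count_space D')"
      by (rule capacity_cover_le[OF q D'(1) _ D'(3)[folded \<rho>_def]]) (rule \<rho>)
    also have "\<dots> \<le> (\<integral>\<^sup>+y. ennreal (dil (6 * \<sigma>) * (2 powr q + 1) / m) * emeasure N (ball y (\<sigma> * r y)) \<partial>count_space D')"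
    proof (intro nn_integral_mono)
      fix y assume "y \<in> space (count_space D')"
      then have y: "y \<in> D'" by simp
      note ry = r[OF D'E[OF y]]
      have "measure M (ball y (2 * \<rho> y)) \<le> dil (6 * \<sigma>) * measure M (ball y (r y))"
        using measure_ball_dil[of "r y" "6 * \<sigma>" y] ry \<sigma> unfolding \<rho>_def by (simp add: mult.assoc)
      also have "\<dots> \<le> dil (6 * \<sigma>) * (r y powr q * measure N (ball y (\<sigma> * r y)) / m)"
        using ry m dil_ge_1[of "6 * \<sigma>"] by (intro mult_left_mono) (auto simp: field_simps)
      finally have 1: "measure M (ball y (2 * \<rho> y)) \<le> dil (6 * \<sigma>) * (r y powr q * measure N (ball y (\<sigma> * r y)) / m)" .
      \<comment> \<open>The term 1, from the norm of the function, uses \<open>r \<le> 2\<close>;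
        the gradient term uses that \<open>\<rho>\<close> is at least \<open>r\<close>.\<close>
      have 2: "(1 + (1 / \<rho> y) powr q) * r y powr q \<le> 2 powr q + 1"
      proof -
        have "r y \<le> \<rho> y" using ry \<sigma> mult_right_mono[of 1 "3 * \<sigma>" "r y"] unfolding \<rho>_def by simp
        then have "(r y / \<rho> y) powr q \<le> 1"
          using \<rho>[OF y] ry q by (intro powr_le1) auto
        moreover have "(1 / \<rho> y) powr q * r y powr q = (r y / \<rho> y) powr q"
          using \<rho>[OF y] ry by (subst powr_mult[symmetric]) auto
        moreover have "r y powr q \<le> 2 powr q" using ry q by (intro powr_mono2) auto
        ultimately show ?thesis by (simp add: distrib_right)
      qed
      have "(1 + (1 / \<rho> y) powr q) * measure M (ball y (2 * \<rho> y))
        \<le> (1 + (1 / \<rho> y) powr q) * (dil (6 * \<sigma>) * (r y powr q * measure N (ball y (\<sigma> * r y)) / m))"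
        using 1 by (intro mult_left_mono) auto
      also have "\<dots> = ((1 + (1 / \<rho> y) powr q) * r y powr q) * (dil (6 * \<sigma>) / m * measure N (ball y (\<sigma> * r y)))"
        by simp
      also have "\<dots> \<le> (2 powr q + 1) * (dil (6 * \<sigma>) / m * measure N (ball y (\<sigma> * r y)))"
        using 2 m dil_ge_1[of "6 * \<sigma>"] by (intro mult_right_mono) auto
      finally have "(1 + (1 / \<rho> y) powr q) * measure M (ball y (2 * \<rho> y))
        \<le> dil (6 * \<sigma>) * (2 powr q + 1) / m * measure N (ball y (\<sigma> * r y))" by (simp add: mult_ac)
      then show "ennreal (1 + (1 / \<rho> y) powr q) * emeasure M (ball y (2 * \<rho> y))
        \<le> ennreal (dil (6 * \<sigma>) * (2 powr q + 1) / m) * emeasure N (ball y (\<sigma> * r y))"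
        using m dil_ge_1[of "6 * \<sigma>"] unfolding emeasure_ball N.emeasure_eq_measure
        by (subst (1 2) ennreal_mult'[symmetric]) (auto intro!: ennreal_leI add_nonneg_nonneg)
    qed
    also have "\<dots> = ennreal (dil (6 * \<sigma>) * (2 powr q + 1) / m) * (\<integral>\<^sup>+y. emeasure N (ball y (\<sigma> * r y)) \<partial>count_space D')"
      by (rule nn_integral_cmult) auto
    also have "\<dots> \<le> ennreal (dil (6 * \<sigma>) * (2 powr q + 1) / m) * emeasure N (space N)"
      using D'(4) by (intro mult_left_mono) auto
    also have "\<dots> = ennreal (H / m)"
      unfolding H_def N.emeasure_eq_measure using m dil_ge_1[of "6 * \<sigma>"]
      by (subst ennreal_mult'[symmetric]) auto
    finally show ?thesis unfolding m_def .
  qed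
  have "(\<lambda>n. H / real (Suc n)) \<longlonglongrightarrow> 0"
    using tendsto_mult_left[OF LIMSEQ_inverse_real_of_nat, of H] by (simp add: divide_inverse)
  then have "(\<lambda>n. ennreal (H / real (Suc n))) \<longlonglongrightarrow> ennreal 0" by (rule tendsto_ennrealI)
  then have "capacity M q E \<le> ennreal 0" using bound by (intro LIMSEQ_le_const) auto
  then show ?thesis unfolding E_def by simp
qed

end

section \<open>The theorem\<close>

lemma nn_integral_powr_less_top:
  assumes "0 < \<kappa>"
  shows "(\<integral>\<^sup>+r\<in>{0<..1}. ennreal (r powr (\<kappa> - 1)) \<partial>lborel) < \<infinity>"
proof -
  have "(\<integral>\<^sup>+r\<in>{0<..1}. ennreal (r powr (\<kappa> - 1)) \<partial>lborel)
    \<le> (\<integral>\<^sup>+r\<in>{0..1}. ennreal (r powr (\<kappa> - 1)) \<partial>lborel)"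
    by (intro nn_integral_mono) (auto simp: indicator_def)
  also have "\<dots> = ennreal (1 powr (\<kappa> - 1 + 1) / (\<kappa> - 1 + 1))"
    using assms by (intro nn_integral_has_integral_lebesgue' has_integral_powr_from_0) auto
  finally show ?thesis by (auto simp: less_top[symmetric] top_unique)
qed

text \<open>Power decay of the mean oscillation makes all three conclusions immediate; the exponent
  \<open>p / (h * (p - 1))\<close> only has to be positive.\<close>

lemma conclusions_of_power_decay:
  fixes f :: "real \<Rightarrow> ennreal"
  assumes f: "\<And>r. 0 < r \<Longrightarrow> r \<le> 1 \<Longrightarrow> f r \<le> ennreal (C * r powr \<kappa>)"
    and C: "0 \<le> C" and \<kappa>: "0 < \<kappa>" and \<beta>: "0 < \<beta>"
  shows "(\<integral>\<^sup>+r\<in>{0<..1}. epowr (f r) \<beta> / ennreal r \<partial>lborel) < \<infinity>"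
    "(\<Sum>k. epowr (f ((1/2) ^ Suc k)) \<beta>) < \<infinity>"
    "(f \<longlongrightarrow> 0) (at_right 0)"
proof -
  have ep: "epowr (f r) \<beta> \<le> ennreal (C powr \<beta> * r powr (\<kappa> * \<beta>))" if "0 < r" "r \<le> 1" for r
  proof -
    have "epowr (f r) \<beta> \<le> epowr (ennreal (C * r powr \<kappa>)) \<beta>"
      using f[OF that] \<beta> by (intro epowr_mono) auto
    also have "\<dots> = ennreal (C powr \<beta> * r powr (\<kappa> * \<beta>))"
      using C that by (simp add: epowr_ennreal powr_mult powr_powr)
    finally show ?thesis .
  qed
  have \<kappa>\<beta>: "0 < \<kappa> * \<beta>" using \<kappa> \<beta> by simp
  have "(\<integral>\<^sup>+r\<in>{0<..1}. epowr (f r) \<beta> / ennreal r \<partial>lborel)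
    \<le> (\<integral>\<^sup>+r. ennreal (C powr \<beta>) * (ennreal (r powr (\<kappa> * \<beta> - 1)) * indicator {0<..1} r) \<partial>lborel)"
  proof (rule nn_integral_mono)
    fix r :: real
    show "epowr (f r) \<beta> / ennreal r * indicator {0<..1} r
      \<le> ennreal (C powr \<beta>) * (ennreal (r powr (\<kappa> * \<beta> - 1)) * indicator {0<..1} r)"
    proof (cases "r \<in> {0<..1}")
      case True
      then have r: "0 < r" "r \<le> 1" by auto
      have "epowr (f r) \<beta> / ennreal r \<le> ennreal (C powr \<beta> * r powr (\<kappa> * \<beta>)) / ennreal r"
        by (intro divide_right_mono_ennreal ep r)
      also have "\<dots> = ennreal (C powr \<beta> * r powr (\<kappa> * \<beta>) / r)"
        using r by (intro divide_ennreal) auto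
      also have "C powr \<beta> * r powr (\<kappa> * \<beta>) / r = C powr \<beta> * r powr (\<kappa> * \<beta> - 1)"
        using r by (simp add: powr_diff)
      also have "ennreal \<dots> = ennreal (C powr \<beta>) * ennreal (r powr (\<kappa> * \<beta> - 1))"
        by (rule ennreal_mult') simp
      finally show ?thesis using True by simp
    qed simp
  qed
  also have "\<dots> = ennreal (C powr \<beta>) * (\<integral>\<^sup>+r\<in>{0<..1}. ennreal (r powr (\<kappa> * \<beta> - 1)) \<partial>lborel)"
    by (intro nn_integral_cmult) measurable
  also have "\<dots> < \<infinity>"
    using nn_integral_powr_less_top[OF \<kappa>\<beta>] by (simp add: ennreal_mult_less_top less_top)
  finally show "(\<integral>\<^sup>+r\<in>{0<..1}. epowr (f r) \<beta> / ennreal r \<partial>lborel) < \<infinity>" .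

  define b where "b = (1/2::real) powr (\<kappa> * \<beta>)"
  have b: "0 < b" "b < 1" unfolding b_def using \<kappa>\<beta> by (auto simp: powr_divide)
  have "(\<Sum>k. epowr (f ((1/2) ^ Suc k)) \<beta>) \<le> (\<Sum>k. ennreal (C powr \<beta> * b * b ^ k))"
  proof (intro suminf_le allI)
    fix k
    have "((1/2) ^ Suc k) powr (\<kappa> * \<beta>) = b ^ Suc k"
      unfolding b_def by (subst (1 2) powr_realpow[symmetric]) (auto simp: powr_powr mult.commute)
    then show "epowr (f ((1/2) ^ Suc k)) \<beta> \<le> ennreal (C powr \<beta> * b * b ^ k)"
      using ep[of "(1/2) ^ Suc k"] by (simp add: power_le_one mult.assoc del: power_Suc flip: power_Suc)
  qed (auto intro: summableI)
  also have "\<dots> = ennreal (\<Sum>k. C powr \<beta> * b * b ^ k)"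
    using b by (intro suminf_ennreal2) auto
  also have "\<dots> < \<infinity>" by simp
  finally show "(\<Sum>k. epowr (f ((1/2) ^ Suc k)) \<beta>) < \<infinity>" .

  have "((\<lambda>r. ennreal (C * r powr \<kappa>)) \<longlongrightarrow> ennreal 0) (at_right 0)"
    using tendsto_mult_left[OF powr_tendsto_0_at_right[OF \<kappa>], of C] by (intro tendsto_ennrealI) simp
  then have lim: "((\<lambda>r. ennreal (C * r powr \<kappa>)) \<longlongrightarrow> 0) (at_right 0)" by simp
  show "(f \<longlongrightarrow> 0) (at_right 0)"
  proof (rule tendsto_sandwich[OF _ _ tendsto_const lim])
    show "\<forall>\<^sub>F r in at_right 0. f r \<le> ennreal (C * r powr \<kappa>)"
      using f unfolding eventually_at_right_field by (intro exI[of _ 1]) auto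
  qed simp
qed

context doubling_metric_measure_space
begin

lemma doubling_constant_ge_1:
  assumes "\<And>x r. 0 < r \<Longrightarrow> measure M (ball x (2 * r)) \<le> D * measure M (ball x r)"
  shows "1 \<le> D"
proof -
  fix x :: 'a
  have "1 * measure M (ball x 1) \<le> measure M (ball x (2 * 1))"
    by (simp, intro measure_ball_mono subset_ball) simp
  also have "\<dots> \<le> D * measure M (ball x 1)" using assms[of 1 x] by simp
  finally show ?thesis using measure_ball_pos[of 1 x] by simp
qed

text \<open>Since \<open>r / R \<le> 1\<close>, a larger exponent only lowers the required
  bound.\<close>

lemma relative_lower_volume_decayD:
  assumes "relative_lower_volume_decay M Q" "Q \<le> Q'"
  obtains c where "0 < c" "\<And>x y r R. y \<in> ball x R \<Longrightarrow> 0 < r \<Longrightarrow> r \<le> R \<Longrightarrow>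
      c * (r / R) powr Q' * measure M (ball x R) \<le> measure M (ball y r)"
proof -
  obtain c where c: "0 < c" "\<And>x y r R. y \<in> ball x R \<Longrightarrow> 0 < r \<Longrightarrow> r \<le> R \<Longrightarrow>
      c * (r / R) powr Q \<le> measure M (ball y r) / measure M (ball x R)"
    using assms(1) unfolding relative_lower_volume_decay_def by blast
  have "c * (r / R) powr Q' * measure M (ball x R) \<le> measure M (ball y r)"
    if a: "y \<in> ball x R" "0 < r" "r \<le> R" for x y r R
  proof -
    have R: "0 < R" using a by linarith
    have "c * (r / R) powr Q' \<le> c * (r / R) powr Q"
      using assms(2) a R c(1) by (intro mult_left_mono powr_mono') auto
    also have "\<dots> \<le> measure M (ball y r) / measure M (ball x R)" by (rule c(2)[OF a])
    finally show ?thesis using measure_ball_pos[OF R, of x] by (simp add: pos_le_divide_eq)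
  qed
  with c(1) show thesis by (rule that)
qed

end

lemma larger_decay_order:
  fixes p Q h :: real
  assumes p: "1 < p"
    and "p < Q \<and> 0 < h \<and> h \<le> Q * p / (Q - p) \<or> p = Q \<and> 0 < h \<or> p > Q \<and> 0 < h"
  obtains Q' where "Q \<le> Q'" "p < Q'" "h \<le> Q' * p / (Q' - p)" "0 < h"
proof (cases "p < Q")
  case True
  then show ?thesis using assms that[of Q] by auto
next
  case False
  then have h: "0 < h" "Q \<le> p" using assms by auto
  \<comment> \<open>For the order \<open>p + d\<close> the Sobolev exponent is
    \<open>(p + d) * p / d\<close>, at least \<open>p * p / d = h\<close>.\<close>
  define d where "d = p ^ 2 / h"
  have d: "0 < d" unfolding d_def using h p by simp
  have "h = p * p / d" unfolding d_def using h p by (simp add: power2_eq_square)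
  also have "\<dots> \<le> (p + d) * p / (p + d - p)" using d p by (simp add: divide_right_mono)
  finally show ?thesis using that[of "p + d"] d h by auto
qed

theorem mainTheorem2:
  fixes M :: "'a::complete_space measure"
    and p q Q h :: real
    and u\<^sub>0 :: "'a \<Rightarrow> real"
    and u :: "'a \<Rightarrow> ereal"
  assumes "doubling_metric_measure_space M"
    and "1 < p"
    and "supports_poincare M p"
    and "0 < Q" and "relative_lower_volume_decay M Q"
    and "1 < q" and "q < p"
    and "u\<^sub>0 \<in> newtonian M p"
    and "\<And>x. u x = limsup_representative M u\<^sub>0 x"
    and "p < Q \<and> 0 < h \<and> h \<le> Q * p / (Q - p) \<or> p = Q \<and> 0 < h \<or> p > Q \<and> 0 < h"
  shows
    "quasi_everywhere M q (\<lambda>x.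
       (\<integral>\<^sup>+r\<in>{0<..1}. epowr (mean_oscillation M h u x r) (p / (h * (p - 1))) / ennreal r \<partial>lborel)
         < \<infinity>) \<and>
     quasi_everywhere M q (\<lambda>x.
       (\<Sum>k. epowr (mean_oscillation M h u x ((1/2) ^ Suc k)) (p / (h * (p - 1)))) < \<infinity>) \<and>
     quasi_everywhere M q (\<lambda>x.
       (mean_oscillation M h u x \<longlongrightarrow> 0) (at_right 0))"
proof -
  interpret doubling_metric_measure_space M by fact
  note p = assms(2) and q = assms(6,7)
  obtain Q' where Q': "Q \<le> Q'" "p < Q'" "h \<le> Q' * p / (Q' - p)" and h: "0 < h"
    by (rule larger_decay_order[OF p assms(10)])
  obtain D where D: "\<And>x r. 0 < r \<Longrightarrow> measure M (ball x (2 * r)) \<le> D * measure M (ball x r)"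
    using doubling by blast
  obtain c where c: "0 < c" "\<And>x y r R. y \<in> ball x R \<Longrightarrow> 0 < r \<Longrightarrow> r \<le> R \<Longrightarrow>
      c * (r / R) powr Q' * measure M (ball x R) \<le> measure M (ball y r)"
    by (rule relative_lower_volume_decayD[OF assms(5) Q'(1)]) (rule that, assumption, blast)
  obtain C \<sigma> where C: "0 < C" and \<sigma>: "1 \<le> \<sigma>"
    and PI: "\<And>x r u g. 0 < r \<Longrightarrow> integrable M u \<Longrightarrow> weak_upper_gradient M p u g \<Longrightarrow>
      ennreal (ball_average M (\<lambda>y. \<bar>u y - ball_average M u x r\<bar>) x r)
        \<le> ennreal (C * diameter (ball x r)) *
           epowr (ball_nn_average M (\<lambda>y. epowr (g y) p) x (\<sigma> * r)) (1 / p)"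
    using assms(3) unfolding supports_poincare_def by blast
  \<comment> \<open>\<open>2 * C\<close> because the diameter of a ball is at most twice its
    radius.\<close>
  interpret poincare_setting M p Q' D "2 * C" \<sigma> c
    by unfold_locales (use p Q' D doubling_constant_ge_1[OF D] C \<sigma> c in auto)
  obtain g where um [measurable]: "u\<^sub>0 \<in> borel_measurable M"
    and up: "(\<integral>\<^sup>+x. ennreal (\<bar>u\<^sub>0 x\<bar> powr p) \<partial>M) < \<infinity>"
    and ug: "upper_gradient u\<^sub>0 g" and gp: "(\<integral>\<^sup>+x. epowr (g x) p \<partial>M) < \<infinity>"
    using assms(8) unfolding newtonian_def by auto
  define N where "N = density M (\<lambda>y. epowr (g y) p)"
  have [measurable]: "g \<in> borel_measurable M"
    using ug unfolding upper_gradient_def by (auto intro: borel_measurable_lift)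
  have N: "finite_measure N" "sets N = sets M"
    unfolding N_def using gp by (auto intro!: finite_measureI simp: emeasure_density cong: nn_integral_cong)
  have tr: "truncation_pair u\<^sub>0 N"
  proof (rule truncation_pairI[OF _ N])
    show "locally_integrable u\<^sub>0" using assms(2) by (intro locally_integrable_Lp[OF um up]) simp
    show "ball_average M (\<lambda>y. \<bar>truncation a b (u\<^sub>0 y) - ball_average M (\<lambda>y. truncation a b (u\<^sub>0 y)) x r\<bar>) x r
      \<le> 2 * C * (r * (measure N ({y. a < u\<^sub>0 y \<and> u\<^sub>0 y < b} \<inter> ball x (\<sigma> * r)) / measure M (ball x r)) powr (1 / p))"
      if "a < b" "0 < r" for a b x r
      unfolding N_def by (rule poincare_truncation[OF PI C \<sigma> assms(2) um ug gp that])
  qed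
  then have pp: "poincare_pair u\<^sub>0 N" unfolding truncation_pair_def by blast
  \<comment> \<open>Where the averages converge, the limsup is a real limit; so \<open>u\<close> is
    real and equal to \<open>u\<^sub>0\<close> almost everywhere, and also real at every point
    outside the set \<open>E\<close> below.\<close>
  have u_eq: "u x = ereal l" if "(ball_average M u\<^sub>0 x \<longlongrightarrow> l) (at_right 0)" for x l
    unfolding assms(9) limsup_representative_def
    using that by (intro lim_imp_Limsup) (auto intro!: tendsto_intros)
  have ae: "AE y in M. u y = ereal (u\<^sub>0 y)"
    using averages_tendsto_AE[OF pp] by eventually_elim (rule u_eq)
  \<comment> \<open>One exceptional set serves all three conclusions.\<close>
  define E where "E = {x. \<forall>m::nat. \<exists>r. 0 < r \<and> r \<le> 2 \<and>
    real m * measure M (ball x r) < r powr q * measure N (ball x (\<sigma> * r))}"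
  have E: "capacity M q E = 0"
    unfolding E_def using q by (intro capacity_exceptional_set[OF N]) simp
  define \<kappa> where "\<kappa> = (1 - q / p) * h"
  have \<kappa>: "0 < \<kappa>" unfolding \<kappa>_def using q p h by simp
  have \<beta>: "0 < p / (h * (p - 1))" using p h by simp
  have decay_osc: "\<exists>C. 0 \<le> C \<and> (\<forall>r. 0 < r \<longrightarrow> r \<le> 1 \<longrightarrow> mean_oscillation M h u x r \<le> ennreal (C * r powr \<kappa>))"
    if xE: "x \<notin> E" for x
  proof -
    obtain m :: nat where "\<not> (\<exists>r. 0 < r \<and> r \<le> 2 \<and>
        real m * measure M (ball x r) < r powr q * measure N (ball x (\<sigma> * r)))"
      using xE unfolding E_def by blast
    then have m: "r powr q * measure N (ball x (\<sigma> * r)) \<le> real m * measure M (ball x r)"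
      if "0 < r" "r \<le> 2" for r
      using that not_less by blast
    have hp: "h \<le> pstar" using Q'(3) unfolding pstar_def .
    obtain l C' where C': "0 \<le> C'" and l: "(ball_average M u\<^sub>0 x \<longlongrightarrow> l) (at_right 0)"
      and bd: "\<And>R. 0 < R \<Longrightarrow> R \<le> 1 \<Longrightarrow> (\<integral>\<^sup>+y\<in>ball x R. ennreal (\<bar>u\<^sub>0 y - l\<bar> powr h) \<partial>M)
      \<le> ennreal (C' * R powr ((1 - q / p) * h) * measure M (ball x R))"
      by (rule oscillation_decay_at_point[OF tr _ q(2) h hp of_nat_0_le_iff m]) (use q in auto)
    have "mean_oscillation M h u x r \<le> ennreal (C' * r powr \<kappa>)" if r: "0 < r" "r \<le> 1" for r
    proof -
      \<comment> \<open>The variable \<open>y\<close> is handled by almost everywhere equality. This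
        says nothing about the fixed centre \<open>x\<close>, where \<open>u x = l\<close> comes
        from the convergence of the averages at \<open>x\<close>.\<close>
      have "(\<integral>\<^sup>+y\<in>ball x r. epowr (e2ennreal \<bar>u y - u x\<bar>) h \<partial>M)
        = (\<integral>\<^sup>+y\<in>ball x r. ennreal (\<bar>u\<^sub>0 y - l\<bar> powr h) \<partial>M)"
      proof (rule nn_integral_cong_AE)
        show "AE y in M. epowr (e2ennreal \<bar>u y - u x\<bar>) h * indicator (ball x r) y
          = ennreal (\<bar>u\<^sub>0 y - l\<bar> powr h) * indicator (ball x r) y"
          using ae by eventually_elim (simp add: u_eq[OF l] epowr_ennreal)
      qed
      also have "\<dots> \<le> ennreal (C' * r powr \<kappa> * measure M (ball x r))"
        using bd[OF r] unfolding \<kappa>_def .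
      finally have "mean_oscillation M h u x r
        \<le> ennreal (C' * r powr \<kappa> * measure M (ball x r)) / ennreal (measure M (ball x r))"
        unfolding mean_oscillation_def ball_nn_average_def emeasure_ball
        by (rule divide_right_mono_ennreal)
      also have "\<dots> = ennreal (C' * r powr \<kappa>)"
        using C' measure_ball_pos[OF r(1), of x] by (subst divide_ennreal) auto
      finally show ?thesis .
    qed
    with C' show ?thesis by blast
  qed
  show ?thesis
  proof (intro conjI quasi_everywhereI[OF E])
    fix x assume "x \<notin> E"
    then obtain C' where C': "0 \<le> C'"
      "\<And>r. 0 < r \<Longrightarrow> r \<le> 1 \<Longrightarrow> mean_oscillation M h u x r \<le> ennreal (C' * r powr \<kappa>)"
      using decay_osc by blast
    note concl = conclusions_of_power_decay[of "mean_oscillation M h u x", OF C'(2,1) \<kappa> \<beta>]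
    show "(\<integral>\<^sup>+r\<in>{0<..1}. epowr (mean_oscillation M h u x r) (p / (h * (p - 1))) / ennreal r \<partial>lborel) < \<infinity>"
      by (rule concl(1))
    show "(\<Sum>k. epowr (mean_oscillation M h u x ((1/2) ^ Suc k)) (p / (h * (p - 1)))) < \<infinity>"
      by (rule concl(2))
    show "(mean_oscillation M h u x \<longlongrightarrow> 0) (at_right 0)"
      by (rule concl(3))
  qed
qed

end
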